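(* Let $(R,\mathfrak{m})$ be a Noetherian local ring and $M$ a generalized Cohen-Macaulay $R$-module of dimension $d>0$. Let $n_0$ be the least positive integer such that $\mathfrak{m}^{n_0}H^{i}_\mathfrak{m}(M) = 0$ for all $i<d$. Then for every parameter element $x$ of $M$ with $x \in \mathfrak{m}^{2n_0}$ one has $$H^{i}_\mathfrak{m}(M/xM)\cong H^{i}_\mathfrak{m}(M)\oplus H^{i+1}_\mathfrak{m}(M)\quad\text{for all } i<d-1,$$ and $$0:_{H^{d-1}_\mathfrak{m}(M/xM)}\mathfrak{m}^{n_0} \;\cong\; H^{d-1}_\mathfrak{m}(M)\oplus \bigl(0:_{H^{d}_\mathfrak{m}(M)}\mathfrak{m}^{n_0}\bigr).$$
   Context: $H^i_{\mathfrak{m}}(\cdot)$ denotes the $i$-th local cohomology functor with respect to $\mathfrak{m}$. A finitely generated module $M$ of dimension $d>0$ over a Noetherian local ring $(R,\mathfrak{m})$ is called generalized Cohen-Macaulay if there is a positive integer $k$ with $\mathfrak{m}^kH^i_{\mathfrak{m}}(M)=0$ for all $i<d$. A parameter element of $M$ is an element $x\in\mathfrak{m}$ with $\dim M/xM=d-1$. For an $R$-module $N$ and an ideal $I$, $0:_N I=\{z\in N: Iz=0\}$. *)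

theory Defs
  imports "HOL-Library.Extended_Real" "HOL-Algebra.Algebra"
begin

section \<open>Modules: homomorphisms, quotients, direct sums\<close>

definition mod_hom ::
  "('a, 'r) ring_scheme \<Rightarrow> ('a, 'b) module \<Rightarrow> ('a, 'c) module \<Rightarrow> ('b \<Rightarrow> 'c) set" where
  "mod_hom R A B = {f. f \<in> carrier A \<rightarrow> carrier B
     \<and> (\<forall>x\<in>carrier A. \<forall>y\<in>carrier A. f (x \<oplus>\<^bsub>A\<^esub> y) = f x \<oplus>\<^bsub>B\<^esub> f y)
     \<and> (\<forall>r\<in>carrier R. \<forall>x\<in>carrier A. f (r \<odot>\<^bsub>A\<^esub> x) = r \<odot>\<^bsub>B\<^esub> f x)}"

definition mod_isomorphic ::
  "('a, 'r) ring_scheme \<Rightarrow> ('a, 'b) module \<Rightarrow> ('a, 'c) module \<Rightarrow> bool" where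
  "mod_isomorphic R A B \<longleftrightarrow> (\<exists>f\<in>mod_hom R A B. bij_betw f (carrier A) (carrier B))"

text \<open>The library's record of modules extends that of rings; the fields \<open>mult\<close> and \<open>one\<close>
  carry no meaning for a module and are left unspecified below.\<close>

definition mod_quot :: "('a, 'b) module \<Rightarrow> 'b set \<Rightarrow> ('a, 'b set) module" where
  "mod_quot M N = \<lparr>carrier = a_rcosets\<^bsub>M\<^esub> N, monoid.mult = undefined, monoid.one = undefined,
     ring.zero = N, ring.add = set_add M, smult = (\<lambda>r S. \<Union>x\<in>S. N +>\<^bsub>M\<^esub> (r \<odot>\<^bsub>M\<^esub> x))\<rparr>"

definition mod_sum :: "('a, 'b) module \<Rightarrow> ('a, 'c) module \<Rightarrow> ('a, 'b \<times> 'c) module" where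
  "mod_sum A B = \<lparr>carrier = carrier A \<times> carrier B, monoid.mult = undefined, monoid.one = undefined,
     ring.zero = (\<zero>\<^bsub>A\<^esub>, \<zero>\<^bsub>B\<^esub>),
     ring.add = (\<lambda>(a, b) (a', b'). (a \<oplus>\<^bsub>A\<^esub> a', b \<oplus>\<^bsub>B\<^esub> b')),
     smult = (\<lambda>r (a, b). (r \<odot>\<^bsub>A\<^esub> a, r \<odot>\<^bsub>B\<^esub> b))\<rparr>"

definition finitely_generated_module :: "('a, 'r) ring_scheme \<Rightarrow> ('a, 'b) module \<Rightarrow> bool" where
  "finitely_generated_module R M \<longleftrightarrow> module R M \<and>
     (\<exists>S. finite S \<and> S \<subseteq> carrier M \<and> \<Inter>{N. submodule N R M \<and> S \<subseteq> N} = carrier M)"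

definition mod_smult_image :: "'a \<Rightarrow> ('a, 'b) module \<Rightarrow> 'b set" where
  "mod_smult_image x M = {x \<odot>\<^bsub>M\<^esub> z | z. z \<in> carrier M}"


section \<open>Ideals, local rings, dimension\<close>

abbreviation ideal_power :: "('a, 'r) ring_scheme \<Rightarrow> 'a set \<Rightarrow> nat \<Rightarrow> 'a set" where
  "ideal_power R I n \<equiv> I [^]\<^bsub>ideals_set R\<^esub> n"

definition noetherian_local_ring :: "('a, 'r) ring_scheme \<Rightarrow> 'a set \<Rightarrow> bool" where
  "noetherian_local_ring R \<mm> \<longleftrightarrow> cring R \<and> noetherian_ring R \<and> maximalideal \<mm> R
     \<and> (\<forall>J. maximalideal J R \<longrightarrow> J = \<mm>)"

definition kills :: "'a set \<Rightarrow> ('a, 'b) module \<Rightarrow> bool" where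
  "kills I N \<longleftrightarrow> (\<forall>a\<in>I. \<forall>z\<in>carrier N. a \<odot>\<^bsub>N\<^esub> z = \<zero>\<^bsub>N\<^esub>)"

text \<open>The submodule \<open>0 :\<^sub>N I\<close>.\<close>

definition zero_colon :: "('a, 'b) module \<Rightarrow> 'a set \<Rightarrow> ('a, 'b) module" where
  "zero_colon N I = N\<lparr>carrier := {z \<in> carrier N. \<forall>a\<in>I. a \<odot>\<^bsub>N\<^esub> z = \<zero>\<^bsub>N\<^esub>}\<rparr>"

definition mod_annihilator :: "('a, 'r) ring_scheme \<Rightarrow> ('a, 'b) module \<Rightarrow> 'a set" where
  "mod_annihilator R M = {a \<in> carrier R. \<forall>z\<in>carrier M. a \<odot>\<^bsub>M\<^esub> z = \<zero>\<^bsub>M\<^esub>}"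

text \<open>The Krull dimension of \<open>R / Ann M\<close>, for finitely generated \<open>M\<close>: the supremum of the lengths
  of chains of primes containing \<open>Ann M\<close>. The zero module has no such chain and gets \<open>-\<infinity>\<close>.\<close>

definition mod_dim :: "('a, 'r) ring_scheme \<Rightarrow> ('a, 'b) module \<Rightarrow> ereal" where
  "mod_dim R M = (SUP n \<in> {n::nat. \<exists>p. (\<forall>i\<le>n. primeideal (p i) R \<and> mod_annihilator R M \<subseteq> p i)
     \<and> (\<forall>i<n. p i \<subset> p (Suc i))}. ereal (real n))"

definition parameter_element ::
  "('a, 'r) ring_scheme \<Rightarrow> 'a set \<Rightarrow> ('a, 'b) module \<Rightarrow> 'a \<Rightarrow> bool" where
  "parameter_element R \<mm> M x \<longleftrightarrow>
     x \<in> \<mm> \<and> mod_dim R (mod_quot M (mod_smult_image x M)) = mod_dim R M - 1"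


section \<open>Injective modules\<close>

text \<open>A HOL definition cannot quantify over the types that carry the test modules. They are taken
  with elements in the type of the ring, which contains \<open>R\<close> and its ideals; by Baer's criterion this
  gives the extension property for test modules in all types, see \<open>injective_module_extension\<close>.\<close>

definition injective_module :: "('a, 'r) ring_scheme \<Rightarrow> ('a, 'e) module \<Rightarrow> bool" where
  "injective_module R E \<longleftrightarrow> module R E \<and>
     (\<forall>(A :: ('a, 'a) module) (B :: ('a, 'a) module) f g.
        module R A \<and> module R B \<and> f \<in> mod_hom R A B \<and> inj_on f (carrier A) \<and> g \<in> mod_hom R A E
        \<longrightarrow> (\<exists>h\<in>mod_hom R B E. \<forall>a\<in>carrier A. h (f a) = g a))"

lemma injective_moduleD:
  fixes A B :: "('a, 'a) module"
  assumes "injective_module R E" "module R A" "module R B" "f \<in> mod_hom R A B"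
    "inj_on f (carrier A)" "g \<in> mod_hom R A E"
  shows "\<exists>h\<in>mod_hom R B E. \<forall>a\<in>carrier A. h (f a) = g a"
  using assms unfolding injective_module_def by blast

definition ring_as_module :: "('a, 'r) ring_scheme \<Rightarrow> ('a, 'a) module" where
  "ring_as_module R = \<lparr>carrier = carrier R, monoid.mult = monoid.mult R, monoid.one = monoid.one R,
     ring.zero = ring.zero R, ring.add = ring.add R, smult = monoid.mult R\<rparr>"

lemma module_ring_as_module:
  assumes "cring R"
  shows "module R (ring_as_module R)"
proof -
  interpret cring R by fact
  show ?thesis
  proof (rule moduleI)
    show "abelian_group (ring_as_module R)"
    proof (rule abelian_groupI)
      fix x assume "x \<in> carrier (ring_as_module R)"
      then show "\<exists>y\<in>carrier (ring_as_module R).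
          y \<oplus>\<^bsub>ring_as_module R\<^esub> x = \<zero>\<^bsub>ring_as_module R\<^esub>"
        by (intro bexI[of _ "\<ominus>\<^bsub>R\<^esub> x"]) (auto simp: ring_as_module_def l_neg)
    qed (auto simp: ring_as_module_def a_ac)
  qed (auto simp: ring_as_module_def assms l_distr r_distr m_assoc)
qed

text \<open>Graphs of homomorphisms from submodules of \<open>B\<close> to \<open>E\<close>.\<close>

definition partial_hom_graph ::
  "('a, 'r) ring_scheme \<Rightarrow> ('a, 'b) module \<Rightarrow> ('a, 'e) module \<Rightarrow> ('b \<times> 'e) set \<Rightarrow> bool" where
  "partial_hom_graph R B E G \<longleftrightarrow> G \<subseteq> carrier B \<times> carrier E \<and> (\<zero>\<^bsub>B\<^esub>, \<zero>\<^bsub>E\<^esub>) \<in> G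
     \<and> (\<forall>u v u' v'. (u, v) \<in> G \<and> (u', v') \<in> G \<longrightarrow> (u \<oplus>\<^bsub>B\<^esub> u', v \<oplus>\<^bsub>E\<^esub> v') \<in> G)
     \<and> (\<forall>r\<in>carrier R. \<forall>u v. (u, v) \<in> G \<longrightarrow> (r \<odot>\<^bsub>B\<^esub> u, r \<odot>\<^bsub>E\<^esub> v) \<in> G)
     \<and> (\<forall>v. (\<zero>\<^bsub>B\<^esub>, v) \<in> G \<longrightarrow> v = \<zero>\<^bsub>E\<^esub>)"

lemma partial_hom_graph_unique:
  assumes "module R B" "module R E" "partial_hom_graph R B E G" "(u, v) \<in> G" "(u, w) \<in> G"
  shows "v = w"
proof -
  interpret B: module R B by fact
  interpret E: module R E by fact
  have G: "u \<in> carrier B" "v \<in> carrier E" "w \<in> carrier E"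
    using assms unfolding partial_hom_graph_def by auto
  have "(\<ominus>\<^bsub>R\<^esub> \<one>\<^bsub>R\<^esub> \<odot>\<^bsub>B\<^esub> u, \<ominus>\<^bsub>R\<^esub> \<one>\<^bsub>R\<^esub> \<odot>\<^bsub>E\<^esub> w) \<in> G"
    using assms unfolding partial_hom_graph_def by blast
  then have "(\<ominus>\<^bsub>B\<^esub> u, \<ominus>\<^bsub>E\<^esub> w) \<in> G"
    using G by (simp add: B.smult_l_minus E.smult_l_minus)
  then have "(u \<oplus>\<^bsub>B\<^esub> \<ominus>\<^bsub>B\<^esub> u, v \<oplus>\<^bsub>E\<^esub> \<ominus>\<^bsub>E\<^esub> w) \<in> G"
    using assms unfolding partial_hom_graph_def by blast
  then have "v \<oplus>\<^bsub>E\<^esub> \<ominus>\<^bsub>E\<^esub> w = \<zero>\<^bsub>E\<^esub>"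
    using assms G unfolding partial_hom_graph_def by (auto simp: B.M.r_neg)
  then show ?thesis using G by (metis E.M.minus_equality E.M.minus_minus E.M.a_inv_closed E.M.a_comm)
qed

lemma partial_hom_graph_step:
  assumes inj: "injective_module R E" and B: "module R B" and G: "partial_hom_graph R B E G"
    and b: "b \<in> carrier B"
  shows "\<exists>G'. partial_hom_graph R B E G' \<and> G \<subseteq> G' \<and> b \<in> fst ` G'"
proof -
  have E: "module R E" using inj unfolding injective_module_def by blast
  interpret B: module R B by fact
  interpret E: module R E by fact
  interpret Rm: module R "ring_as_module R" by (rule module_ring_as_module) unfold_locales
  note Gd = G[unfolded partial_hom_graph_def]
  have GC: "u \<in> carrier B \<and> v \<in> carrier E" if "(u, v) \<in> G" for u v using Gd that by auto
  have Gadd: "(u \<oplus>\<^bsub>B\<^esub> u', v \<oplus>\<^bsub>E\<^esub> v') \<in> G" if "(u, v) \<in> G" "(u', v') \<in> G" for u v u' v'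
    using Gd that by blast
  have Gsm: "(r \<odot>\<^bsub>B\<^esub> u, r \<odot>\<^bsub>E\<^esub> v) \<in> G" if "(u, v) \<in> G" "r \<in> carrier R" for r u v
    using Gd that by blast
  have G0: "(\<zero>\<^bsub>B\<^esub>, \<zero>\<^bsub>E\<^esub>) \<in> G" and Gz: "\<And>v. (\<zero>\<^bsub>B\<^esub>, v) \<in> G \<Longrightarrow> v = \<zero>\<^bsub>E\<^esub>" using Gd by auto
  note uniq = partial_hom_graph_unique[OF B E G]
  define I where "I = {r \<in> carrier R. r \<odot>\<^bsub>B\<^esub> b \<in> fst ` G}"
  define \<phi> where "\<phi> r = (THE v. (r \<odot>\<^bsub>B\<^esub> b, v) \<in> G)" for r
  have \<phi>I: "\<phi> r = v" if "(r \<odot>\<^bsub>B\<^esub> b, v) \<in> G" for r v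
    unfolding \<phi>_def using that uniq by blast
  have \<phi>: "(r \<odot>\<^bsub>B\<^esub> b, \<phi> r) \<in> G" if "r \<in> I" for r
  proof -
    from that obtain v where "(r \<odot>\<^bsub>B\<^esub> b, v) \<in> G" unfolding I_def by force
    then show ?thesis using \<phi>I by metis
  qed
  have Iadd: "r \<oplus>\<^bsub>R\<^esub> s \<in> I \<and> \<phi> (r \<oplus>\<^bsub>R\<^esub> s) = \<phi> r \<oplus>\<^bsub>E\<^esub> \<phi> s" if "r \<in> I" "s \<in> I" for r s
  proof -
    have rs: "r \<in> carrier R" "s \<in> carrier R" using that unfolding I_def by auto
    have "((r \<oplus>\<^bsub>R\<^esub> s) \<odot>\<^bsub>B\<^esub> b, \<phi> r \<oplus>\<^bsub>E\<^esub> \<phi> s) \<in> G"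
      using Gadd[OF \<phi>[OF that(1)] \<phi>[OF that(2)]] rs b by (simp add: B.smult_l_distr)
    then show ?thesis using \<phi>I rs unfolding I_def by force
  qed
  have Ism: "r \<otimes>\<^bsub>R\<^esub> s \<in> I \<and> \<phi> (r \<otimes>\<^bsub>R\<^esub> s) = r \<odot>\<^bsub>E\<^esub> \<phi> s" if "r \<in> carrier R" "s \<in> I" for r s
  proof -
    have rs: "s \<in> carrier R" using that unfolding I_def by auto
    have "((r \<otimes>\<^bsub>R\<^esub> s) \<odot>\<^bsub>B\<^esub> b, r \<odot>\<^bsub>E\<^esub> \<phi> s) \<in> G"
      using Gsm[OF \<phi>[OF that(2)] that(1)] rs that(1) b by (simp add: B.smult_assoc1)
    then show ?thesis using \<phi>I rs that(1) unfolding I_def by force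
  qed
  have I0: "\<zero>\<^bsub>R\<^esub> \<in> I" using b G0 unfolding I_def by force
  have Ic: "I \<subseteq> carrier R" unfolding I_def by auto
  have Ineg: "\<ominus>\<^bsub>R\<^esub> r \<in> I" if "r \<in> I" for r
    using Ism[of "\<ominus>\<^bsub>R\<^esub> \<one>\<^bsub>R\<^esub>" r] that Ic by (auto simp: B.R.l_minus)
  let ?A = "(ring_as_module R)\<lparr>carrier := I\<rparr>"
  have "submodule I R (ring_as_module R)"
  proof (rule Rm.submoduleI)
    fix a assume a: "a \<in> I"
    have "\<ominus>\<^bsub>ring_as_module R\<^esub> a = \<ominus>\<^bsub>R\<^esub> a"
      using a Ic by (intro Rm.M.minus_equality) (auto simp: ring_as_module_def B.R.l_neg)
    then show "\<ominus>\<^bsub>ring_as_module R\<^esub> a \<in> I" using Ineg a by simp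
  qed (use I0 Ic Iadd Ism in \<open>auto simp: ring_as_module_def\<close>)
  then have A: "module R ?A"
    using submodule.submodule_is_module Rm.module_axioms by blast
  have "\<exists>h\<in>mod_hom R (ring_as_module R) E. \<forall>a\<in>carrier ?A. h (id a) = \<phi> a"
  proof (rule injective_moduleD[OF inj A Rm.module_axioms])
    show "id \<in> mod_hom R ?A (ring_as_module R)"
      using Ic by (auto simp: mod_hom_def ring_as_module_def)
    show "\<phi> \<in> mod_hom R ?A E"
      using Iadd Ism \<phi> GC by (fastforce simp: mod_hom_def ring_as_module_def)
  qed simp
  then obtain h where h: "h \<in> mod_hom R (ring_as_module R) E" "\<And>a. a \<in> I \<Longrightarrow> h a = \<phi> a"
    by auto
  define e where "e = h \<one>\<^bsub>R\<^esub>"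
  have e: "e \<in> carrier E" using h(1) unfolding e_def mod_hom_def ring_as_module_def by auto
  have he: "h r = r \<odot>\<^bsub>E\<^esub> e" if "r \<in> carrier R" for r
  proof -
    have "h (r \<otimes>\<^bsub>R\<^esub> \<one>\<^bsub>R\<^esub>) = r \<odot>\<^bsub>E\<^esub> h \<one>\<^bsub>R\<^esub>"
      using h(1) that unfolding mod_hom_def ring_as_module_def by (simp del: B.R.r_one)
    then show ?thesis using that by (simp add: e_def)
  qed
  have \<phi>e: "(r \<odot>\<^bsub>B\<^esub> b, r \<odot>\<^bsub>E\<^esub> e) \<in> G" if "r \<in> I" for r
    using \<phi>[OF that] h(2)[OF that] he that Ic by auto
  define G' where "G' = {(u \<oplus>\<^bsub>B\<^esub> r \<odot>\<^bsub>B\<^esub> b, v \<oplus>\<^bsub>E\<^esub> r \<odot>\<^bsub>E\<^esub> e) | u v r. (u, v) \<in> G \<and> r \<in> carrier R}"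
  have G'I: "(s, t) \<in> G'"
    if "s = u \<oplus>\<^bsub>B\<^esub> r \<odot>\<^bsub>B\<^esub> b" "t = v \<oplus>\<^bsub>E\<^esub> r \<odot>\<^bsub>E\<^esub> e" "(u, v) \<in> G" "r \<in> carrier R" for s t u v r
    using that unfolding G'_def by blast
  have "partial_hom_graph R B E G'"
    unfolding partial_hom_graph_def
  proof (intro conjI allI impI ballI)
    show "G' \<subseteq> carrier B \<times> carrier E" using GC b e unfolding G'_def by blast
    show "(\<zero>\<^bsub>B\<^esub>, \<zero>\<^bsub>E\<^esub>) \<in> G'" by (rule G'I[OF _ _ G0 B.R.zero_closed]) (use b e in auto)
  next
    fix u v u' v' assume "(u, v) \<in> G' \<and> (u', v') \<in> G'"
    then obtain p q r p' q' r' where *: "(p, q) \<in> G" "(p', q') \<in> G" "r \<in> carrier R" "r' \<in> carrier R"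
      "u = p \<oplus>\<^bsub>B\<^esub> r \<odot>\<^bsub>B\<^esub> b" "v = q \<oplus>\<^bsub>E\<^esub> r \<odot>\<^bsub>E\<^esub> e" "u' = p' \<oplus>\<^bsub>B\<^esub> r' \<odot>\<^bsub>B\<^esub> b" "v' = q' \<oplus>\<^bsub>E\<^esub> r' \<odot>\<^bsub>E\<^esub> e"
      unfolding G'_def by blast
    show "(u \<oplus>\<^bsub>B\<^esub> u', v \<oplus>\<^bsub>E\<^esub> v') \<in> G'"
      by (rule G'I[OF _ _ Gadd[OF *(1,2)] B.R.a_closed[OF *(3,4)]])
        (use * GC b e in \<open>auto simp: B.smult_l_distr E.smult_l_distr B.M.a_ac E.M.a_ac\<close>)
  next
    fix s u v assume s: "s \<in> carrier R" and "(u, v) \<in> G'"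
    then obtain p q r where *: "(p, q) \<in> G" "r \<in> carrier R"
      "u = p \<oplus>\<^bsub>B\<^esub> r \<odot>\<^bsub>B\<^esub> b" "v = q \<oplus>\<^bsub>E\<^esub> r \<odot>\<^bsub>E\<^esub> e"
      unfolding G'_def by blast
    show "(s \<odot>\<^bsub>B\<^esub> u, s \<odot>\<^bsub>E\<^esub> v) \<in> G'"
      by (rule G'I[OF _ _ Gsm[OF *(1) s] B.R.m_closed[OF s *(2)]])
        (use * s GC b e in \<open>auto simp: B.smult_r_distr E.smult_r_distr B.smult_assoc1 E.smult_assoc1\<close>)
  next
    fix v assume "(\<zero>\<^bsub>B\<^esub>, v) \<in> G'"
    then obtain p q r where *: "(p, q) \<in> G" "r \<in> carrier R"
      "\<zero>\<^bsub>B\<^esub> = p \<oplus>\<^bsub>B\<^esub> r \<odot>\<^bsub>B\<^esub> b" "v = q \<oplus>\<^bsub>E\<^esub> r \<odot>\<^bsub>E\<^esub> e"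
      unfolding G'_def by blast
    have pq: "p \<in> carrier B" "q \<in> carrier E" using GC *(1) by auto
    have "p = \<ominus>\<^bsub>B\<^esub> (r \<odot>\<^bsub>B\<^esub> b)"
      using *(2,3) pq b B.M.minus_equality[of p "r \<odot>\<^bsub>B\<^esub> b"] by auto
    then have "\<ominus>\<^bsub>R\<^esub> \<one>\<^bsub>R\<^esub> \<odot>\<^bsub>B\<^esub> p = r \<odot>\<^bsub>B\<^esub> b"
      using *(2) pq b by (simp add: B.smult_l_minus)
    then have "(r \<odot>\<^bsub>B\<^esub> b, \<ominus>\<^bsub>R\<^esub> \<one>\<^bsub>R\<^esub> \<odot>\<^bsub>E\<^esub> q) \<in> G"
      using Gsm[OF *(1), of "\<ominus>\<^bsub>R\<^esub> \<one>\<^bsub>R\<^esub>"] by simp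
    then have "r \<in> I" using *(2) unfolding I_def by force
    then have "(\<zero>\<^bsub>B\<^esub>, v) \<in> G" using Gadd[OF *(1) \<phi>e] *(3,4) by simp
    then show "v = \<zero>\<^bsub>E\<^esub>" by (rule Gz)
  qed
  moreover have "G \<subseteq> G'"
  proof
    fix z assume "z \<in> G"
    then obtain u v where z: "z = (u, v)" "(u, v) \<in> G" by (cases z) auto
    show "z \<in> G'" unfolding z(1)
      by (rule G'I[OF _ _ z(2) B.R.zero_closed]) (use GC[OF z(2)] b e in auto)
  qed
  moreover have "(b, e) \<in> G'"
    by (rule G'I[OF _ _ G0 B.R.one_closed]) (use b e in auto)
  then have "b \<in> fst ` G'" by force
  ultimately show ?thesis by blast
qed

text \<open>Baer's criterion: the universe of test modules in the definition is immaterial.\<close>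

theorem injective_module_extension:
  fixes A :: "('a, 'b) module" and B :: "('a, 'c) module"
  assumes inj: "injective_module R E" and A: "module R A" and B: "module R B"
    and f: "f \<in> mod_hom R A B" "inj_on f (carrier A)" and g: "g \<in> mod_hom R A E"
  shows "\<exists>h\<in>mod_hom R B E. \<forall>a\<in>carrier A. h (f a) = g a"
proof -
  have E: "module R E" using inj unfolding injective_module_def by blast
  interpret A: module R A by fact
  interpret B: module R B by fact
  interpret E: module R E by fact
  have fc: "f a \<in> carrier B" "g a \<in> carrier E" if "a \<in> carrier A" for a
    using f g that unfolding mod_hom_def by auto
  have fadd: "f (a \<oplus>\<^bsub>A\<^esub> a') = f a \<oplus>\<^bsub>B\<^esub> f a'" "g (a \<oplus>\<^bsub>A\<^esub> a') = g a \<oplus>\<^bsub>E\<^esub> g a'"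
    if "a \<in> carrier A" "a' \<in> carrier A" for a a' using f g that unfolding mod_hom_def by auto
  have fsm: "f (r \<odot>\<^bsub>A\<^esub> a) = r \<odot>\<^bsub>B\<^esub> f a" "g (r \<odot>\<^bsub>A\<^esub> a) = r \<odot>\<^bsub>E\<^esub> g a"
    if "r \<in> carrier R" "a \<in> carrier A" for r a using f g that unfolding mod_hom_def by auto
  have f0: "f \<zero>\<^bsub>A\<^esub> = \<zero>\<^bsub>B\<^esub>" "g \<zero>\<^bsub>A\<^esub> = \<zero>\<^bsub>E\<^esub>"
    using fsm[of "\<zero>\<^bsub>R\<^esub>" "\<zero>\<^bsub>A\<^esub>"] fc[of "\<zero>\<^bsub>A\<^esub>"] by auto
  define G0 where "G0 = (\<lambda>a. (f a, g a)) ` carrier A"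
  have G0I: "(s, t) \<in> G0" if "s = f a" "t = g a" "a \<in> carrier A" for s t a
    using that unfolding G0_def by blast
  have G0: "partial_hom_graph R B E G0"
    unfolding partial_hom_graph_def
  proof (intro conjI allI impI ballI)
    show "G0 \<subseteq> carrier B \<times> carrier E" using fc unfolding G0_def by blast
    show "(\<zero>\<^bsub>B\<^esub>, \<zero>\<^bsub>E\<^esub>) \<in> G0" using f0 by (intro G0I[of _ "\<zero>\<^bsub>A\<^esub>"]) auto
  next
    fix u v u' v' assume "(u, v) \<in> G0 \<and> (u', v') \<in> G0"
    then obtain a a' where "a \<in> carrier A" "a' \<in> carrier A" "u = f a" "v = g a" "u' = f a'" "v' = g a'"
      unfolding G0_def by blast
    then show "(u \<oplus>\<^bsub>B\<^esub> u', v \<oplus>\<^bsub>E\<^esub> v') \<in> G0" by (intro G0I[of _ "a \<oplus>\<^bsub>A\<^esub> a'"]) (auto simp: fadd)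
  next
    fix s u v assume s: "s \<in> carrier R" and "(u, v) \<in> G0"
    then obtain a where "a \<in> carrier A" "u = f a" "v = g a" unfolding G0_def by blast
    then show "(s \<odot>\<^bsub>B\<^esub> u, s \<odot>\<^bsub>E\<^esub> v) \<in> G0" using s by (intro G0I[of _ "s \<odot>\<^bsub>A\<^esub> a"]) (auto simp: fsm)
  next
    fix v assume "(\<zero>\<^bsub>B\<^esub>, v) \<in> G0"
    then obtain a where a: "a \<in> carrier A" "\<zero>\<^bsub>B\<^esub> = f a" "v = g a" unfolding G0_def by blast
    then have "a = \<zero>\<^bsub>A\<^esub>" using f(2) f0(1) by (metis A.M.zero_closed inj_onD)
    then show "v = \<zero>\<^bsub>E\<^esub>" using a f0 by simp
  qed
  define \<G> where "\<G> = {G. partial_hom_graph R B E G \<and> G0 \<subseteq> G}"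
  have "\<exists>G\<in>\<G>. \<forall>S\<in>\<G>. G \<subseteq> S \<longrightarrow> S = G"
  proof (rule subset_Zorn_nonempty)
    show "\<G> \<noteq> {}" using G0 unfolding \<G>_def by blast
  next
    fix C assume ne: "C \<noteq> {}" and "subset.chain \<G> C"
    then have C: "C \<subseteq> \<G>" and tot: "\<And>S T. S \<in> C \<Longrightarrow> T \<in> C \<Longrightarrow> S \<subseteq> T \<or> T \<subseteq> S"
      unfolding subset.chain_def by blast+
    have CG: "partial_hom_graph R B E S" "G0 \<subseteq> S" if "S \<in> C" for S using C that unfolding \<G>_def by auto
    have "partial_hom_graph R B E (\<Union>C)"
      unfolding partial_hom_graph_def
    proof (intro conjI allI impI ballI)
      show "\<Union>C \<subseteq> carrier B \<times> carrier E" using CG unfolding partial_hom_graph_def by blast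
      show "(\<zero>\<^bsub>B\<^esub>, \<zero>\<^bsub>E\<^esub>) \<in> \<Union>C" using CG ne unfolding partial_hom_graph_def by blast
    next
      fix u v u' v' assume "(u, v) \<in> \<Union>C \<and> (u', v') \<in> \<Union>C"
      then obtain S where "S \<in> C" "(u, v) \<in> S" "(u', v') \<in> S" using tot by blast
      then show "(u \<oplus>\<^bsub>B\<^esub> u', v \<oplus>\<^bsub>E\<^esub> v') \<in> \<Union>C"
        using CG(1) unfolding partial_hom_graph_def by blast
    next
      fix s u v assume s: "s \<in> carrier R" and "(u, v) \<in> \<Union>C"
      then show "(s \<odot>\<^bsub>B\<^esub> u, s \<odot>\<^bsub>E\<^esub> v) \<in> \<Union>C"
        using CG(1) unfolding partial_hom_graph_def by blast
    next
      fix v assume "(\<zero>\<^bsub>B\<^esub>, v) \<in> \<Union>C"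
      then show "v = \<zero>\<^bsub>E\<^esub>" using CG(1) unfolding partial_hom_graph_def by blast
    qed
    then show "\<Union>C \<in> \<G>" using CG(2) ne unfolding \<G>_def by blast
  qed
  then obtain G where G\<G>: "G \<in> \<G>" and max\<G>: "\<And>S. S \<in> \<G> \<Longrightarrow> G \<subseteq> S \<Longrightarrow> S = G"
    by meson
  have G: "partial_hom_graph R B E G" "G0 \<subseteq> G" using G\<G> unfolding \<G>_def by auto
  have max: "S = G" if "partial_hom_graph R B E S" "G \<subseteq> S" for S
    by (rule max\<G>) (use that G in \<open>auto simp: \<G>_def\<close>)
  note uniq = partial_hom_graph_unique[OF B E G(1)]
  have tot: "\<exists>v. (b, v) \<in> G" if "b \<in> carrier B" for b
    using partial_hom_graph_step[OF inj B G(1) that] max by force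
  define h where "h b = (THE v. (b, v) \<in> G)" for b
  have hI: "h b = v" if "(b, v) \<in> G" for b v unfolding h_def using that uniq by blast
  have hG: "(b, h b) \<in> G" if "b \<in> carrier B" for b using tot[OF that] hI by metis
  have "h \<in> mod_hom R B E"
    unfolding mod_hom_def
  proof (intro CollectI conjI ballI)
    show "h \<in> carrier B \<rightarrow> carrier E" using hG G(1) unfolding partial_hom_graph_def by blast
  next
    fix x y assume "x \<in> carrier B" "y \<in> carrier B"
    then have "(x \<oplus>\<^bsub>B\<^esub> y, h x \<oplus>\<^bsub>E\<^esub> h y) \<in> G"
      using hG[of x] hG[of y] G(1) by (simp add: partial_hom_graph_def)
    then show "h (x \<oplus>\<^bsub>B\<^esub> y) = h x \<oplus>\<^bsub>E\<^esub> h y" by (rule hI)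
  next
    fix r x assume "r \<in> carrier R" "x \<in> carrier B"
    then have "(r \<odot>\<^bsub>B\<^esub> x, r \<odot>\<^bsub>E\<^esub> h x) \<in> G" using hG[of x] G(1) by (simp add: partial_hom_graph_def)
    then show "h (r \<odot>\<^bsub>B\<^esub> x) = r \<odot>\<^bsub>E\<^esub> h x" by (rule hI)
  qed
  moreover have "h (f a) = g a" if "a \<in> carrier A" for a
    using that G(2) G0I by (intro hI) blast
  ultimately show ?thesis by blast
qed


section \<open>Local cohomology\<close>

text \<open>Complexes \<open>E\<^sup>0 \<rightarrow> E\<^sup>1 \<rightarrow> \<dots>\<close>; only the values of \<open>diff C n\<close> on the carrier of \<open>obj C n\<close> matter.\<close>

record ('a, 'e) cochain_complex =
  obj :: "nat \<Rightarrow> ('a, 'e) module"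
  diff :: "nat \<Rightarrow> 'e \<Rightarrow> 'e"

text \<open>Exactness of \<open>0 \<rightarrow> M \<rightarrow> E\<^sup>0 \<rightarrow> E\<^sup>1 \<rightarrow> \<dots>\<close> with augmentation \<open>\<epsilon>\<close> and all \<open>E\<^sup>n\<close> injective.\<close>

definition injective_resolution ::
  "('a, 'r) ring_scheme \<Rightarrow> ('a, 'b) module \<Rightarrow> ('b \<Rightarrow> 'e) \<Rightarrow> ('a, 'e) cochain_complex \<Rightarrow> bool" where
  "injective_resolution R M \<epsilon> C \<longleftrightarrow>
     (\<forall>n. injective_module R (obj C n)) \<and>
     \<epsilon> \<in> mod_hom R M (obj C 0) \<and>
     (\<forall>n. diff C n \<in> mod_hom R (obj C n) (obj C (Suc n))) \<and>
     inj_on \<epsilon> (carrier M) \<and>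
     a_kernel (obj C 0) (obj C 1) (diff C 0) = \<epsilon> ` carrier M \<and>
     (\<forall>n. a_kernel (obj C (Suc n)) (obj C (Suc (Suc n))) (diff C (Suc n))
          = diff C n ` carrier (obj C n))"

text \<open>The \<open>I\<close>-torsion functor; on homomorphisms it is restriction.\<close>

definition torsion_submodule :: "('a, 'r) ring_scheme \<Rightarrow> 'a set \<Rightarrow> ('a, 'b) module \<Rightarrow> ('a, 'b) module" where
  "torsion_submodule R I N =
     N\<lparr>carrier := {z \<in> carrier N. \<exists>n::nat. \<forall>a\<in>ideal_power R I n. a \<odot>\<^bsub>N\<^esub> z = \<zero>\<^bsub>N\<^esub>}\<rparr>"

definition torsion_complex ::
  "('a, 'r) ring_scheme \<Rightarrow> 'a set \<Rightarrow> ('a, 'e) cochain_complex \<Rightarrow> ('a, 'e) cochain_complex" where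
  "torsion_complex R I C = \<lparr>obj = (\<lambda>n. torsion_submodule R I (obj C n)), diff = diff C\<rparr>"

definition coboundaries :: "('a, 'e) cochain_complex \<Rightarrow> nat \<Rightarrow> 'e set" where
  "coboundaries C i =
     (case i of 0 \<Rightarrow> {\<zero>\<^bsub>obj C 0\<^esub>} | Suc j \<Rightarrow> diff C j ` carrier (obj C j))"

definition cohomology :: "('a, 'e) cochain_complex \<Rightarrow> nat \<Rightarrow> ('a, 'e set) module" where
  "cohomology C i =
     mod_quot ((obj C i)\<lparr>carrier := a_kernel (obj C i) (obj C (Suc i)) (diff C i)\<rparr>) (coboundaries C i)"

text \<open>If \<open>C\<close> is an injective resolution of \<open>M\<close>, this is the value on \<open>M\<close> of the \<open>i\<close>-th right derived
  functor of the \<open>I\<close>-torsion functor. As usual it depends on \<open>C\<close> only up to isomorphism.\<close>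

definition local_cohomology ::
  "('a, 'r) ring_scheme \<Rightarrow> 'a set \<Rightarrow> ('a, 'e) cochain_complex \<Rightarrow> nat \<Rightarrow> ('a, 'e set) module" where
  "local_cohomology R I C i = cohomology (torsion_complex R I C) i"

text \<open>\<open>C\<close> is to be an injective resolution of \<open>M\<close>; it only serves to compute \<open>H\<^sup>i(M)\<close>.\<close>

definition generalized_Cohen_Macaulay ::
  "('a, 'r) ring_scheme \<Rightarrow> 'a set \<Rightarrow> ('a, 'b) module \<Rightarrow> ('a, 'e) cochain_complex \<Rightarrow> nat \<Rightarrow> bool" where
  "generalized_Cohen_Macaulay R \<mm> M C d \<longleftrightarrow>
     finitely_generated_module R M \<and> mod_dim R M = ereal (real d) \<and> 0 < d \<and>
     (\<exists>k::nat. 0 < k \<and> (\<forall>i<d. kills (ideal_power R \<mm> k) (local_cohomology R \<mm> C i)))"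

end

theory Submission
  imports Defs
begin

text \<open>
  Let \<open>\<Gamma>\<close> be the torsion functor and \<open>\<phi> : C \<rightarrow> D\<close> a lift of \<open>M \<rightarrow> M/xM\<close> to the resolutions. Since \<open>x\<close>
  is zero on \<open>M/xM\<close>, the map \<open>x \<phi>\<close> has a null-homotopy \<open>\<tau>\<close>, and the total complex \<open>L\<close> of
  \<open>C \<rightarrow> C \<rightarrow> D\<close> with maps \<open>x\<close>, \<open>\<phi>\<close> and \<open>\<tau>\<close> is a resolution of \<open>0 :\<^sub>M x\<close>. If that module is torsion,
  then \<open>\<Gamma> L\<close> is exact in positive degrees. Now write \<open>x = \<Sum> a\<^sub>j b\<^sub>j\<close> with \<open>a\<^sub>j, b\<^sub>j \<in> \<mm>\<^sup>n\<close>, where \<open>\<mm>\<^sup>n\<close>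
  kills \<open>H\<^sup>i(M)\<close>. For a cocycle \<open>v\<close> whose class in \<open>H\<^sup>i\<^sup>+\<^sup>1(M)\<close> is killed by \<open>\<mm>\<^sup>n\<close> choose \<open>y\<^sub>j\<close> with
  \<open>d y\<^sub>j = b\<^sub>j v\<close>; then \<open>(c, v) \<mapsto> \<phi> c + \<tau> v - \<phi> (\<Sum> a\<^sub>j y\<^sub>j)\<close> is well defined on classes, because \<open>a\<^sub>j\<close>
  kills the ambiguity of \<open>y\<^sub>j\<close>, and the exactness of \<open>\<Gamma> L\<close> makes it an isomorphism onto the elements of
  \<open>H\<^sup>i(M/xM)\<close> killed by \<open>\<mm>\<^sup>n\<close>.

  It remains to see that \<open>0 :\<^sub>M x\<close> is torsion. Otherwise \<open>x\<close> lies in a prime \<open>p \<noteq> \<mm>\<close> which annihilates a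
  non-zero element of \<open>M/\<Gamma> M\<close>. The complex \<open>F = C/\<Gamma> C\<close> has cohomology that is noetherian up to
  powers of elements of \<open>\<mm>\<close> in degrees below \<open>d - 1\<close>, so Nakayama's lemma, applied to the cohomology
  of \<open>Hom(R/q, F)\<close>, extends \<open>p\<close> step by step to a chain of primes of length \<open>d\<close>, which contradicts
  \<open>dim M/xM = d - 1\<close>.
\<close>


text \<open>That a torsion module has no local cohomology in positive degrees is usually read off
  from the fact that the torsion of an injective module is injective. Here \<open>cyclic_ext\<close>
  of \<open>C/\<Gamma> C\<close> takes its place: a weak Artin-Rees argument suffices for it, and it
  makes Hom(R/J, -) on \<open>C/\<Gamma> C\<close> behave as on injectives along
  \<open>0 -> R/(J : a) -> R/J -> R/(J + Ra) -> 0\<close>. It is used twice, for the exactness of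
  \<open>\<Gamma> L\<close> and for the chain of primes. The terms of \<open>L\<close> are direct
  sums with elements in a product type, and zero modules occur in low degrees. What they inherit
  directly is Baer's criterion, hence \<open>baer_module\<close>. The exponent
  \<open>2 * n\<^sub>0\<close> is spent in two halves: one factor of a product turns the cocycle
  \<open>v\<close> into a coboundary, the other absorbs the choice of the preimage. Degree
  \<open>k\<close> of \<open>C/\<Gamma> C\<close> is controlled by \<open>H (Suc k)\<close>, so the
  hypothesis below degree \<open>d\<close> allows \<open>d - 1\<close> Nakayama steps;
  \<open>\<mm>\<close> itself is the last prime of the chain. Local cohomology need not be finitely
  generated, so Nakayama's lemma must tolerate parts killed by a power of \<open>y\<close>.\<close>

section \<open>Noetherian local rings\<close>

lemma (in cring) ideal_crit:
  "ideal I R \<longleftrightarrow> I \<subseteq> carrier R \<and> \<zero> \<in> I \<and> (\<forall>a\<in>I. \<forall>b\<in>I. a \<oplus> b \<in> I)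
     \<and> (\<forall>r\<in>carrier R. \<forall>a\<in>I. r \<otimes> a \<in> I)" (is "_ \<longleftrightarrow> ?rhs")
proof
  assume "ideal I R"
  then interpret ideal I R .
  show ?rhs using I_l_closed a_subset by auto
next
  assume I: ?rhs
  have "\<ominus> a \<in> I" if "a \<in> I" for a
  proof -
    have "a \<in> carrier R" "\<ominus> \<one> \<otimes> a \<in> I" using I that by auto
    then show ?thesis by (simp add: l_minus)
  qed
  then have "subgroup I (add_monoid R)"
    using I by (intro add.subgroupI) (auto simp: a_inv_def)
  then show "ideal I R"
    using I by (intro idealI ring_axioms) (auto simp: subset_eq, metis m_comm)
qed

text \<open>With \<open>ideal_colon\<close> this gives the outer terms R/(J : a) and R/(J + Ra) of
  the sequence through R/J. The inductions over ideals in a complex run along it, so that only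
  cyclic modules ever serve as test modules.\<close>

definition ideal_adjoin :: "('a, 'r) ring_scheme \<Rightarrow> 'a set \<Rightarrow> 'a \<Rightarrow> 'a set" where
  "ideal_adjoin R J a = {j \<oplus>\<^bsub>R\<^esub> r \<otimes>\<^bsub>R\<^esub> a | j r. j \<in> J \<and> r \<in> carrier R}"

definition ideal_colon :: "('a, 'r) ring_scheme \<Rightarrow> 'a set \<Rightarrow> 'a \<Rightarrow> 'a set" where
  "ideal_colon R J a = {r \<in> carrier R. r \<otimes>\<^bsub>R\<^esub> a \<in> J}"

context cring
begin

lemma ideal_adjoin_ideal:
  assumes J: "ideal J R" and a: "a \<in> carrier R"
  shows "ideal (ideal_adjoin R J a) R"
  unfolding ideal_crit
proof (intro conjI ballI)
  note J = J[unfolded ideal_crit]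
  show "ideal_adjoin R J a \<subseteq> carrier R" using J a unfolding ideal_adjoin_def by auto
  show "\<zero> \<in> ideal_adjoin R J a"
    using J a unfolding ideal_adjoin_def by (auto intro!: exI[of _ \<zero>])
next
  note J = J[unfolded ideal_crit]
  fix u v assume "u \<in> ideal_adjoin R J a" "v \<in> ideal_adjoin R J a"
  then obtain j r j' r' where *: "j \<in> J" "j' \<in> J" "r \<in> carrier R" "r' \<in> carrier R"
    "u = j \<oplus> r \<otimes> a" "v = j' \<oplus> r' \<otimes> a" unfolding ideal_adjoin_def by blast
  have jc: "j \<in> carrier R" "j' \<in> carrier R" using * J by auto
  have "u \<oplus> v = (j \<oplus> j') \<oplus> (r \<oplus> r') \<otimes> a" using * jc a by (simp add: l_distr a_ac)
  then show "u \<oplus> v \<in> ideal_adjoin R J a" using * J unfolding ideal_adjoin_def by blast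
next
  note J = J[unfolded ideal_crit]
  fix s u assume s: "s \<in> carrier R" and "u \<in> ideal_adjoin R J a"
  then obtain j r where *: "j \<in> J" "r \<in> carrier R" "u = j \<oplus> r \<otimes> a"
    unfolding ideal_adjoin_def by blast
  have jc: "j \<in> carrier R" using * J by auto
  have "s \<otimes> u = s \<otimes> j \<oplus> (s \<otimes> r) \<otimes> a" using * jc a s by (simp add: r_distr m_assoc)
  then show "s \<otimes> u \<in> ideal_adjoin R J a" using * J s unfolding ideal_adjoin_def by blast
qed

lemma ideal_adjoin_incl:
  assumes "ideal J R" "a \<in> carrier R"
  shows "J \<subseteq> ideal_adjoin R J a" "a \<in> ideal_adjoin R J a"
proof -
  note J = assms(1)[unfolded ideal_crit]
  have "j \<in> ideal_adjoin R J a" if "j \<in> J" for j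
    using that J assms(2) unfolding ideal_adjoin_def by (intro CollectI exI[of _ j] exI[of _ \<zero>]) auto
  then show "J \<subseteq> ideal_adjoin R J a" by blast
  show "a \<in> ideal_adjoin R J a"
    using J assms(2) unfolding ideal_adjoin_def by (intro CollectI exI[of _ \<zero>] exI[of _ \<one>]) auto
qed

lemma ideal_adjoin_least:
  assumes "ideal I R" "J \<subseteq> I" "a \<in> I"
  shows "ideal_adjoin R J a \<subseteq> I"
  using assms unfolding ideal_crit ideal_adjoin_def by blast

lemma ideal_colon_ideal:
  assumes J: "ideal J R" and a: "a \<in> carrier R"
  shows "ideal (ideal_colon R J a) R"
  using J a unfolding ideal_crit ideal_colon_def by (auto simp: l_distr m_assoc)

lemma ideal_colon_incl: "ideal J R \<Longrightarrow> a \<in> carrier R \<Longrightarrow> J \<subseteq> ideal_colon R J a"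
  unfolding ideal_colon_def ideal_crit by (auto, metis m_comm subsetD)

lemma ideal_power_ideal: "ideal I R \<Longrightarrow> ideal (ideal_power R I n) R"
proof -
  interpret Is: comm_monoid "ideals_set R" by (rule ideals_set_is_comm_monoid)
  assume "ideal I R"
  then show ?thesis using Is.nat_pow_closed[of I n] by (simp add: ideals_set_def)
qed

lemma ideal_power_add:
  assumes "ideal I R"
  shows "ideal_power R I (k + l) = ideal_power R I k \<cdot> ideal_power R I l"
proof -
  interpret Is: comm_monoid "ideals_set R" by (rule ideals_set_is_comm_monoid)
  show ?thesis using Is.nat_pow_mult[of I k l] assms by (simp add: ideals_set_def)
qed

lemma ideal_power_zero: "ideal_power R I 0 = carrier R"
  by (simp add: ideals_set_def nat_pow_def)

lemma ideal_power_one: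
  assumes "ideal I R"
  shows "ideal_power R I 1 = I"
proof -
  interpret Is: comm_monoid "ideals_set R" by (rule ideals_set_is_comm_monoid)
  show ?thesis using Is.nat_pow_eone[of I] assms by (simp add: ideals_set_def)
qed

lemma ideal_power_elem:
  assumes I: "ideal I R" and a: "a \<in> I"
  shows "a [^] (n::nat) \<in> ideal_power R I n"
proof (induction n)
  case 0
  show ?case unfolding ideal_power_zero by simp
next
  case (Suc n)
  have "ideal_power R I (Suc n) = ideal_power R I n \<cdot> I"
    using ideal_power_add[OF I, of n 1] by (simp only: ideal_power_one[OF I] Suc_eq_plus1)
  then show ?case using ideal_prod.prod[OF Suc a, of R] by simp
qed

end

locale noeth_local_ring = cring R for R (structure) +
  fixes \<mm>
  assumes noeth_local: "noetherian_local_ring R \<mm>"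
begin

sublocale noetherian_ring R
  using noeth_local unfolding noetherian_local_ring_def by blast

lemma maximalideal_mm: "maximalideal \<mm> R"
  using noeth_local unfolding noetherian_local_ring_def by blast

lemma ideal_mm: "ideal \<mm> R"
  using maximalideal_mm unfolding maximalideal_def by blast

lemma mm_subset: "\<mm> \<subseteq> carrier R"
  using ideal_mm unfolding ideal_crit by blast

lemma mm_carrier: "a \<in> \<mm> \<Longrightarrow> a \<in> carrier R"
  using mm_subset by blast

lemma one_notin_mm: "\<one> \<notin> \<mm>"
  using maximalideal.I_notcarr[OF maximalideal_mm] ideal.one_imp_carrier[OF ideal_mm] by blast

text \<open>In a noetherian ring the union of a nonempty chain of ideals is a member of the chain.
  Zorn's lemma therefore applies to an arbitrary property of ideals, whether or not it passes to
  unions.\<close>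

lemma ex_maximal_ideal:
  assumes P: "P I0" and ideal: "\<And>I. P I \<Longrightarrow> ideal I R"
  obtains I where "P I" "\<And>J. P J \<Longrightarrow> I \<subseteq> J \<Longrightarrow> J = I"
proof -
  have "\<exists>I\<in>Collect P. \<forall>J\<in>Collect P. I \<subseteq> J \<longrightarrow> J = I"
  proof (rule subset_Zorn_nonempty)
    show "Collect P \<noteq> {}" using P by blast
    fix C assume C: "C \<noteq> {}" "subset.chain (Collect P) C"
    then have CP: "C \<subseteq> Collect P" unfolding subset.chain_def by simp
    then have "C \<subseteq> {I. ideal I R}" using ideal by auto
    then have "subset.chain {I. ideal I R} C" using C(2) unfolding subset.chain_def by simp
    then have "\<Union>C \<in> C" by (rule ideal_chain_is_trivial[OF C(1)])
    then show "\<Union>C \<in> Collect P" using CP by (rule subsetD[rotated])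
  qed
  then show thesis using that by auto
qed

lemma ideal_chain_stable:
  assumes I: "\<And>n::nat. ideal (I n) R" and mono: "\<And>n. I n \<subseteq> I (Suc n)"
  shows "\<exists>n. \<forall>k. I k \<subseteq> I n"
proof -
  obtain K where "K \<in> range I" "\<And>J. J \<in> range I \<Longrightarrow> K \<subseteq> J \<Longrightarrow> J = K"
    by (rule ex_maximal_ideal[of "\<lambda>K. K \<in> range I" "I 0"]) (use I in auto)
  then obtain n where n: "\<And>k. I n \<subseteq> I k \<Longrightarrow> I k = I n" by (metis rangeE rangeI)
  have "I k \<subseteq> I n" for k
  proof (cases "k \<le> n")
    case True
    then show ?thesis using lift_Suc_mono_le[of I] mono by blast
  next
    case False
    then have "I n \<subseteq> I k" using lift_Suc_mono_le[of I] mono by simp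
    then show ?thesis using n by blast
  qed
  then show ?thesis by blast
qed

text \<open>Replaces induction on a finite generating set: an ideal maximal among those inside
  \<open>J\<close> with property \<open>Q\<close> absorbs every element of \<open>J\<close>. No
  generators have to be named.\<close>

lemma ideal_adjoin_induct [consumes 1, case_names zero adjoin]:
  assumes J: "ideal J R" and zero: "Q {\<zero>}"
    and adjoin: "\<And>J0 a. ideal J0 R \<Longrightarrow> J0 \<subseteq> J \<Longrightarrow> a \<in> J \<Longrightarrow> Q J0 \<Longrightarrow> Q (ideal_adjoin R J0 a)"
  shows "Q J"
proof -
  have z: "{\<zero>} \<subseteq> J" using J unfolding ideal_crit by auto
  obtain I where I: "ideal I R \<and> I \<subseteq> J \<and> Q I"
    and max: "\<And>K. ideal K R \<and> K \<subseteq> J \<and> Q K \<Longrightarrow> I \<subseteq> K \<Longrightarrow> K = I"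
    by (rule ex_maximal_ideal[of "\<lambda>I. ideal I R \<and> I \<subseteq> J \<and> Q I" "{\<zero>}"])
      (use zeroideal zero z in auto)
  have "J \<subseteq> I"
  proof
    fix a assume a: "a \<in> J"
    then have aR: "a \<in> carrier R" using J unfolding ideal_crit by auto
    have "ideal_adjoin R I a = I"
      by (rule max) (simp_all add: I a aR adjoin ideal_adjoin_ideal ideal_adjoin_least J ideal_adjoin_incl)
    then show "a \<in> I" using ideal_adjoin_incl(2)[of I a] I aR by simp
  qed
  then have "I = J" using I by blast
  then show ?thesis using I by simp
qed

lemma proper_ideal_subset:
  assumes "ideal I R" "\<one> \<notin> I"
  shows "I \<subseteq> \<mm>"
proof -
  obtain J where J: "ideal J R \<and> I \<subseteq> J \<and> \<one> \<notin> J"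
    and max: "\<And>K. ideal K R \<and> I \<subseteq> K \<and> \<one> \<notin> K \<Longrightarrow> J \<subseteq> K \<Longrightarrow> K = J"
    by (rule ex_maximal_ideal[of "\<lambda>J. ideal J R \<and> I \<subseteq> J \<and> \<one> \<notin> J" I]) (use assms in auto)
  have "maximalideal J R"
  proof (rule maximalidealI)
    show "ideal J R" "carrier R \<noteq> J" using J by auto
    fix K assume K: "ideal K R" "J \<subseteq> K" "K \<subseteq> carrier R"
    show "K = J \<or> K = carrier R"
    proof (cases "\<one> \<in> K")
      case True
      then show ?thesis using ideal.one_imp_carrier[OF K(1)] by blast
    next
      case False
      then show ?thesis using max[of K] J K by auto
    qed
  qed
  then show ?thesis using noeth_local J unfolding noetherian_local_ring_def by blast
qed

text \<open>The only input from locality in the Nakayama argument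
  \<open>almost_noeth_nakayama\<close>.\<close>

lemma unit_one_minus:
  assumes r: "r \<in> carrier R" and y: "y \<in> \<mm>"
  shows "\<exists>s\<in>carrier R. s \<otimes> (\<one> \<ominus> r \<otimes> y) = \<one>"
proof -
  have yR: "y \<in> carrier R" using y mm_carrier by blast
  let ?t = "\<one> \<ominus> r \<otimes> y"
  have t: "?t \<in> carrier R" using r yR by auto
  have "\<one> \<in> PIdl ?t"
  proof (rule ccontr)
    assume "\<one> \<notin> PIdl ?t"
    then have "?t \<in> \<mm>"
      using proper_ideal_subset[OF cgenideal_ideal[OF t]] cgenideal_self[OF t] by blast
    moreover have "r \<otimes> y \<in> \<mm>" using ideal_mm r y unfolding ideal_crit by blast
    ultimately have "?t \<oplus> r \<otimes> y \<in> \<mm>" using ideal_mm unfolding ideal_crit by blast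
    then show False using one_notin_mm r yR by (simp add: minus_eq a_assoc l_neg)
  qed
  then obtain s where "s \<in> carrier R" "\<one> = s \<otimes> ?t" unfolding cgenideal_def by blast
  then show ?thesis by (intro bexI[of _ s]) simp_all
qed

lemma primeideal_subset: "primeideal p R \<Longrightarrow> p \<subseteq> \<mm>"
  using proper_ideal_subset[of p] ideal.one_imp_carrier[of p] primeideal.I_notcarr[of p R]
  unfolding primeideal_def by blast

lemma primeideal_mm: "primeideal \<mm> R"
  using maximalideal_mm maximalideal_prime by blast

text \<open>An ideal maximal among those that contain \<open>L\<close> and no power of the maximal ideal is prime.\<close>

lemma power_subset_of_nilpotent:
  assumes L: "ideal L R" and nil: "\<And>b. b \<in> \<mm> \<Longrightarrow> \<exists>n::nat. b [^] n \<in> L"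
  shows "\<exists>n. ideal_power R \<mm> n \<subseteq> L"
proof (rule ccontr)
  assume contra: "\<nexists>n. ideal_power R \<mm> n \<subseteq> L"
  let ?P = "\<lambda>J. ideal J R \<and> L \<subseteq> J \<and> (\<nexists>n. ideal_power R \<mm> n \<subseteq> J)"
  obtain J where J: "?P J" and max: "\<And>K. ?P K \<Longrightarrow> J \<subseteq> K \<Longrightarrow> K = J"
    by (rule ex_maximal_ideal[of ?P L]) (use L contra in auto)
  have Ji: "ideal J R" using J by blast
  have big: "\<exists>n. ideal_power R \<mm> n \<subseteq> ideal_adjoin R J a" if "a \<in> carrier R" "a \<notin> J" for a
  proof (rule ccontr)
    assume "\<nexists>n. ideal_power R \<mm> n \<subseteq> ideal_adjoin R J a"
    moreover note incl = ideal_adjoin_incl[OF Ji that(1)]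
    moreover have "L \<subseteq> ideal_adjoin R J a" using J incl(1) by (meson subset_trans)
    ultimately have "ideal_adjoin R J a = J" using max ideal_adjoin_ideal[OF Ji that(1)] by simp
    then show False using incl(2) that(2) by simp
  qed
  have prime: "a \<in> J \<or> b \<in> J" if ab: "a \<in> carrier R" "b \<in> carrier R" "a \<otimes> b \<in> J" for a b
  proof (rule ccontr)
    assume "\<not> (a \<in> J \<or> b \<in> J)"
    then obtain k l where kl: "ideal_power R \<mm> k \<subseteq> ideal_adjoin R J a"
      "ideal_power R \<mm> l \<subseteq> ideal_adjoin R J b" using big[OF ab(1)] big[OF ab(2)] by meson
    have "u \<in> J" if "u \<in> ideal_power R \<mm> k \<cdot> ideal_power R \<mm> l" for u
      using that
    proof (induction u rule: ideal_prod.induct)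
      case (prod u v)
      then obtain j r j' r' where *: "j \<in> J" "j' \<in> J" "r \<in> carrier R" "r' \<in> carrier R"
        "u = j \<oplus> r \<otimes> a" "v = j' \<oplus> r' \<otimes> b" using kl unfolding ideal_adjoin_def by blast
      have jc: "j \<in> carrier R" "j' \<in> carrier R" using * Ji unfolding ideal_crit by auto
      \<comment> \<open>Grouped so that each summand is visibly a multiple of \<open>j\<close>, of
        \<open>j'\<close> or of \<open>a \<otimes> b\<close>, all of which lie in
        \<open>J\<close>.\<close>
      have "u \<otimes> v = (j' \<oplus> r' \<otimes> b) \<otimes> j \<oplus> ((r \<otimes> a) \<otimes> j' \<oplus> (r \<otimes> r') \<otimes> (a \<otimes> b))"
        using * jc ab(1,2) by (simp add: l_distr r_distr m_ac a_ac)
      then show ?case using * ab Ji jc unfolding ideal_crit by auto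
    next
      case (sum u v)
      then show ?case using Ji unfolding ideal_crit by blast
    qed
    then have "ideal_power R \<mm> (k + l) \<subseteq> J" by (simp add: ideal_power_add[OF ideal_mm] subsetI)
    then show False using J by blast
  qed
  \<comment> \<open>Primeness turns the nilpotency of \<open>b\<close> modulo \<open>L\<close> into
    membership in \<open>J\<close>, so \<open>J\<close> would contain the first power of the maximal
    ideal.\<close>
  have "b \<in> J" if b: "b \<in> \<mm>" for b
  proof -
    have bR: "b \<in> carrier R" using b mm_carrier by blast
    obtain n :: nat where "b [^] n \<in> J" using nil[OF b] J by blast
    then show ?thesis
    proof (induction n)
      case 0
      then show ?case using Ji bR unfolding ideal_crit by force
    next
      case (Suc n)
      then show ?case using prime[of "b [^] n" b] bR by auto
    qed
  qed
  then have "ideal_power R \<mm> 1 \<subseteq> J" by (simp only: ideal_power_one[OF ideal_mm] subsetI)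
  then show False using J by blast
qed

end


section \<open>Modules, quotients and homomorphisms\<close>

lemma mod_homD:
  assumes "f \<in> mod_hom R A B"
  shows "x \<in> carrier A \<Longrightarrow> f x \<in> carrier B"
    and "x \<in> carrier A \<Longrightarrow> y \<in> carrier A \<Longrightarrow> f (x \<oplus>\<^bsub>A\<^esub> y) = f x \<oplus>\<^bsub>B\<^esub> f y"
    and "r \<in> carrier R \<Longrightarrow> x \<in> carrier A \<Longrightarrow> f (r \<odot>\<^bsub>A\<^esub> x) = r \<odot>\<^bsub>B\<^esub> f x"
  using assms unfolding mod_hom_def by auto

lemma mod_homI:
  assumes "\<And>x. x \<in> carrier A \<Longrightarrow> f x \<in> carrier B"
    and "\<And>x y. x \<in> carrier A \<Longrightarrow> y \<in> carrier A \<Longrightarrow> f (x \<oplus>\<^bsub>A\<^esub> y) = f x \<oplus>\<^bsub>B\<^esub> f y"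
    and "\<And>r x. r \<in> carrier R \<Longrightarrow> x \<in> carrier A \<Longrightarrow> f (r \<odot>\<^bsub>A\<^esub> x) = r \<odot>\<^bsub>B\<^esub> f x"
  shows "f \<in> mod_hom R A B"
  using assms unfolding mod_hom_def by auto

lemma (in module) minus_as_smult: "x \<in> carrier M \<Longrightarrow> \<ominus>\<^bsub>M\<^esub> x = (\<ominus>\<^bsub>R\<^esub> \<one>\<^bsub>R\<^esub>) \<odot>\<^bsub>M\<^esub> x"
  by (simp add: smult_l_minus)

lemma mod_hom_zero:
  assumes "module R A" "module R B" "f \<in> mod_hom R A B"
  shows "f \<zero>\<^bsub>A\<^esub> = \<zero>\<^bsub>B\<^esub>"
proof -
  interpret A: module R A by fact
  interpret B: module R B by fact
  show ?thesis using mod_homD(3)[OF assms(3), of "\<zero>\<^bsub>R\<^esub>" "\<zero>\<^bsub>A\<^esub>"] mod_homD(1)[OF assms(3), of "\<zero>\<^bsub>A\<^esub>"] by simp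
qed

lemma mod_hom_neg:
  assumes "module R A" "module R B" "f \<in> mod_hom R A B" "x \<in> carrier A"
  shows "f (\<ominus>\<^bsub>A\<^esub> x) = \<ominus>\<^bsub>B\<^esub> f x"
proof -
  interpret A: module R A by fact
  interpret B: module R B by fact
  show ?thesis
    using mod_homD(3)[OF assms(3), of "\<ominus>\<^bsub>R\<^esub> \<one>\<^bsub>R\<^esub>" x] mod_homD(1)[OF assms(3), of x] assms(4)
    by (simp add: A.minus_as_smult B.minus_as_smult)
qed

lemma mod_hom_minus:
  assumes "module R A" "module R B" "f \<in> mod_hom R A B" "x \<in> carrier A" "y \<in> carrier A"
  shows "f (x \<ominus>\<^bsub>A\<^esub> y) = f x \<ominus>\<^bsub>B\<^esub> f y"
proof -
  interpret A: module R A by fact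
  interpret B: module R B by fact
  show ?thesis using assms(4,5) by (simp add: A.M.minus_eq B.M.minus_eq mod_homD(2)[OF assms(3)] mod_hom_neg[OF assms(1-3)])
qed

lemma (in abelian_group) minus_self: "x \<in> carrier G \<Longrightarrow> x \<ominus> x = \<zero>"
  by (simp add: minus_eq r_neg)

lemma (in abelian_group) minus_eq_zeroD: "x \<in> carrier G \<Longrightarrow> y \<in> carrier G \<Longrightarrow> x \<ominus> y = \<zero> \<Longrightarrow> x = y"
  by (metis a_inv_closed minus_eq minus_equality minus_minus)

lemma (in abelian_group) minus_zero_right: "x \<in> carrier G \<Longrightarrow> x \<ominus> \<zero> = x"
  by (metis minus_eq minus_equality r_zero zero_closed)

lemma (in abelian_group) minus_add_cancel: "x \<in> carrier G \<Longrightarrow> y \<in> carrier G \<Longrightarrow> (x \<ominus> y) \<oplus> y = x"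
  by (simp add: minus_eq a_assoc l_neg)

context module
begin

lemma submodule_crit:
  "submodule N R M \<longleftrightarrow> N \<subseteq> carrier M \<and> \<zero>\<^bsub>M\<^esub> \<in> N \<and> (\<forall>a\<in>N. \<forall>b\<in>N. a \<oplus>\<^bsub>M\<^esub> b \<in> N)
     \<and> (\<forall>r\<in>carrier R. \<forall>a\<in>N. r \<odot>\<^bsub>M\<^esub> a \<in> N)" (is "_ \<longleftrightarrow> ?rhs")
proof
  assume N: "submodule N R M"
  then have "\<zero>\<^bsub>M\<^esub> \<in> N" using subgroup.one_closed[of N "add_monoid M"] unfolding submodule_def by auto
  then show ?rhs using submoduleE[OF N] by auto
next
  assume N: ?rhs
  have "\<ominus>\<^bsub>M\<^esub> a \<in> N" if "a \<in> N" for a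
  proof -
    have "a \<in> carrier M" "\<ominus>\<^bsub>R\<^esub> \<one>\<^bsub>R\<^esub> \<odot>\<^bsub>M\<^esub> a \<in> N" using N that by auto
    then show ?thesis by (simp add: minus_as_smult)
  qed
  then show "submodule N R M" using N by (intro submoduleI) auto
qed

lemma submoduleD:
  assumes "submodule N R M"
  shows "a \<in> N \<Longrightarrow> a \<in> carrier M" "\<zero>\<^bsub>M\<^esub> \<in> N" "a \<in> N \<Longrightarrow> b \<in> N \<Longrightarrow> a \<oplus>\<^bsub>M\<^esub> b \<in> N"
    "r \<in> carrier R \<Longrightarrow> a \<in> N \<Longrightarrow> r \<odot>\<^bsub>M\<^esub> a \<in> N" "a \<in> N \<Longrightarrow> \<ominus>\<^bsub>M\<^esub> a \<in> N"
    "a \<in> N \<Longrightarrow> b \<in> N \<Longrightarrow> a \<ominus>\<^bsub>M\<^esub> b \<in> N"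
  using submoduleE[OF assms] assms unfolding submodule_crit minus_eq by auto

lemma submodule_abelian_subgroup: "submodule N R M \<Longrightarrow> abelian_subgroup N M"
  using abelian_group_axioms
  by (intro abelian_subgroupI3) (auto simp: additive_subgroup_def submodule_def)

lemma coset_eq_iff:
  assumes N: "submodule N R M" and "a \<in> carrier M" "b \<in> carrier M"
  shows "N +>\<^bsub>M\<^esub> a = N +>\<^bsub>M\<^esub> b \<longleftrightarrow> a \<ominus>\<^bsub>M\<^esub> b \<in> N"
proof -
  interpret N: abelian_subgroup N M by (rule submodule_abelian_subgroup[OF N])
  have mem: "a \<in> N +>\<^bsub>M\<^esub> b \<longleftrightarrow> a \<ominus>\<^bsub>M\<^esub> b \<in> N"
  proof
    assume "a \<in> N +>\<^bsub>M\<^esub> b"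
    then obtain n where n: "n \<in> N" "a = n \<oplus>\<^bsub>M\<^esub> b" by (auto simp: a_r_coset_def')
    then have "a \<ominus>\<^bsub>M\<^esub> b = n" using assms(3) submoduleD(1)[OF N] by (simp add: minus_eq a_assoc M.r_neg)
    then show "a \<ominus>\<^bsub>M\<^esub> b \<in> N" using n by simp
  next
    assume n: "a \<ominus>\<^bsub>M\<^esub> b \<in> N"
    have "a = (a \<ominus>\<^bsub>M\<^esub> b) \<oplus>\<^bsub>M\<^esub> b" using assms(2,3) by (simp add: minus_add_cancel)
    then show "a \<in> N +>\<^bsub>M\<^esub> b" using n unfolding a_r_coset_def' by blast
  qed
  show ?thesis
    using mem N.a_rcos_self[OF assms(2)] N.a_repr_independence'[of a b] assms(3) by metis
qed

lemma coset_zero_iff: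
  assumes "submodule N R M" "a \<in> carrier M"
  shows "N +>\<^bsub>M\<^esub> a = N \<longleftrightarrow> a \<in> N"
  using coset_eq_iff[OF assms M.zero_closed] assms a_coset_add_zero[of N] submoduleD(1)[OF assms(1)]
  by (simp add: minus_zero_right subset_eq)

lemma coset_add:
  assumes "submodule N R M" "a \<in> carrier M" "b \<in> carrier M"
  shows "(N +>\<^bsub>M\<^esub> a) <+>\<^bsub>M\<^esub> (N +>\<^bsub>M\<^esub> b) = N +>\<^bsub>M\<^esub> (a \<oplus>\<^bsub>M\<^esub> b)"
  using abelian_subgroup.a_rcos_sum[OF submodule_abelian_subgroup] assms by blast

lemma coset_smult:
  assumes N: "submodule N R M" and a: "a \<in> carrier M" and r: "r \<in> carrier R"
  shows "(\<Union>x\<in>N +>\<^bsub>M\<^esub> a. N +>\<^bsub>M\<^esub> (r \<odot>\<^bsub>M\<^esub> x)) = N +>\<^bsub>M\<^esub> (r \<odot>\<^bsub>M\<^esub> a)"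
proof -
  interpret N: abelian_subgroup N M by (rule submodule_abelian_subgroup[OF N])
  have "N +>\<^bsub>M\<^esub> (r \<odot>\<^bsub>M\<^esub> x) = N +>\<^bsub>M\<^esub> (r \<odot>\<^bsub>M\<^esub> a)" if "x \<in> N +>\<^bsub>M\<^esub> a" for x
  proof -
    have "\<exists>n\<in>N. x = n \<oplus>\<^bsub>M\<^esub> a" using that by (simp add: a_r_coset_def')
    then obtain n where n: "n \<in> N" "x = n \<oplus>\<^bsub>M\<^esub> a" by blast
    have nc: "n \<in> carrier M" using n(1) submoduleD(1)[OF N] by blast
    have "r \<odot>\<^bsub>M\<^esub> x \<ominus>\<^bsub>M\<^esub> r \<odot>\<^bsub>M\<^esub> a = r \<odot>\<^bsub>M\<^esub> n"
      using nc a r n(2) by (simp add: smult_r_distr minus_eq a_assoc M.r_neg)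
    then show ?thesis using coset_eq_iff[OF N] n nc a r submoduleD(4)[OF N] by simp
  qed
  moreover have "a \<in> N +>\<^bsub>M\<^esub> a" using N.a_rcos_self a by blast
  ultimately show ?thesis by blast
qed

lemma submodule_module: "submodule N R M \<Longrightarrow> module R (M\<lparr>carrier := N\<rparr>)"
  using submodule.submodule_is_module module_axioms by blast

end

lemma mod_quot_simps:
  assumes "module R M" "submodule N R M"
  shows "carrier (mod_quot M N) = (\<lambda>a. N +>\<^bsub>M\<^esub> a) ` carrier M"
    and "a \<in> carrier M \<Longrightarrow> b \<in> carrier M \<Longrightarrow>
      (N +>\<^bsub>M\<^esub> a) \<oplus>\<^bsub>mod_quot M N\<^esub> (N +>\<^bsub>M\<^esub> b) = N +>\<^bsub>M\<^esub> (a \<oplus>\<^bsub>M\<^esub> b)"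
    and "\<zero>\<^bsub>mod_quot M N\<^esub> = N"
    and "a \<in> carrier M \<Longrightarrow> r \<in> carrier R \<Longrightarrow> r \<odot>\<^bsub>mod_quot M N\<^esub> (N +>\<^bsub>M\<^esub> a) = N +>\<^bsub>M\<^esub> (r \<odot>\<^bsub>M\<^esub> a)"
  unfolding mod_quot_def using module.coset_add[OF assms] module.coset_smult[OF assms]
  by (auto simp: A_RCOSETS_def')

lemma mod_quot_module:
  assumes M: "module R M" and N: "submodule N R M"
  shows "module R (mod_quot M N)"
proof -
  interpret module R M by fact
  note simps = mod_quot_simps[OF M N]
  have zz: "\<zero>\<^bsub>mod_quot M N\<^esub> = N +>\<^bsub>M\<^esub> \<zero>\<^bsub>M\<^esub>"
    using coset_zero_iff[OF N, of "\<zero>\<^bsub>M\<^esub>"] submoduleD(2)[OF N] simps(3) by simp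
  show ?thesis
  proof (rule moduleI)
    show "abelian_group (mod_quot M N)"
    proof (rule abelian_groupI)
      fix u assume "u \<in> carrier (mod_quot M N)"
      then obtain a where a: "a \<in> carrier M" "u = N +>\<^bsub>M\<^esub> a" unfolding simps(1) by blast
      then show "\<exists>y\<in>carrier (mod_quot M N). y \<oplus>\<^bsub>mod_quot M N\<^esub> u = \<zero>\<^bsub>mod_quot M N\<^esub>"
        by (intro bexI[of _ "N +>\<^bsub>M\<^esub> (\<ominus>\<^bsub>M\<^esub> a)"]) (auto simp: simps(1,2) zz M.l_neg)
    qed (auto simp: simps(1,2) zz M.a_ac)
  qed (auto simp: simps(1,2,4) smult_l_distr smult_r_distr smult_assoc1 R.is_cring)
qed

lemma quot_map_hom:
  "module R M \<Longrightarrow> submodule N R M \<Longrightarrow> (\<lambda>a. N +>\<^bsub>M\<^esub> a) \<in> mod_hom R M (mod_quot M N)"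
  by (intro mod_homI) (auto simp: mod_quot_simps)

lemma a_r_coset_carrier_upd [simp]: "N +>\<^bsub>M\<lparr>carrier := K\<rparr>\<^esub> a = N +>\<^bsub>M\<^esub> a"
  by (simp add: a_r_coset_def')

lemma mod_sum_module:
  assumes "module R A" "module R B"
  shows "module R (mod_sum A B)"
proof -
  interpret A: module R A by fact
  interpret B: module R B by fact
  show ?thesis
  proof (rule moduleI)
    show "abelian_group (mod_sum A B)"
    proof (rule abelian_groupI)
      fix u assume "u \<in> carrier (mod_sum A B)"
      then show "\<exists>y\<in>carrier (mod_sum A B). y \<oplus>\<^bsub>mod_sum A B\<^esub> u = \<zero>\<^bsub>mod_sum A B\<^esub>"
        by (intro bexI[of _ "(\<ominus>\<^bsub>A\<^esub> fst u, \<ominus>\<^bsub>B\<^esub> snd u)"]) (auto simp: mod_sum_def A.M.l_neg B.M.l_neg)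
    qed (auto simp: mod_sum_def A.M.a_ac B.M.a_ac)
  qed (auto simp: mod_sum_def A.R.is_cring A.smult_l_distr B.smult_l_distr A.smult_r_distr
      B.smult_r_distr A.smult_assoc1 B.smult_assoc1)
qed

text \<open>Two partners of the same element differ by a partner of zero, so trivial fibres over
  zero on both sides make the relation a bijection. In this form an isomorphism can be given by
  representatives and choices, as in \<open>splitting_isomorphism\<close>.\<close>

lemma mod_isomorphic_graph:
  assumes A: "module R A" and B: "module R B"
    and sub: "G \<subseteq> carrier A \<times> carrier B"
    and add: "\<And>a b a' b'. (a, b) \<in> G \<Longrightarrow> (a', b') \<in> G \<Longrightarrow> (a \<oplus>\<^bsub>A\<^esub> a', b \<oplus>\<^bsub>B\<^esub> b') \<in> G"
    and smult: "\<And>r a b. r \<in> carrier R \<Longrightarrow> (a, b) \<in> G \<Longrightarrow> (r \<odot>\<^bsub>A\<^esub> a, r \<odot>\<^bsub>B\<^esub> b) \<in> G"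
    and left: "\<And>a. a \<in> carrier A \<Longrightarrow> \<exists>b. (a, b) \<in> G" and right: "\<And>b. b \<in> carrier B \<Longrightarrow> \<exists>a. (a, b) \<in> G"
    and zl: "\<And>b. (\<zero>\<^bsub>A\<^esub>, b) \<in> G \<Longrightarrow> b = \<zero>\<^bsub>B\<^esub>" and zr: "\<And>a. (a, \<zero>\<^bsub>B\<^esub>) \<in> G \<Longrightarrow> a = \<zero>\<^bsub>A\<^esub>"
  shows "mod_isomorphic R A B"
proof -
  interpret A: module R A by fact
  interpret B: module R B by fact
  have diff: "(a \<ominus>\<^bsub>A\<^esub> a', b \<ominus>\<^bsub>B\<^esub> b') \<in> G" if "(a, b) \<in> G" "(a', b') \<in> G" for a a' b b'
  proof -
    have "(\<ominus>\<^bsub>A\<^esub> a', \<ominus>\<^bsub>B\<^esub> b') \<in> G"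
      using smult[OF _ that(2), of "\<ominus>\<^bsub>R\<^esub> \<one>\<^bsub>R\<^esub>"] sub that(2)
      by (auto simp: A.minus_as_smult B.minus_as_smult)
    then show ?thesis unfolding A.M.minus_eq B.M.minus_eq using add that(1) by blast
  qed
  have Gc: "a \<in> carrier A" "b \<in> carrier B" if "(a, b) \<in> G" for a b using that sub by auto
  have uniq: "b = b'" if "(a, b) \<in> G" "(a, b') \<in> G" for a b b'
  proof -
    have "b \<ominus>\<^bsub>B\<^esub> b' = \<zero>\<^bsub>B\<^esub>" using diff[OF that] Gc[OF that(1)] by (intro zl) (simp add: A.M.minus_self)
    then show ?thesis using B.M.minus_eq_zeroD Gc that by blast
  qed
  have uniq': "a = a'" if "(a, b) \<in> G" "(a', b) \<in> G" for a a' b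
  proof -
    have "a \<ominus>\<^bsub>A\<^esub> a' = \<zero>\<^bsub>A\<^esub>" using diff[OF that] Gc[OF that(1)] by (intro zr) (simp add: B.M.minus_self)
    then show ?thesis using A.M.minus_eq_zeroD Gc that by blast
  qed
  define f where "f a = (SOME b. (a, b) \<in> G)" for a
  have f: "(a, f a) \<in> G" if "a \<in> carrier A" for a
    unfolding f_def using left[OF that] by (rule someI_ex)
  have fI: "f a = b" if "(a, b) \<in> G" for a b using f[of a] that sub uniq by blast
  have "f \<in> mod_hom R A B"
  proof (rule mod_homI)
    fix a assume "a \<in> carrier A"
    then show "f a \<in> carrier B" using f sub by blast
  next
    fix a a' assume "a \<in> carrier A" "a' \<in> carrier A"
    then show "f (a \<oplus>\<^bsub>A\<^esub> a') = f a \<oplus>\<^bsub>B\<^esub> f a'" using add f fI by blast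
  next
    fix r a assume "r \<in> carrier R" "a \<in> carrier A"
    then show "f (r \<odot>\<^bsub>A\<^esub> a) = r \<odot>\<^bsub>B\<^esub> f a" using smult f fI by blast
  qed
  moreover have "bij_betw f (carrier A) (carrier B)"
  proof (rule bij_betw_imageI)
    show "inj_on f (carrier A)" using f uniq' by (metis inj_onI)
    show "f ` carrier A = carrier B"
    proof (intro equalityI subsetI)
      fix b assume "b \<in> f ` carrier A"
      then show "b \<in> carrier B" using f Gc(2) by blast
    next
      fix b assume "b \<in> carrier B"
      then obtain a where "(a, b) \<in> G" using right by blast
      then show "b \<in> f ` carrier A" using fI Gc(1) by blast
    qed
  qed
  ultimately show ?thesis unfolding mod_isomorphic_def by blast
qed

text \<open>The first projection of \<open>G\<close> is a submodule of \<open>B\<close> on which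
  \<open>G\<close> is a homomorphism, and the extension property applies to its inclusion.\<close>

lemma injective_module_graph:
  fixes B :: "('a, 'b) module"
  assumes E: "injective_module R E" and B: "module R B" and G: "partial_hom_graph R B E G"
  shows "\<exists>h\<in>mod_hom R B E. \<forall>(b, v)\<in>G. h b = v"
proof -
  have Em: "module R E" using E unfolding injective_module_def by blast
  interpret B: module R B by fact
  note Gd = G[unfolded partial_hom_graph_def]
  define g where "g b = (THE v. (b, v) \<in> G)" for b
  have g: "g b = v" if "(b, v) \<in> G" for b v
    unfolding g_def using that partial_hom_graph_unique[OF B Em G] by blast
  have sub: "submodule (fst ` G) R B"
    unfolding B.submodule_crit
  proof (intro conjI ballI)
    show "fst ` G \<subseteq> carrier B" "\<zero>\<^bsub>B\<^esub> \<in> fst ` G" using Gd by force+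
  next
    fix a b assume "a \<in> fst ` G" "b \<in> fst ` G"
    then obtain v w where "(a, v) \<in> G" "(b, w) \<in> G" by force
    then have "(a \<oplus>\<^bsub>B\<^esub> b, v \<oplus>\<^bsub>E\<^esub> w) \<in> G" using Gd by blast
    then show "a \<oplus>\<^bsub>B\<^esub> b \<in> fst ` G" by force
  next
    fix r a assume r: "r \<in> carrier R" and "a \<in> fst ` G"
    then obtain v where "(a, v) \<in> G" by force
    then have "(r \<odot>\<^bsub>B\<^esub> a, r \<odot>\<^bsub>E\<^esub> v) \<in> G" using Gd r by blast
    then show "r \<odot>\<^bsub>B\<^esub> a \<in> fst ` G" by force
  qed
  have "\<exists>h\<in>mod_hom R B E. \<forall>a\<in>carrier (B\<lparr>carrier := fst ` G\<rparr>). h (id a) = g a"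
  proof (rule injective_module_extension[OF E B.submodule_module[OF sub] B])
    show "id \<in> mod_hom R (B\<lparr>carrier := fst ` G\<rparr>) B"
      using B.submoduleD(1)[OF sub] by (intro mod_homI) auto
    show "g \<in> mod_hom R (B\<lparr>carrier := fst ` G\<rparr>) E"
    proof (rule mod_homI)
      fix a assume "a \<in> carrier (B\<lparr>carrier := fst ` G\<rparr>)"
      then obtain v where v: "(a, v) \<in> G" by force
      then have "v \<in> carrier E" using Gd by blast
      then show "g a \<in> carrier E" using g[OF v] by simp
    next
      fix a b assume "a \<in> carrier (B\<lparr>carrier := fst ` G\<rparr>)" "b \<in> carrier (B\<lparr>carrier := fst ` G\<rparr>)"
      then obtain v w where vw: "(a, v) \<in> G" "(b, w) \<in> G" by force
      then have "(a \<oplus>\<^bsub>B\<^esub> b, v \<oplus>\<^bsub>E\<^esub> w) \<in> G" using Gd by blast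
      then show "g (a \<oplus>\<^bsub>B\<lparr>carrier := fst ` G\<rparr>\<^esub> b) = g a \<oplus>\<^bsub>E\<^esub> g b" using vw by (simp add: g)
    next
      fix r a assume r: "r \<in> carrier R" and "a \<in> carrier (B\<lparr>carrier := fst ` G\<rparr>)"
      then obtain v where v: "(a, v) \<in> G" by force
      then have "(r \<odot>\<^bsub>B\<^esub> a, r \<odot>\<^bsub>E\<^esub> v) \<in> G" using Gd r by blast
      then show "g (r \<odot>\<^bsub>B\<lparr>carrier := fst ` G\<rparr>\<^esub> a) = r \<odot>\<^bsub>E\<^esub> g a" using v by (simp add: g)
    qed
  qed simp
  then obtain h where h: "h \<in> mod_hom R B E" "\<And>a. a \<in> fst ` G \<Longrightarrow> h a = g a" by auto
  have "h b = v" if "(b, v) \<in> G" for b v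
    using h(2)[of b] g[OF that] that by force
  then show ?thesis using h(1) by blast
qed

text \<open>The pairs \<open>(u a, v a)\<close> form a partial homomorphism because \<open>v\<close>
  vanishes on the kernel of \<open>u\<close>. The chain map \<open>\<phi>\<close> and the homotopy
  \<open>\<tau>\<close> are built degree by degree with this lemma.\<close>

lemma injective_module_factor:
  fixes A :: "('a, 'b) module" and B :: "('a, 'c) module"
  assumes E: "injective_module R E" and A: "module R A" and B: "module R B"
    and u: "u \<in> mod_hom R A B" and v: "v \<in> mod_hom R A E"
    and ker: "\<And>a. a \<in> carrier A \<Longrightarrow> u a = \<zero>\<^bsub>B\<^esub> \<Longrightarrow> v a = \<zero>\<^bsub>E\<^esub>"
  shows "\<exists>h\<in>mod_hom R B E. \<forall>a\<in>carrier A. h (u a) = v a"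
proof -
  have Em: "module R E" using E unfolding injective_module_def by blast
  interpret A: module R A by fact
  note u = mod_homD[OF u] mod_hom_zero[OF A B u] and v = mod_homD[OF v] mod_hom_zero[OF A Em v]
  have "partial_hom_graph R B E ((\<lambda>a. (u a, v a)) ` carrier A)" (is "partial_hom_graph R B E ?G")
    unfolding partial_hom_graph_def
  proof (intro conjI allI impI ballI)
    show "?G \<subseteq> carrier B \<times> carrier E" using u v by auto
    show "(\<zero>\<^bsub>B\<^esub>, \<zero>\<^bsub>E\<^esub>) \<in> ?G" using u(4) v(4) by (intro image_eqI[of _ _ "\<zero>\<^bsub>A\<^esub>"]) auto
  next
    fix p q p' q' assume "(p, q) \<in> ?G \<and> (p', q') \<in> ?G"
    then obtain a a' where "a \<in> carrier A" "a' \<in> carrier A" "p = u a" "q = v a" "p' = u a'" "q' = v a'" by blast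
    then show "(p \<oplus>\<^bsub>B\<^esub> p', q \<oplus>\<^bsub>E\<^esub> q') \<in> ?G" using u v by (intro image_eqI[of _ _ "a \<oplus>\<^bsub>A\<^esub> a'"]) auto
  next
    fix r p q assume "r \<in> carrier R" "(p, q) \<in> ?G"
    then obtain a where "r \<in> carrier R" "a \<in> carrier A" "p = u a" "q = v a" by blast
    then show "(r \<odot>\<^bsub>B\<^esub> p, r \<odot>\<^bsub>E\<^esub> q) \<in> ?G" using u v by (intro image_eqI[of _ _ "r \<odot>\<^bsub>A\<^esub> a"]) auto
  next
    fix q assume "(\<zero>\<^bsub>B\<^esub>, q) \<in> ?G"
    then show "q = \<zero>\<^bsub>E\<^esub>" using ker by auto
  qed
  from injective_module_graph[OF E B this] show ?thesis by simp
qed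


section \<open>Torsion, extension of homomorphisms and chain conditions\<close>

text \<open>Extension from ideals to the ring only. This is all that the torsion argument uses of
  injectivity, and it passes to sums and zero modules with elements in any type.\<close>

definition baer_module :: "('a, 'r) ring_scheme \<Rightarrow> ('a, 'e) module \<Rightarrow> bool" where
  "baer_module R E \<longleftrightarrow> module R E \<and> (\<forall>G. partial_hom_graph R (ring_as_module R) E G \<longrightarrow>
     (\<exists>e\<in>carrier E. \<forall>(r, v)\<in>G. v = r \<odot>\<^bsub>E\<^esub> e))"

lemma injective_imp_baer:
  assumes E: "injective_module R E"
  shows "baer_module R E"
  unfolding baer_module_def
proof (intro conjI allI impI)
  show "module R E" using E unfolding injective_module_def by blast
  then interpret E: module R E .
  note Rm = module_ring_as_module[OF E.R.is_cring]
  fix G assume G: "partial_hom_graph R (ring_as_module R) E G"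
  obtain h where h: "h \<in> mod_hom R (ring_as_module R) E" and "\<forall>(r, v)\<in>G. h r = v"
    using injective_module_graph[OF E Rm G] by (rule bexE)
  then have hG: "h r = v" if "(r, v) \<in> G" for r v using that by auto
  have hr: "h r = r \<odot>\<^bsub>E\<^esub> h \<one>\<^bsub>R\<^esub>" if "r \<in> carrier R" for r
    using mod_homD(3)[OF h, of r "\<one>\<^bsub>R\<^esub>"] that by (simp add: ring_as_module_def)
  have "r \<in> carrier R" if "(r, v) \<in> G" for r v
    using that G unfolding partial_hom_graph_def ring_as_module_def by auto
  then have "v = r \<odot>\<^bsub>E\<^esub> h \<one>\<^bsub>R\<^esub>" if "(r, v) \<in> G" for r v
    using hr hG that by metis
  moreover have "h \<one>\<^bsub>R\<^esub> \<in> carrier E"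
    using mod_homD(1)[OF h, of "\<one>\<^bsub>R\<^esub>"] by (simp add: ring_as_module_def)
  ultimately show "\<exists>e\<in>carrier E. \<forall>(r, v)\<in>G. v = r \<odot>\<^bsub>E\<^esub> e" by blast
qed

text \<open>Keeps the element type of \<open>E\<close>, so that it can fill the degrees left empty
  when a complex is shifted.\<close>

definition zero_module :: "('a, 'e) module \<Rightarrow> ('a, 'e) module" where
  "zero_module E = E\<lparr>carrier := {\<zero>\<^bsub>E\<^esub>}\<rparr>"

lemma zero_module_simps [simp]:
  "carrier (zero_module E) = {\<zero>\<^bsub>E\<^esub>}" "\<zero>\<^bsub>zero_module E\<^esub> = \<zero>\<^bsub>E\<^esub>"
  "a \<oplus>\<^bsub>zero_module E\<^esub> b = a \<oplus>\<^bsub>E\<^esub> b" "r \<odot>\<^bsub>zero_module E\<^esub> a = r \<odot>\<^bsub>E\<^esub> a"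
  by (simp_all add: zero_module_def)

lemma baer_zero_module:
  assumes "module R E"
  shows "baer_module R (zero_module E)"
proof -
  interpret E: module R E by fact
  have "submodule {\<zero>\<^bsub>E\<^esub>} R E" by (auto simp: E.submodule_crit)
  then have "module R (zero_module E)" unfolding zero_module_def by (rule E.submodule_module)
  moreover have "v = r \<odot>\<^bsub>E\<^esub> \<zero>\<^bsub>E\<^esub>"
    if "partial_hom_graph R (ring_as_module R) (zero_module E) G" "(r, v) \<in> G" for G r v
  proof -
    have "r \<in> carrier R" "v = \<zero>\<^bsub>E\<^esub>"
      using that unfolding partial_hom_graph_def ring_as_module_def by auto
    then show ?thesis by simp
  qed
  ultimately show ?thesis unfolding baer_module_def by auto
qed

lemma partial_hom_graph_comp:
  assumes B: "module R B" and E: "module R E" and E': "module R E'"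
    and G: "partial_hom_graph R B E G" and f: "f \<in> mod_hom R E E'"
  shows "partial_hom_graph R B E' ((\<lambda>(r, v). (r, f v)) ` G)" (is "partial_hom_graph R B E' ?G")
  unfolding partial_hom_graph_def
proof (intro conjI allI impI ballI)
  note Gd = G[unfolded partial_hom_graph_def] and f' = mod_homD[OF f] mod_hom_zero[OF E E' f]
  have sub: "G \<subseteq> carrier B \<times> carrier E" using Gd by blast
  then show "?G \<subseteq> carrier B \<times> carrier E'" using f' by auto
  have z: "(\<zero>\<^bsub>B\<^esub>, \<zero>\<^bsub>E\<^esub>) \<in> G" using Gd by blast
  then show "(\<zero>\<^bsub>B\<^esub>, \<zero>\<^bsub>E'\<^esub>) \<in> ?G" using f'(4) by force
  {
    fix u v u' v' assume "(u, v) \<in> ?G \<and> (u', v') \<in> ?G"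
    then obtain w w' where w: "(u, w) \<in> G" "(u', w') \<in> G" "v = f w" "v' = f w'" by auto
    then have c: "w \<in> carrier E" "w' \<in> carrier E" using sub by auto
    have "(u \<oplus>\<^bsub>B\<^esub> u', w \<oplus>\<^bsub>E\<^esub> w') \<in> G" using Gd w by blast
    moreover have "f (w \<oplus>\<^bsub>E\<^esub> w') = f w \<oplus>\<^bsub>E'\<^esub> f w'" using f'(2)[OF c] .
    ultimately
    show "(u \<oplus>\<^bsub>B\<^esub> u', v \<oplus>\<^bsub>E'\<^esub> v') \<in> ?G" using w by force
  next
    fix r u v assume r: "r \<in> carrier R" and "(u, v) \<in> ?G"
    then obtain w where w: "(u, w) \<in> G" "v = f w" by auto
    then have c: "w \<in> carrier E" using sub by auto
    have "(r \<odot>\<^bsub>B\<^esub> u, r \<odot>\<^bsub>E\<^esub> w) \<in> G" using Gd w r by blast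
    moreover have "f (r \<odot>\<^bsub>E\<^esub> w) = r \<odot>\<^bsub>E'\<^esub> f w" using f'(3)[OF r c] .
    ultimately show "(r \<odot>\<^bsub>B\<^esub> u, r \<odot>\<^bsub>E'\<^esub> v) \<in> ?G" using w by force
  next
    fix v assume "(\<zero>\<^bsub>B\<^esub>, v) \<in> ?G"
    then obtain w where w: "(\<zero>\<^bsub>B\<^esub>, w) \<in> G" "v = f w" by auto
    then have "w = \<zero>\<^bsub>E\<^esub>" using Gd by blast
    then show "v = \<zero>\<^bsub>E'\<^esub>" using w f' by simp
  }
qed

lemma baer_mod_sum:
  assumes "baer_module R A" "baer_module R B"
  shows "baer_module R (mod_sum A B)"
proof -
  have A: "module R A" and B: "module R B" using assms unfolding baer_module_def by auto
  interpret A: module R A by fact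
  interpret B: module R B by fact
  note AB = mod_sum_module[OF A B]
  note Rm = module_ring_as_module[OF A.R.is_cring]
  have fst: "fst \<in> mod_hom R (mod_sum A B) A" and snd: "snd \<in> mod_hom R (mod_sum A B) B"
    by (auto intro!: mod_homI simp: mod_sum_def)
  have "\<exists>e\<in>carrier (mod_sum A B). \<forall>(r, v)\<in>G. v = r \<odot>\<^bsub>mod_sum A B\<^esub> e"
    if G: "partial_hom_graph R (ring_as_module R) (mod_sum A B) G" for G
  proof -
    obtain e where e: "e \<in> carrier A" "\<forall>(r, v)\<in>(\<lambda>(r, v). (r, fst v)) ` G. v = r \<odot>\<^bsub>A\<^esub> e"
      using assms(1) partial_hom_graph_comp[OF Rm AB A G fst] unfolding baer_module_def by blast
    obtain e' where e': "e' \<in> carrier B" "\<forall>(r, v)\<in>(\<lambda>(r, v). (r, snd v)) ` G. v = r \<odot>\<^bsub>B\<^esub> e'"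
      using assms(2) partial_hom_graph_comp[OF Rm AB B G snd] unfolding baer_module_def by blast
    show ?thesis
      by (rule bexI[of _ "(e, e')"]) (use e e' in \<open>force simp: mod_sum_def\<close>)+
  qed
  then show ?thesis using AB unfolding baer_module_def by blast
qed

text \<open>The exponent may depend on \<open>a\<close>, so torsion can be tested one element at a
  time. Over a noetherian local ring this agrees with \<open>torsion_submodule\<close>, see
  \<open>carrier_torsion_submodule\<close>.\<close>

definition tors :: "('a, 'r) ring_scheme \<Rightarrow> 'a set \<Rightarrow> ('a, 'e) module \<Rightarrow> 'e set" where
  "tors R \<mm> E = {z \<in> carrier E. \<forall>a\<in>\<mm>. \<exists>n::nat. (a [^]\<^bsub>R\<^esub> n) \<odot>\<^bsub>E\<^esub> z = \<zero>\<^bsub>E\<^esub>}"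

text \<open>Multiplication by \<open>a\<close> maps \<open>0 :\<^sub>F J\<close> onto \<open>0 :\<^sub>F (J : a)\<close>. This trace of injectivity is inherited by
  the quotient of an injective module by its torsion.\<close>

definition cyclic_ext :: "('a, 'r) ring_scheme \<Rightarrow> ('a, 'e) module \<Rightarrow> bool" where
  "cyclic_ext R F \<longleftrightarrow> (\<forall>J a. \<forall>w\<in>carrier F. ideal J R \<longrightarrow> a \<in> carrier R \<longrightarrow>
     (\<forall>r\<in>ideal_colon R J a. r \<odot>\<^bsub>F\<^esub> w = \<zero>\<^bsub>F\<^esub>) \<longrightarrow>
     (\<exists>w'\<in>carrier F. (\<forall>j\<in>J. j \<odot>\<^bsub>F\<^esub> w' = \<zero>\<^bsub>F\<^esub>) \<and> a \<odot>\<^bsub>F\<^esub> w' = w))"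

lemma (in module) annihilator_ideal:
  assumes "w \<in> carrier M"
  shows "ideal {r \<in> carrier R. r \<odot>\<^bsub>M\<^esub> w = \<zero>\<^bsub>M\<^esub>} R"
  using assms unfolding R.ideal_crit by (auto simp: smult_l_distr smult_assoc1)

context noeth_local_ring
begin

lemma tors_mono_pow:
  assumes "module R E" "z \<in> carrier E" "a \<in> carrier R" "(a [^] (n::nat)) \<odot>\<^bsub>E\<^esub> z = \<zero>\<^bsub>E\<^esub>"
  shows "(a [^] (k + n)) \<odot>\<^bsub>E\<^esub> z = \<zero>\<^bsub>E\<^esub>"
proof -
  interpret E: module R E by fact
  show ?thesis using assms(2-) by (simp add: nat_pow_mult[symmetric] E.smult_assoc1)
qed

lemma tors_submodule:
  assumes E: "module R E"
  shows "submodule (tors R \<mm> E) R E"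
proof -
  interpret E: module R E by fact
  show ?thesis
    unfolding E.submodule_crit
  proof (intro conjI ballI)
    show "tors R \<mm> E \<subseteq> carrier E" "\<zero>\<^bsub>E\<^esub> \<in> tors R \<mm> E" using mm_carrier by (auto simp: tors_def)
  next
    fix u v assume uv: "u \<in> tors R \<mm> E" "v \<in> tors R \<mm> E"
    then have uvc: "u \<in> carrier E" "v \<in> carrier E" by (auto simp: tors_def)
    show "u \<oplus>\<^bsub>E\<^esub> v \<in> tors R \<mm> E"
      unfolding tors_def
    proof (intro CollectI conjI ballI)
      show "u \<oplus>\<^bsub>E\<^esub> v \<in> carrier E" using uvc by simp
      fix a assume a: "a \<in> \<mm>"
      then have aR: "a \<in> carrier R" using mm_carrier by blast
      obtain k l :: nat where "(a [^] k) \<odot>\<^bsub>E\<^esub> u = \<zero>\<^bsub>E\<^esub>" "(a [^] l) \<odot>\<^bsub>E\<^esub> v = \<zero>\<^bsub>E\<^esub>"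
        using uv a unfolding tors_def by blast
      then have "(a [^] (l + k)) \<odot>\<^bsub>E\<^esub> u = \<zero>\<^bsub>E\<^esub>" "(a [^] (k + l)) \<odot>\<^bsub>E\<^esub> v = \<zero>\<^bsub>E\<^esub>"
        using tors_mono_pow[OF E] uvc aR by blast+
      then have "(a [^] (k + l)) \<odot>\<^bsub>E\<^esub> (u \<oplus>\<^bsub>E\<^esub> v) = \<zero>\<^bsub>E\<^esub>"
        using uvc aR by (simp add: E.smult_r_distr add.commute)
      then show "\<exists>n::nat. (a [^] n) \<odot>\<^bsub>E\<^esub> (u \<oplus>\<^bsub>E\<^esub> v) = \<zero>\<^bsub>E\<^esub>" by blast
    qed
  next
    fix r u assume r: "r \<in> carrier R" and u: "u \<in> tors R \<mm> E"
    then have uc: "u \<in> carrier E" by (auto simp: tors_def)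
    show "r \<odot>\<^bsub>E\<^esub> u \<in> tors R \<mm> E"
      unfolding tors_def
    proof (intro CollectI conjI ballI)
      show "r \<odot>\<^bsub>E\<^esub> u \<in> carrier E" using uc r by simp
      fix a assume a: "a \<in> \<mm>"
      then have aR: "a \<in> carrier R" using mm_carrier by blast
      obtain k :: nat where "(a [^] k) \<odot>\<^bsub>E\<^esub> u = \<zero>\<^bsub>E\<^esub>" using u a unfolding tors_def by blast
      then have "(r \<otimes> a [^] k) \<odot>\<^bsub>E\<^esub> u = \<zero>\<^bsub>E\<^esub>" using r uc aR by (simp add: E.smult_assoc1)
      then have "(a [^] k) \<odot>\<^bsub>E\<^esub> (r \<odot>\<^bsub>E\<^esub> u) = \<zero>\<^bsub>E\<^esub>"
        using r uc aR by (simp add: E.smult_assoc1[symmetric] m_comm)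
      then show "\<exists>n::nat. (a [^] n) \<odot>\<^bsub>E\<^esub> (r \<odot>\<^bsub>E\<^esub> u) = \<zero>\<^bsub>E\<^esub>" by blast
    qed
  qed
qed

text \<open>The annihilator of a torsion element contains a power of each element of
  \<open>\<mm>\<close>, hence a power of \<open>\<mm>\<close> by
  \<open>power_subset_of_nilpotent\<close>.\<close>

lemma carrier_torsion_submodule:
  assumes E: "module R E"
  shows "carrier (torsion_submodule R \<mm> E) = tors R \<mm> E"
proof -
  interpret E: module R E by fact
  have "\<exists>n::nat. \<forall>a\<in>ideal_power R \<mm> n. a \<odot>\<^bsub>E\<^esub> z = \<zero>\<^bsub>E\<^esub>" if z: "z \<in> tors R \<mm> E" for z
  proof -
    have zc: "z \<in> carrier E" using z by (auto simp: tors_def)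
    have "\<exists>n. ideal_power R \<mm> n \<subseteq> {r \<in> carrier R. r \<odot>\<^bsub>E\<^esub> z = \<zero>\<^bsub>E\<^esub>}"
      using z mm_carrier
      by (intro power_subset_of_nilpotent E.annihilator_ideal[OF zc]) (auto simp: tors_def)
    then show ?thesis by blast
  qed
  then show ?thesis
    using ideal_power_elem[OF ideal_mm] unfolding torsion_submodule_def tors_def by simp blast
qed

text \<open>The exponents add up. In other words, \<open>E\<close> modulo its torsion is
  torsion-free.\<close>

lemma tors_closed:
  assumes E: "module R E" and z: "z \<in> carrier E"
    and tors: "\<And>a. a \<in> \<mm> \<Longrightarrow> \<exists>n::nat. (a [^] n) \<odot>\<^bsub>E\<^esub> z \<in> tors R \<mm> E"
  shows "z \<in> tors R \<mm> E"
proof -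
  interpret E: module R E by fact
  have "\<exists>n::nat. (a [^] n) \<odot>\<^bsub>E\<^esub> z = \<zero>\<^bsub>E\<^esub>" if a: "a \<in> \<mm>" for a
  proof -
    obtain n k :: nat where "(a [^] k) \<odot>\<^bsub>E\<^esub> ((a [^] n) \<odot>\<^bsub>E\<^esub> z) = \<zero>\<^bsub>E\<^esub>"
      using tors[OF a] a unfolding tors_def by blast
    then have "(a [^] (k + n)) \<odot>\<^bsub>E\<^esub> z = \<zero>\<^bsub>E\<^esub>"
      using mm_carrier[OF a] z by (simp add: nat_pow_mult[symmetric] E.smult_assoc1)
    then show ?thesis by blast
  qed
  then show ?thesis using z unfolding tors_def by blast
qed

text \<open>A weak form of the Artin--Rees lemma, for the annihilator of \<open>w\<close>.\<close>

lemma artin_rees_annihilator: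
  assumes E: "module R E" and w: "w \<in> carrier E" and I: "ideal I R"
    and Iw: "\<And>t. t \<in> I \<Longrightarrow> t \<odot>\<^bsub>E\<^esub> w \<in> tors R \<mm> E"
  obtains L where "ideal L R" "\<And>r. r \<in> L \<Longrightarrow> r \<in> I \<Longrightarrow> r \<odot>\<^bsub>E\<^esub> w = \<zero>\<^bsub>E\<^esub>"
    "\<And>b. b \<in> \<mm> \<Longrightarrow> \<exists>n::nat. b [^] n \<in> L"
proof -
  interpret E: module R E by fact
  define K where "K = {r \<in> carrier R. r \<odot>\<^bsub>E\<^esub> w = \<zero>\<^bsub>E\<^esub>}"
  have K: "ideal K R" unfolding K_def by (rule E.annihilator_ideal[OF w])
  \<comment> \<open>Maximality does the work of the Artin-Rees estimate: it will force a power of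
    each \<open>b\<close> in \<open>\<mm>\<close> into \<open>L\<close>.\<close>
  obtain L where L: "ideal L R \<and> K \<subseteq> L \<and> L \<inter> I \<subseteq> K"
    and max: "\<And>L'. ideal L' R \<and> K \<subseteq> L' \<and> L' \<inter> I \<subseteq> K \<Longrightarrow> L \<subseteq> L' \<Longrightarrow> L' = L"
    by (rule ex_maximal_ideal[of "\<lambda>L. ideal L R \<and> K \<subseteq> L \<and> L \<inter> I \<subseteq> K" K]) (use K in auto)
  have Li: "ideal L R" using L by blast
  note Ld = Li[unfolded ideal_crit]
  have Ic: "I \<subseteq> carrier R" using I unfolding ideal_crit by blast
  have colon_chain: "\<exists>n::nat. \<forall>k::nat. ideal_colon R J (c [^] k) \<subseteq> ideal_colon R J (c [^] n)"
    if J: "ideal J R" and c: "c \<in> carrier R" for J c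
  proof (rule ideal_chain_stable)
    fix n :: nat
    show "ideal (ideal_colon R J (c [^] n)) R" using J c by (intro ideal_colon_ideal) auto
    show "ideal_colon R J (c [^] n) \<subseteq> ideal_colon R J (c [^] Suc n)"
    proof
      fix t assume "t \<in> ideal_colon R J (c [^] n)"
      then have t: "t \<in> carrier R" "t \<otimes> c [^] n \<in> J" unfolding ideal_colon_def by auto
      have "t \<otimes> c [^] Suc n = c \<otimes> (t \<otimes> c [^] n)" using t c by (simp add: m_ac)
      then show "t \<in> ideal_colon R J (c [^] Suc n)"
        using t c J unfolding ideal_colon_def ideal_crit by auto
    qed
  qed
  have "\<exists>n::nat. b [^] n \<in> L" if b: "b \<in> \<mm>" for b
  proof -
    have bR: "b \<in> carrier R" using mm_carrier[OF b] .
    \<comment> \<open>The exponent that kills \<open>t w\<close> depends on \<open>t\<close> at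
      first. Since the ideals \<open>(K : b^k)\<close> become stationary, the single power
      \<open>c = b^N\<close> kills \<open>t w\<close> for every \<open>t\<close> in
      \<open>I\<close>.\<close>
    obtain N :: nat where N: "\<And>k::nat. ideal_colon R K (b [^] k) \<subseteq> ideal_colon R K (b [^] N)"
      using colon_chain[OF K bR] by blast
    define c where "c = b [^] N"
    have c: "c \<in> carrier R" using bR unfolding c_def by simp
    have cK: "t \<otimes> c \<in> K" if t: "t \<in> I" for t
    proof -
      have tR: "t \<in> carrier R" using t Ic by blast
      obtain n :: nat where "(b [^] n) \<odot>\<^bsub>E\<^esub> (t \<odot>\<^bsub>E\<^esub> w) = \<zero>\<^bsub>E\<^esub>" using Iw[OF t] b unfolding tors_def by blast
      then have "(t \<otimes> b [^] n) \<odot>\<^bsub>E\<^esub> w = \<zero>\<^bsub>E\<^esub>"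
        using tR bR w by (simp add: E.smult_assoc1[symmetric] m_comm)
      then have "t \<in> ideal_colon R K (b [^] n)"
        using tR bR unfolding ideal_colon_def K_def by auto
      then have "t \<in> ideal_colon R K c" unfolding c_def using N by blast
      then show ?thesis unfolding ideal_colon_def by blast
    qed
    obtain n :: nat where n: "\<And>k::nat. ideal_colon R L (c [^] k) \<subseteq> ideal_colon R L (c [^] n)"
      using colon_chain[OF Li c] by blast
    have cn: "c [^] n \<in> carrier R" using c by simp
    have "t \<in> K" if t: "t \<in> ideal_adjoin R L (c [^] n)" "t \<in> I" for t
    proof -
      obtain l v where lv: "l \<in> L" "v \<in> carrier R" "t = l \<oplus> v \<otimes> c [^] n"
        using t(1) unfolding ideal_adjoin_def by blast
      have l: "l \<in> carrier R" using lv Ld by blast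
      have tR: "t \<in> carrier R" using t(2) Ic by blast
      \<comment> \<open>As \<open>t c\<close> lies in \<open>K\<close> and so in \<open>L\<close>,
        also \<open>v c^(n+1) = t c - c l\<close> does. The choice of \<open>n\<close> lowers the
        exponent: \<open>v c^n\<close> is in \<open>L\<close>, hence so is \<open>t\<close>. Thus
        adjoining \<open>c^n\<close> keeps the intersection with \<open>I\<close> inside
        \<open>K\<close>.\<close>
      have "t \<otimes> c \<oplus> (\<ominus> c) \<otimes> l = v \<otimes> (c [^] n \<otimes> c) \<oplus> (c \<otimes> l \<oplus> \<ominus> (c \<otimes> l))"
        unfolding lv(3) l_minus[OF c l] using lv(2) l c cn by (simp add: l_distr m_comm[of l c] m_assoc a_ac)
      then have "v \<otimes> c [^] Suc n = t \<otimes> c \<oplus> (\<ominus> c) \<otimes> l"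
        using lv(2) l c cn by (simp add: r_neg)
      moreover have "\<dots> \<in> L" using cK[OF t(2)] L lv(1) c Ld by auto
      ultimately have "v \<in> ideal_colon R L (c [^] Suc n)" using lv(2) unfolding ideal_colon_def by simp
      then have "v \<in> ideal_colon R L (c [^] n)" using n by blast
      then have "t \<in> L" using lv Ld unfolding ideal_colon_def by blast
      then show ?thesis using L t(2) by blast
    qed
    then have "ideal_adjoin R L (c [^] n) = L"
      using max[of "ideal_adjoin R L (c [^] n)"] ideal_adjoin_ideal[OF Li cn] ideal_adjoin_incl[OF Li cn] L
      by (meson IntE subsetI subset_trans)
    then have "c [^] n \<in> L" using ideal_adjoin_incl[OF Li cn] by simp
    then have "b [^] (N * n) \<in> L" unfolding c_def using bR by (simp add: nat_pow_pow)
    then show ?thesis by blast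
  qed
  moreover have "r \<odot>\<^bsub>E\<^esub> w = \<zero>\<^bsub>E\<^esub>" if "r \<in> L" "r \<in> I" for r using that L unfolding K_def by blast
  ultimately show thesis using that Li by blast
qed

text \<open>Lift the class \<open>W\<close> to \<open>w\<close> in \<open>E\<close>. The assignment
  \<open>r a + j |-> r w\<close> need not be well defined, for \<open>(J : a) w\<close> is only
  torsion; it becomes so for \<open>r\<close> in the ideal \<open>L\<close> of
  \<open>artin_rees_annihilator\<close>. Baer's criterion extends it to multiplication by some
  \<open>e\<close>. Then \<open>J e = 0\<close> and \<open>L\<close> kills \<open>a e - w\<close>,
  which is therefore torsion.\<close>

lemma cyclic_ext_mod_tors:
  assumes "baer_module R E"
  shows "cyclic_ext R (mod_quot E (tors R \<mm> E))"
proof -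
  have E: "module R E" using assms unfolding baer_module_def by blast
  interpret E: module R E by fact
  let ?N = "tors R \<mm> E"
  note N = tors_submodule[OF E]
  note qs = mod_quot_simps[OF E N]
  have zero: "?N +>\<^bsub>E\<^esub> z = \<zero>\<^bsub>mod_quot E ?N\<^esub> \<longleftrightarrow> z \<in> ?N" if "z \<in> carrier E" for z
    using E.coset_zero_iff[OF N that] qs(3) by simp
  show ?thesis
    unfolding cyclic_ext_def
  proof (intro allI ballI impI)
    fix J a W
    assume J: "ideal J R" and a: "a \<in> carrier R" and W: "W \<in> carrier (mod_quot E ?N)"
      and ann: "\<forall>r\<in>ideal_colon R J a. r \<odot>\<^bsub>mod_quot E ?N\<^esub> W = \<zero>\<^bsub>mod_quot E ?N\<^esub>"
    note Jd = J[unfolded ideal_crit]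
    obtain w where w: "w \<in> carrier E" "W = ?N +>\<^bsub>E\<^esub> w" using W qs(1) by auto
    have I: "ideal (ideal_colon R J a) R" by (rule ideal_colon_ideal[OF J a])
    have Iw: "t \<odot>\<^bsub>E\<^esub> w \<in> ?N" if t: "t \<in> ideal_colon R J a" for t
    proof -
      have "t \<in> carrier R" using t unfolding ideal_colon_def by blast
      then show ?thesis using ann t w by (auto simp: qs(4) zero)
    qed
    obtain L where L: "ideal L R" and LK: "\<And>r. r \<in> L \<Longrightarrow> r \<in> ideal_colon R J a \<Longrightarrow> r \<odot>\<^bsub>E\<^esub> w = \<zero>\<^bsub>E\<^esub>"
      and Lm: "\<And>b. b \<in> \<mm> \<Longrightarrow> \<exists>n::nat. b [^] n \<in> L"
      using artin_rees_annihilator[OF E w(1) I Iw] by blast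
    note Ld = L[unfolded ideal_crit]
    have Lc: "r \<in> carrier R" if "r \<in> L" for r using that Ld by blast
    have Jc: "r \<in> carrier R" if "r \<in> J" for r using that Jd by blast
    define G where "G = {(r \<otimes> a \<oplus> j, r \<odot>\<^bsub>E\<^esub> w) | r j. r \<in> L \<and> j \<in> J}"
    have GI: "(s, t) \<in> G" if "s = r \<otimes> a \<oplus> j" "t = r \<odot>\<^bsub>E\<^esub> w" "r \<in> L" "j \<in> J" for s t r j
      using that unfolding G_def by blast
    have "partial_hom_graph R (ring_as_module R) E G"
      unfolding partial_hom_graph_def
    proof (intro conjI allI impI ballI)
      show "G \<subseteq> carrier (ring_as_module R) \<times> carrier E"
        using a w(1) Lc Jc unfolding G_def ring_as_module_def by auto
      show "(\<zero>\<^bsub>ring_as_module R\<^esub>, \<zero>\<^bsub>E\<^esub>) \<in> G"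
        by (rule GI[of _ \<zero> \<zero>]) (use a w(1) Ld Jd in \<open>auto simp: ring_as_module_def\<close>)
    next
      fix u v u' v' assume "(u, v) \<in> G \<and> (u', v') \<in> G"
      then obtain r j r' j' where *: "r \<in> L" "r' \<in> L" "j \<in> J" "j' \<in> J"
        "u = r \<otimes> a \<oplus> j" "v = r \<odot>\<^bsub>E\<^esub> w" "u' = r' \<otimes> a \<oplus> j'" "v' = r' \<odot>\<^bsub>E\<^esub> w"
        unfolding G_def by blast
      show "(u \<oplus>\<^bsub>ring_as_module R\<^esub> u', v \<oplus>\<^bsub>E\<^esub> v') \<in> G"
        by (rule GI[of _ "r \<oplus> r'" "j \<oplus> j'"])
          (use * a w(1) Lc Jc Ld Jd in \<open>auto simp: ring_as_module_def l_distr E.smult_l_distr a_ac E.M.a_comm\<close>)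
    next
      fix s u v assume s: "s \<in> carrier R" and "(u, v) \<in> G"
      then obtain r j where *: "r \<in> L" "j \<in> J" "u = r \<otimes> a \<oplus> j" "v = r \<odot>\<^bsub>E\<^esub> w"
        unfolding G_def by blast
      show "(s \<odot>\<^bsub>ring_as_module R\<^esub> u, s \<odot>\<^bsub>E\<^esub> v) \<in> G"
        by (rule GI[of _ "s \<otimes> r" "s \<otimes> j"])
          (use * s a w(1) Lc Jc Ld Jd in \<open>auto simp: ring_as_module_def r_distr m_assoc E.smult_assoc1\<close>)
    next
      fix v assume "(\<zero>\<^bsub>ring_as_module R\<^esub>, v) \<in> G"
      then obtain r j where *: "r \<in> L" "j \<in> J" "\<zero> = r \<otimes> a \<oplus> j" "v = r \<odot>\<^bsub>E\<^esub> w"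
        unfolding G_def ring_as_module_def by auto
      \<comment> \<open>A pair over zero has \<open>r\<close> in both \<open>L\<close> and
        \<open>(J : a)\<close>, the intersection that kills \<open>w\<close>.\<close>
      have "r \<otimes> a = \<ominus> j" using *(1-3) a Lc Jc by (metis minus_equality m_closed)
      also have "\<dots> = \<ominus> \<one> \<otimes> j" using *(2) Jc by (simp add: l_minus)
      also have "\<dots> \<in> J" using *(2) Jd by auto
      finally have "r \<in> ideal_colon R J a" using *(1) Lc unfolding ideal_colon_def by blast
      then show "v = \<zero>\<^bsub>E\<^esub>" using LK *(1,4) by blast
    qed
    then obtain e where e: "e \<in> carrier E" "\<And>r v. (r, v) \<in> G \<Longrightarrow> v = r \<odot>\<^bsub>E\<^esub> e"
      using assms unfolding baer_module_def by blast
    have Je: "j \<odot>\<^bsub>E\<^esub> e = \<zero>\<^bsub>E\<^esub>" if j: "j \<in> J" for j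
    proof -
      have "(j, \<zero>\<^bsub>E\<^esub>) \<in> G" by (rule GI[of _ \<zero> j]) (use a w(1) j Ld Jc in auto)
      then show ?thesis using e(2) by force
    qed
    have Le: "r \<odot>\<^bsub>E\<^esub> (a \<odot>\<^bsub>E\<^esub> e \<ominus>\<^bsub>E\<^esub> w) = \<zero>\<^bsub>E\<^esub>" if r: "r \<in> L" for r
    proof -
      have "(r \<otimes> a, r \<odot>\<^bsub>E\<^esub> w) \<in> G" by (rule GI[of _ r \<zero>]) (use a w(1) r Lc Jd in auto)
      then have "r \<odot>\<^bsub>E\<^esub> w = r \<odot>\<^bsub>E\<^esub> (a \<odot>\<^bsub>E\<^esub> e)" using e Lc[OF r] a by (metis E.smult_assoc1)
      then show ?thesis
        using Lc[OF r] a w(1) e(1) by (simp add: E.minus_eq E.smult_r_distr E.smult_r_minus E.M.r_neg)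
    qed
    have "a \<odot>\<^bsub>E\<^esub> e \<ominus>\<^bsub>E\<^esub> w \<in> ?N"
      unfolding tors_def using Lm Le a w(1) e(1) by blast
    then have "a \<odot>\<^bsub>mod_quot E ?N\<^esub> (?N +>\<^bsub>E\<^esub> e) = W"
      using a w e(1) by (simp add: qs(4) E.coset_eq_iff[OF N])
    moreover have "j \<odot>\<^bsub>mod_quot E ?N\<^esub> (?N +>\<^bsub>E\<^esub> e) = \<zero>\<^bsub>mod_quot E ?N\<^esub>" if "j \<in> J" for j
      using Je[OF that] Jc[OF that] e(1) E.submoduleD(2)[OF N] by (simp add: qs(4) zero)
    ultimately show "\<exists>w'\<in>carrier (mod_quot E ?N). (\<forall>j\<in>J. j \<odot>\<^bsub>mod_quot E ?N\<^esub> w' = \<zero>\<^bsub>mod_quot E ?N\<^esub>)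
        \<and> a \<odot>\<^bsub>mod_quot E ?N\<^esub> w' = W"
      using e(1) by (intro bexI[of _ "?N +>\<^bsub>E\<^esub> e"]) (auto simp: qs(1))
  qed
qed

end

section \<open>The ascending chain condition for finitely generated modules\<close>

definition acc_on :: "('a, 'r) ring_scheme \<Rightarrow> ('a, 'b) module \<Rightarrow> 'b set \<Rightarrow> bool" where
  "acc_on R M N \<longleftrightarrow> (\<forall>U::nat \<Rightarrow> 'b set. (\<forall>n. submodule (U n) R M \<and> U n \<subseteq> N \<and> U n \<subseteq> U (Suc n)) \<longrightarrow>
     (\<exists>n. \<forall>k. U k \<subseteq> U n))"

lemma chain_mono: "(\<And>n::nat. U n \<subseteq> U (Suc n)) \<Longrightarrow> k \<le> l \<Longrightarrow> U k \<subseteq> U l"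
  using lift_Suc_mono_le[of U k l] by blast

text \<open>Generators are added one at a time. A chain inside \<open>N + R m\<close> is controlled
  by its traces on \<open>N\<close> and by the ideals of coefficients at \<open>m\<close>.\<close>

lemma (in noeth_local_ring) acc_finitely_generated:
  assumes "finitely_generated_module R M"
  shows "acc_on R M (carrier M)"
proof -
  from assms obtain S where M: "module R M" and S: "finite S" "S \<subseteq> carrier M"
    "\<Inter>{N. submodule N R M \<and> S \<subseteq> N} = carrier M"
    unfolding finitely_generated_module_def by blast
  interpret M: module R M by fact
  have step: "\<exists>N'. submodule N' R M \<and> acc_on R M N' \<and> insert m N \<subseteq> N'"
    if N: "submodule N R M" "acc_on R M N" and m: "m \<in> carrier M" for N m
  proof (intro exI conjI)
    let ?N = "{n \<oplus>\<^bsub>M\<^esub> r \<odot>\<^bsub>M\<^esub> m | n r. n \<in> N \<and> r \<in> carrier R}"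
    note Nd = M.submoduleD[OF N(1)]
    have NI: "z \<in> ?N" if "z = n \<oplus>\<^bsub>M\<^esub> r \<odot>\<^bsub>M\<^esub> m" "n \<in> N" "r \<in> carrier R" for z n r
      using that by blast
    show "submodule ?N R M"
      unfolding M.submodule_crit
    proof (intro conjI ballI)
      show "?N \<subseteq> carrier M" using Nd(1) m by auto
      show "\<zero>\<^bsub>M\<^esub> \<in> ?N" by (rule NI[of _ "\<zero>\<^bsub>M\<^esub>" \<zero>]) (use Nd(2) m in auto)
    next
      fix u v assume "u \<in> ?N" "v \<in> ?N"
      then obtain n r n' r' where *: "n \<in> N" "n' \<in> N" "r \<in> carrier R" "r' \<in> carrier R"
        "u = n \<oplus>\<^bsub>M\<^esub> r \<odot>\<^bsub>M\<^esub> m" "v = n' \<oplus>\<^bsub>M\<^esub> r' \<odot>\<^bsub>M\<^esub> m" by blast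
      show "u \<oplus>\<^bsub>M\<^esub> v \<in> ?N"
        by (rule NI[of _ "n \<oplus>\<^bsub>M\<^esub> n'" "r \<oplus> r'"]) (use * Nd m in \<open>auto simp: M.smult_l_distr M.M.a_ac\<close>)
    next
      fix s u assume s: "s \<in> carrier R" and "u \<in> ?N"
      then obtain n r where *: "n \<in> N" "r \<in> carrier R" "u = n \<oplus>\<^bsub>M\<^esub> r \<odot>\<^bsub>M\<^esub> m" by blast
      show "s \<odot>\<^bsub>M\<^esub> u \<in> ?N"
        by (rule NI[of _ "s \<odot>\<^bsub>M\<^esub> n" "s \<otimes> r"]) (use s * Nd m in \<open>auto simp: M.smult_r_distr M.smult_assoc1\<close>)
    qed
    show "insert m N \<subseteq> ?N"
    proof
      fix z assume "z \<in> insert m N"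
      then consider "z = m" | "z \<in> N" by blast
      then show "z \<in> ?N"
      proof cases
        case 1
        show ?thesis by (rule NI[of _ "\<zero>\<^bsub>M\<^esub>" \<one>]) (use 1 Nd m in auto)
      next
        case 2
        show ?thesis by (rule NI[of _ z \<zero>]) (use 2 Nd m in auto)
      qed
    qed
    show "acc_on R M ?N"
      unfolding acc_on_def
    proof (intro allI impI)
      fix U :: "nat \<Rightarrow> _ set"
      assume U: "\<forall>n. submodule (U n) R M \<and> U n \<subseteq> ?N \<and> U n \<subseteq> U (Suc n)"
      have Us: "submodule (U n) R M" for n using U by blast
      note Ud = M.submoduleD[OF Us]
      have mono: "U k \<subseteq> U l" if "k \<le> l" for k l using chain_mono[of U] U that by blast
      have "\<forall>n. submodule (U n \<inter> N) R M \<and> U n \<inter> N \<subseteq> N \<and> U n \<inter> N \<subseteq> U (Suc n) \<inter> N"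
        using Us N(1) subsetD[OF mono[OF le_SucI[OF order_refl]]] unfolding M.submodule_crit by auto
      then obtain n1 where n1: "\<And>k. U k \<inter> N \<subseteq> U n1 \<inter> N" using N(2) unfolding acc_on_def by meson
      define I where "I n = {r \<in> carrier R. \<exists>z\<in>N. z \<oplus>\<^bsub>M\<^esub> r \<odot>\<^bsub>M\<^esub> m \<in> U n}" for n
      have "\<exists>n. \<forall>k. I k \<subseteq> I n"
      proof (rule ideal_chain_stable)
        show "I n \<subseteq> I (Suc n)" for n using mono[of n "Suc n"] unfolding I_def by auto
        show "ideal (I n) R" for n
          unfolding ideal_crit
        proof (intro conjI ballI)
          show "I n \<subseteq> carrier R" unfolding I_def by blast
          show "\<zero> \<in> I n" unfolding I_def using Nd(2) Ud(2) m by (intro CollectI conjI bexI[of _ "\<zero>\<^bsub>M\<^esub>"]) auto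
        next
          fix r s assume "r \<in> I n" "s \<in> I n"
          then obtain z z' where *: "r \<in> carrier R" "s \<in> carrier R" "z \<in> N" "z' \<in> N"
            "z \<oplus>\<^bsub>M\<^esub> r \<odot>\<^bsub>M\<^esub> m \<in> U n" "z' \<oplus>\<^bsub>M\<^esub> s \<odot>\<^bsub>M\<^esub> m \<in> U n" unfolding I_def by blast
          have "(z \<oplus>\<^bsub>M\<^esub> z') \<oplus>\<^bsub>M\<^esub> (r \<oplus> s) \<odot>\<^bsub>M\<^esub> m = (z \<oplus>\<^bsub>M\<^esub> r \<odot>\<^bsub>M\<^esub> m) \<oplus>\<^bsub>M\<^esub> (z' \<oplus>\<^bsub>M\<^esub> s \<odot>\<^bsub>M\<^esub> m)"
            using * Nd(1) m by (simp add: M.smult_l_distr M.M.a_ac)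
          also have "\<dots> \<in> U n" using * Ud(3) by blast
          finally show "r \<oplus> s \<in> I n" unfolding I_def using * Nd(3) by blast
        next
          fix t r assume t: "t \<in> carrier R" and "r \<in> I n"
          then obtain z where *: "r \<in> carrier R" "z \<in> N" "z \<oplus>\<^bsub>M\<^esub> r \<odot>\<^bsub>M\<^esub> m \<in> U n" unfolding I_def by blast
          have "t \<odot>\<^bsub>M\<^esub> z \<oplus>\<^bsub>M\<^esub> (t \<otimes> r) \<odot>\<^bsub>M\<^esub> m = t \<odot>\<^bsub>M\<^esub> (z \<oplus>\<^bsub>M\<^esub> r \<odot>\<^bsub>M\<^esub> m)"
            using * t Nd(1) m by (simp add: M.smult_r_distr M.smult_assoc1)
          also have "\<dots> \<in> U n" using * t Ud(4) by blast
          finally show "t \<otimes> r \<in> I n" unfolding I_def using * t Nd(4) by blast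
        qed
      qed
      then obtain n2 where n2: "\<And>k. I k \<subseteq> I n2" by blast
      have "U k \<subseteq> U (max n1 n2)" for k
      proof
        fix u assume u: "u \<in> U k"
        then obtain z r where zr: "z \<in> N" "r \<in> carrier R" "u = z \<oplus>\<^bsub>M\<^esub> r \<odot>\<^bsub>M\<^esub> m" using U by blast
        then have "r \<in> I k" using u unfolding I_def by blast
        then obtain z' where z': "z' \<in> N" "z' \<oplus>\<^bsub>M\<^esub> r \<odot>\<^bsub>M\<^esub> m \<in> U n2" using n2 unfolding I_def by blast
        let ?u' = "z' \<oplus>\<^bsub>M\<^esub> r \<odot>\<^bsub>M\<^esub> m"
        have c: "z \<in> carrier M" "z' \<in> carrier M" "r \<odot>\<^bsub>M\<^esub> m \<in> carrier M" using zr z' Nd(1) m by auto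
        \<comment> \<open>\<open>u\<close> and \<open>?u'\<close> have the same coefficient at
          \<open>m\<close>, so their difference lies in \<open>N\<close>, where the chain is
          stationary from \<open>n1\<close> on.\<close>
        have "u \<ominus>\<^bsub>M\<^esub> ?u' = z \<ominus>\<^bsub>M\<^esub> z'"
          using c zr(3) by (simp add: M.minus_eq M.M.minus_add M.M.a_ac M.M.r_neg M.M.r_neg1 M.M.r_neg2)
        moreover have "u \<ominus>\<^bsub>M\<^esub> ?u' \<in> U (max k n2)"
          using u z'(2) mono[of k "max k n2"] mono[of n2 "max k n2"] Ud(6) by (simp add: subset_iff)
        ultimately have "u \<ominus>\<^bsub>M\<^esub> ?u' \<in> U n1" using n1[of "max k n2"] Nd(6)[OF zr(1) z'(1)] by auto
        then have "u \<ominus>\<^bsub>M\<^esub> ?u' \<in> U (max n1 n2)" "?u' \<in> U (max n1 n2)"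
          using z'(2) mono[of n1 "max n1 n2"] mono[of n2 "max n1 n2"] by auto
        then have "(u \<ominus>\<^bsub>M\<^esub> ?u') \<oplus>\<^bsub>M\<^esub> ?u' \<in> U (max n1 n2)" using Ud(3) by blast
        then show "u \<in> U (max n1 n2)" using c zr(3) by (simp add: M.M.minus_add_cancel)
      qed
      then show "\<exists>n. \<forall>k. U k \<subseteq> U n" by blast
    qed
  qed
  have "\<exists>N. submodule N R M \<and> acc_on R M N \<and> S \<subseteq> N"
    using S(1,2)
  proof (induction S rule: finite_induct)
    case empty
    have "submodule {\<zero>\<^bsub>M\<^esub>} R M" by (auto simp: M.submodule_crit)
    moreover have "acc_on R M {\<zero>\<^bsub>M\<^esub>}"
      unfolding acc_on_def
    proof (intro allI impI exI[of _ 0])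
      fix U :: "nat \<Rightarrow> _ set" and k
      assume U: "\<forall>n. submodule (U n) R M \<and> U n \<subseteq> {\<zero>\<^bsub>M\<^esub>} \<and> U n \<subseteq> U (Suc n)"
      then have "\<zero>\<^bsub>M\<^esub> \<in> U 0" using M.submoduleD(2) by blast
      moreover have "U k \<subseteq> {\<zero>\<^bsub>M\<^esub>}" using U by blast
      ultimately show "U k \<subseteq> U 0" by auto
    qed
    ultimately show ?case by blast
  next
    case (insert m S)
    then show ?case using step[of _ m] by (meson insert_subset subset_trans)
  qed
  then obtain N where N: "submodule N R M" "acc_on R M N" "S \<subseteq> N" by blast
  then have "carrier M \<subseteq> N" using S(3) by blast
  then have "N = carrier M" using N(1) M.submoduleD(1) by blast
  then show ?thesis using N(2) by simp
qed


section \<open>Annihilators in complexes\<close>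

locale cyclic_ext_complex = noeth_local_ring R \<mm> for R (structure) and \<mm> +
  fixes F :: "nat \<Rightarrow> ('a, 'e) module" and d :: "nat \<Rightarrow> 'e \<Rightarrow> 'e"
  assumes F_module: "module R (F n)"
    and d_hom: "d n \<in> mod_hom R (F n) (F (Suc n))"
    and d_d: "z \<in> carrier (F n) \<Longrightarrow> d (Suc n) (d n z) = \<zero>\<^bsub>F (Suc (Suc n))\<^esub>"
    and F_ext: "cyclic_ext R (F n)"
begin

sublocale Fm: module R "F n" for n by (rule F_module)

lemmas d_simps [simp] = mod_homD[OF d_hom] mod_hom_zero[OF F_module F_module d_hom]
  mod_hom_neg[OF F_module F_module d_hom] mod_hom_minus[OF F_module F_module d_hom]

definition annih :: "nat \<Rightarrow> 'a set \<Rightarrow> 'e set" where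
  "annih n J = {w \<in> carrier (F n). \<forall>j\<in>J. j \<odot>\<^bsub>F n\<^esub> w = \<zero>\<^bsub>F n\<^esub>}"

definition cyc :: "nat \<Rightarrow> 'a set \<Rightarrow> 'e set" where
  "cyc n J = {w \<in> annih n J. d n w = \<zero>\<^bsub>F (Suc n)\<^esub>}"

definition bnd :: "nat \<Rightarrow> 'a set \<Rightarrow> 'e set" where
  "bnd n J = (case n of 0 \<Rightarrow> {\<zero>\<^bsub>F 0\<^esub>} | Suc k \<Rightarrow> d k ` annih k J)"

text \<open>Vanishing of the \<open>n\<close>-th cohomology of \<open>Hom(R/J, F)\<close>, whose terms are the modules \<open>annih n J\<close>.\<close>

definition acyc :: "nat \<Rightarrow> 'a set \<Rightarrow> bool" where
  "acyc n J \<longleftrightarrow> cyc n J \<subseteq> bnd n J"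

lemma annih_carrier: "w \<in> annih n J \<Longrightarrow> w \<in> carrier (F n)"
  unfolding annih_def by blast

lemma cyc_annih: "w \<in> cyc n J \<Longrightarrow> w \<in> annih n J"
  unfolding cyc_def by blast

lemma cyc_carrier: "w \<in> cyc n J \<Longrightarrow> w \<in> carrier (F n)"
  unfolding cyc_def annih_def by blast

lemma annih_submodule:
  assumes "J \<subseteq> carrier R"
  shows "submodule (annih n J) R (F n)"
proof -
  have "j \<odot>\<^bsub>F n\<^esub> (r \<odot>\<^bsub>F n\<^esub> w) = \<zero>\<^bsub>F n\<^esub>"
    if "j \<in> J" "r \<in> carrier R" "w \<in> carrier (F n)" "j \<odot>\<^bsub>F n\<^esub> w = \<zero>\<^bsub>F n\<^esub>" for j r w
  proof -
    have j: "j \<in> carrier R" using that(1) assms by blast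
    have "j \<odot>\<^bsub>F n\<^esub> (r \<odot>\<^bsub>F n\<^esub> w) = r \<odot>\<^bsub>F n\<^esub> (j \<odot>\<^bsub>F n\<^esub> w)"
      using that(2,3) j by (simp add: Fm.smult_assoc1[symmetric] m_comm)
    then show ?thesis using that by simp
  qed
  then show ?thesis
    using assms unfolding Fm.submodule_crit annih_def by (auto simp: Fm.smult_r_distr subset_eq)
qed

lemma cyc_submodule:
  assumes "J \<subseteq> carrier R"
  shows "submodule (cyc n J) R (F n)"
  using annih_submodule[OF assms, of n] unfolding Fm.submodule_crit cyc_def by (auto simp: subset_eq)

lemma bnd_submodule:
  assumes "J \<subseteq> carrier R"
  shows "submodule (bnd n J) R (F n)"
proof (cases n)
  case 0
  then show ?thesis unfolding Fm.submodule_crit bnd_def by auto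
next
  case (Suc k)
  note A = annih_submodule[OF assms, of k, unfolded Fm.submodule_crit]
  have c: "w \<in> carrier (F k)" if "w \<in> annih k J" for w using A that by blast
  show ?thesis
    unfolding Fm.submodule_crit bnd_def Suc nat.case
  proof (intro conjI ballI)
    show "d k ` annih k J \<subseteq> carrier (F (Suc k))" using c by auto
    show "\<zero>\<^bsub>F (Suc k)\<^esub> \<in> d k ` annih k J" using A by (intro image_eqI[of _ _ "\<zero>\<^bsub>F k\<^esub>"]) auto
  next
    fix u v assume "u \<in> d k ` annih k J" "v \<in> d k ` annih k J"
    then obtain u' v' where "u' \<in> annih k J" "v' \<in> annih k J" "u = d k u'" "v = d k v'" by blast
    then show "u \<oplus>\<^bsub>F (Suc k)\<^esub> v \<in> d k ` annih k J"
      using A c by (intro image_eqI[of _ _ "u' \<oplus>\<^bsub>F k\<^esub> v'"]) auto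
  next
    fix r u assume r: "r \<in> carrier R" and "u \<in> d k ` annih k J"
    then obtain u' where "u' \<in> annih k J" "u = d k u'" by blast
    then show "r \<odot>\<^bsub>F (Suc k)\<^esub> u \<in> d k ` annih k J"
      using A c r by (intro image_eqI[of _ _ "r \<odot>\<^bsub>F k\<^esub> u'"]) auto
  qed
qed

lemma bnd_subset_cyc:
  assumes "J \<subseteq> carrier R"
  shows "bnd n J \<subseteq> cyc n J"
proof (cases n)
  case 0
  then show ?thesis
    using cyc_submodule[OF assms, of n] unfolding Fm.submodule_crit bnd_def by auto
next
  case (Suc k)
  have "d k w \<in> cyc (Suc k) J" if "w \<in> annih k J" for w
  proof -
    have w: "w \<in> carrier (F k)" "\<And>j. j \<in> J \<Longrightarrow> j \<odot>\<^bsub>F k\<^esub> w = \<zero>\<^bsub>F k\<^esub>" using that unfolding annih_def by auto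
    have "j \<odot>\<^bsub>F (Suc k)\<^esub> d k w = \<zero>\<^bsub>F (Suc k)\<^esub>" if "j \<in> J" for j
      using w(2)[OF that] w(1) that assms d_simps(3)[of j w k] by (simp add: subset_eq del: d_simps(3))
    then show ?thesis using w unfolding cyc_def annih_def by (simp add: d_d)
  qed
  then show ?thesis using Suc unfolding bnd_def by auto
qed

lemma bnd_0: "bnd 0 J = {\<zero>\<^bsub>F 0\<^esub>}" and bnd_Suc: "bnd (Suc k) J = d k ` annih k J"
  unfolding bnd_def by auto

lemma antimono:
  assumes "J \<subseteq> J'"
  shows "annih n J' \<subseteq> annih n J" "cyc n J' \<subseteq> cyc n J" "bnd n J' \<subseteq> bnd n J"
  using assms unfolding annih_def cyc_def bnd_def by (auto split: nat.split)

lemma annih_adjoin: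
  assumes J: "ideal J R" and a: "a \<in> carrier R"
  shows "annih n (ideal_adjoin R J a) = {w \<in> annih n J. a \<odot>\<^bsub>F n\<^esub> w = \<zero>\<^bsub>F n\<^esub>}"
proof (intro equalityI subsetI)
  fix w assume w: "w \<in> annih n (ideal_adjoin R J a)"
  show "w \<in> {w \<in> annih n J. a \<odot>\<^bsub>F n\<^esub> w = \<zero>\<^bsub>F n\<^esub>}"
    using w antimono(1)[OF ideal_adjoin_incl(1)[OF J a], of n] ideal_adjoin_incl(2)[OF J a]
    by (auto simp: annih_def)
next
  fix w assume w: "w \<in> {w \<in> annih n J. a \<odot>\<^bsub>F n\<^esub> w = \<zero>\<^bsub>F n\<^esub>}"
  have "(j \<oplus> r \<otimes> a) \<odot>\<^bsub>F n\<^esub> w = \<zero>\<^bsub>F n\<^esub>" if "j \<in> J" "r \<in> carrier R" for j r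
  proof -
    have "j \<in> carrier R" using that(1) J unfolding ideal_crit by blast
    then show ?thesis
      using w that a unfolding annih_def by (simp add: Fm.smult_l_distr Fm.smult_assoc1)
  qed
  then show "w \<in> annih n (ideal_adjoin R J a)" using w unfolding annih_def ideal_adjoin_def by auto
qed

text \<open>Restriction of homomorphisms along the injection of R/(J : a) into R/J given by
  multiplication by \<open>a\<close>.\<close>

lemma smult_annih_colon:
  assumes "a \<in> carrier R" "w \<in> annih n J"
  shows "a \<odot>\<^bsub>F n\<^esub> w \<in> annih n (ideal_colon R J a)"
  using assms unfolding annih_def ideal_colon_def by (auto simp: Fm.smult_assoc1[symmetric])

lemma smult_cyc_colon:
  assumes "a \<in> carrier R" "w \<in> cyc n J"
  shows "a \<odot>\<^bsub>F n\<^esub> w \<in> cyc n (ideal_colon R J a)"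
  using assms smult_annih_colon[OF assms(1), of w n J] annih_carrier[of w n J] unfolding cyc_def by simp

lemma annih_colon_lift:
  assumes "ideal J R" "a \<in> carrier R" "w \<in> annih n (ideal_colon R J a)"
  obtains w' where "w' \<in> annih n J" "a \<odot>\<^bsub>F n\<^esub> w' = w"
  using assms F_ext[of n] unfolding cyclic_ext_def annih_def by blast

lemma bnd_colon_lift:
  assumes J: "ideal J R" and a: "a \<in> carrier R" and b: "b \<in> bnd n (ideal_colon R J a)"
  obtains b' where "b' \<in> bnd n J" "a \<odot>\<^bsub>F n\<^esub> b' = b"
proof (cases n)
  case 0
  have "J \<subseteq> carrier R" using J unfolding ideal_crit by blast
  then have "\<zero>\<^bsub>F n\<^esub> \<in> bnd n J" using bnd_submodule[of J n] unfolding Fm.submodule_crit by blast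
  moreover have "b = \<zero>\<^bsub>F n\<^esub>" using b 0 by (simp add: bnd_0)
  ultimately show thesis using that[of "\<zero>\<^bsub>F n\<^esub>"] a by simp
next
  case (Suc k)
  then obtain w where w: "w \<in> annih k (ideal_colon R J a)" "b = d k w" using b by (auto simp: bnd_Suc)
  obtain w' where w': "w' \<in> annih k J" "a \<odot>\<^bsub>F k\<^esub> w' = w" by (rule annih_colon_lift[OF J a w(1)])
  have "a \<odot>\<^bsub>F n\<^esub> d k w' = b" using w w' a Suc annih_carrier[OF w'(1)] d_simps(3)[of a w' k] by simp
  then show thesis using that[of "d k w'"] w'(1) Suc by (auto simp: bnd_Suc)
qed

text \<open>\<open>acyc_middle\<close> and \<open>bnd_adjoin\<close> are the exactness of the long cohomology sequence of
  \<open>0 \<rightarrow> R/(J : a) \<rightarrow> R/J \<rightarrow> R/(J + (a)) \<rightarrow> 0\<close> at two places.\<close>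

lemma acyc_middle:
  assumes J: "ideal J R" and a: "a \<in> carrier R"
    and "acyc n (ideal_adjoin R J a)" "acyc n (ideal_colon R J a)"
  shows "acyc n J"
  unfolding acyc_def
proof
  have Jc: "J \<subseteq> carrier R" using J unfolding ideal_crit by blast
  fix z assume z: "z \<in> cyc n J"
  then have "a \<odot>\<^bsub>F n\<^esub> z \<in> bnd n (ideal_colon R J a)"
    using smult_cyc_colon[OF a z] assms(4) unfolding acyc_def by blast
  \<comment> \<open>The boundary \<open>a z\<close> is lifted to a boundary \<open>b\<close> for
    \<open>J\<close>; then \<open>a\<close> kills \<open>z - b\<close>, which is a cocycle for
    \<open>J + Ra\<close>.\<close>
  then obtain b where b: "b \<in> bnd n J" "a \<odot>\<^bsub>F n\<^esub> b = a \<odot>\<^bsub>F n\<^esub> z" by (rule bnd_colon_lift[OF J a])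
  have bz: "b \<in> cyc n J" using b(1) bnd_subset_cyc[OF Jc] by blast
  note c = cyc_carrier[OF z] cyc_carrier[OF bz]
  have "a \<odot>\<^bsub>F n\<^esub> (z \<ominus>\<^bsub>F n\<^esub> b) = \<zero>\<^bsub>F n\<^esub>"
    using b(2) c a by (simp add: Fm.minus_eq Fm.smult_r_distr Fm.smult_r_minus Fm.M.r_neg)
  moreover have "z \<ominus>\<^bsub>F n\<^esub> b \<in> cyc n J" using Fm.submoduleD(6)[OF cyc_submodule[OF Jc]] z bz by blast
  ultimately have "z \<ominus>\<^bsub>F n\<^esub> b \<in> cyc n (ideal_adjoin R J a)"
    unfolding cyc_def annih_adjoin[OF J a] by blast
  then have "z \<ominus>\<^bsub>F n\<^esub> b \<in> bnd n J"
    using assms(3) antimono(3)[OF ideal_adjoin_incl(1)[OF J a]] unfolding acyc_def by blast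
  then have "(z \<ominus>\<^bsub>F n\<^esub> b) \<oplus>\<^bsub>F n\<^esub> b \<in> bnd n J" using Fm.submoduleD(3)[OF bnd_submodule[OF Jc]] b(1) by blast
  then show "z \<in> bnd n J" using c by (simp add: Fm.M.minus_add_cancel)
qed

lemma bnd_adjoin:
  assumes J: "ideal J R" and a: "a \<in> carrier R"
    and ac: "\<And>k. n = Suc k \<Longrightarrow> acyc k (ideal_colon R J a)"
    and z: "z \<in> cyc n (ideal_adjoin R J a)" "z \<in> bnd n J"
  shows "z \<in> bnd n (ideal_adjoin R J a)"
proof (cases n)
  case 0
  then show ?thesis using z(2) by (simp add: bnd_0)
next
  case (Suc k)
  have Jc: "J \<subseteq> carrier R" using J unfolding ideal_crit by blast
  obtain w where w: "w \<in> annih k J" "z = d k w" using z(2) Suc by (auto simp: bnd_Suc)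
  note wc = annih_carrier[OF w(1)]
  have "d k (a \<odot>\<^bsub>F k\<^esub> w) = a \<odot>\<^bsub>F n\<^esub> z" using a wc w(2) Suc by simp
  also have "\<dots> = \<zero>\<^bsub>F n\<^esub>" using z(1) unfolding cyc_def annih_adjoin[OF J a] by blast
  finally have "a \<odot>\<^bsub>F k\<^esub> w \<in> cyc k (ideal_colon R J a)"
    using smult_annih_colon[OF a w(1)] Suc unfolding cyc_def by simp
  then have "a \<odot>\<^bsub>F k\<^esub> w \<in> bnd k (ideal_colon R J a)" using ac[OF Suc] unfolding acyc_def by blast
  then obtain b where b: "b \<in> bnd k J" "a \<odot>\<^bsub>F k\<^esub> b = a \<odot>\<^bsub>F k\<^esub> w" by (rule bnd_colon_lift[OF J a])
  have bz: "b \<in> cyc k J" using b(1) bnd_subset_cyc[OF Jc] by blast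
  note bc = cyc_carrier[OF bz]
  have "a \<odot>\<^bsub>F k\<^esub> (w \<ominus>\<^bsub>F k\<^esub> b) = \<zero>\<^bsub>F k\<^esub>"
    using b(2) bc wc a by (simp add: Fm.minus_eq Fm.smult_r_distr Fm.smult_r_minus Fm.M.r_neg)
  moreover have "w \<ominus>\<^bsub>F k\<^esub> b \<in> annih k J"
    using Fm.submoduleD(6)[OF annih_submodule[OF Jc]] w(1) cyc_annih[OF bz] by blast
  ultimately have "w \<ominus>\<^bsub>F k\<^esub> b \<in> annih k (ideal_adjoin R J a)" unfolding annih_adjoin[OF J a] by blast
  moreover have "d k (w \<ominus>\<^bsub>F k\<^esub> b) = z"
    using bz wc bc w(2) unfolding cyc_def by (simp add: Fm.M.minus_zero_right)
  ultimately show ?thesis using Suc by (force simp: bnd_Suc)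
qed

text \<open>Adjoining \<open>a\<close> needs the vanishing for \<open>(J0 : a)\<close>, an ideal
  that the induction over ideals does not reach, but only one degree lower. Hence the outer
  induction over the degree.\<close>

lemma acyc_all_ideals:
  assumes "\<And>k. k < n \<Longrightarrow> acyc k {\<zero>}" and "ideal J R" and "k < n"
  shows "acyc k J"
  using assms(2,3)
proof (induction k arbitrary: J rule: less_induct)
  case (less k)
  from less.prems(1) show ?case
  proof (induction rule: ideal_adjoin_induct)
    case zero
    show ?case using assms(1) less.prems(2) by blast
  next
    case (adjoin J0 a)
    have a: "a \<in> carrier R" using adjoin(3) less.prems(1) unfolding ideal_crit by blast
    note incl = ideal_adjoin_incl(1)[OF adjoin(1) a]
    have ac: "acyc l (ideal_colon R J0 a)" if "k = Suc l" for l
      by (rule less.IH) (use that less.prems(2) ideal_colon_ideal[OF adjoin(1) a] in auto)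
    show ?case
      unfolding acyc_def
    proof
      fix z assume z: "z \<in> cyc k (ideal_adjoin R J0 a)"
      then have "z \<in> bnd k J0" using antimono(2)[OF incl] adjoin(4) unfolding acyc_def by blast
      then show "z \<in> bnd k (ideal_adjoin R J0 a)" using bnd_adjoin[OF adjoin(1) a ac z] by blast
    qed
  qed
qed

text \<open>In a degree below which \<open>F\<close> is acyclic, the cohomology of Hom(R/J, F)
  embeds into that of \<open>F\<close>.\<close>

lemma bnd_zero_imp_bnd:
  assumes "\<And>k. k < n \<Longrightarrow> acyc k {\<zero>}" and "ideal J R"
    and "z \<in> cyc n J" "z \<in> bnd n {\<zero>}"
  shows "z \<in> bnd n J"
proof -
  have "cyc n J \<inter> bnd n {\<zero>} \<subseteq> bnd n J"
    using assms(2)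
  proof (induction rule: ideal_adjoin_induct)
    case zero
    show ?case by blast
  next
    case (adjoin J0 a)
    have a: "a \<in> carrier R" using adjoin(3) assms(2) unfolding ideal_crit by blast
    note incl = ideal_adjoin_incl(1)[OF adjoin(1) a]
    have ac: "acyc l (ideal_colon R J0 a)" if "n = Suc l" for l
      by (rule acyc_all_ideals[of n]) (use assms(1) that ideal_colon_ideal[OF adjoin(1) a] in auto)
    show ?case using bnd_adjoin[OF adjoin(1) a ac] antimono(2)[OF incl] adjoin(4) by blast
  qed
  then show ?thesis using assms(3,4) by blast
qed

text \<open>The counterpart of \<open>bnd_zero_imp_bnd\<close>: in such a degree a class of
  \<open>F\<close> killed by \<open>I\<close> comes from Hom(R/I, F). The representative is
  corrected by a coboundary each time a generator is adjoined.\<close>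

lemma cyc_lift_to_annihilator:
  assumes ac: "\<And>k. k < n \<Longrightarrow> acyc k {\<zero>}" and I: "ideal I R"
    and z: "z \<in> cyc n {\<zero>}" and Iz: "\<And>a. a \<in> I \<Longrightarrow> a \<odot>\<^bsub>F n\<^esub> z \<in> bnd n {\<zero>}"
  shows "\<exists>z'\<in>cyc n I. z \<ominus>\<^bsub>F n\<^esub> z' \<in> bnd n {\<zero>}"
  using I
proof (induction rule: ideal_adjoin_induct)
  case zero
  show ?case
    using z bnd_submodule[of "{\<zero>}" n] by (intro bexI[of _ z]) (auto simp: Fm.M.minus_self cyc_carrier Fm.submodule_crit)
next
  case (adjoin J0 a)
  have a: "a \<in> carrier R" using adjoin(3) I unfolding ideal_crit by blast
  have Jc: "J0 \<subseteq> carrier R" using adjoin(1) unfolding ideal_crit by blast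
  note B = Fm.submoduleD[OF bnd_submodule[of "{\<zero>}" n]]
  obtain z' where z': "z' \<in> cyc n J0" "z \<ominus>\<^bsub>F n\<^esub> z' \<in> bnd n {\<zero>}" using adjoin(4) by blast
  note zc = cyc_carrier[OF z] cyc_carrier[OF z'(1)]
  \<comment> \<open>Written as a difference of two boundaries, \<open>a z'\<close> is a boundary of
    \<open>F\<close>. By \<open>bnd_zero_imp_bnd\<close> it is one for \<open>(J0 : a)\<close> and
    so equals \<open>a b\<close> for a boundary \<open>b\<close>, the required correction.\<close>
  have "a \<odot>\<^bsub>F n\<^esub> z \<ominus>\<^bsub>F n\<^esub> a \<odot>\<^bsub>F n\<^esub> (z \<ominus>\<^bsub>F n\<^esub> z') \<in> bnd n {\<zero>}"
    using B(4)[OF _ a z'(2)] B(6)[OF _ Iz[OF adjoin(3)]] by simp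
  also have "a \<odot>\<^bsub>F n\<^esub> z \<ominus>\<^bsub>F n\<^esub> a \<odot>\<^bsub>F n\<^esub> (z \<ominus>\<^bsub>F n\<^esub> z') = a \<odot>\<^bsub>F n\<^esub> z'"
    using zc a by (simp add: Fm.minus_eq Fm.smult_r_distr Fm.smult_r_minus Fm.M.minus_add Fm.M.r_neg1 Fm.M.r_neg2)
  finally have "a \<odot>\<^bsub>F n\<^esub> z' \<in> bnd n (ideal_colon R J0 a)"
    using bnd_zero_imp_bnd[OF ac ideal_colon_ideal[OF adjoin(1) a] smult_cyc_colon[OF a z'(1)]] by blast
  then obtain b where b: "b \<in> bnd n J0" "a \<odot>\<^bsub>F n\<^esub> b = a \<odot>\<^bsub>F n\<^esub> z'" by (rule bnd_colon_lift[OF adjoin(1) a])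
  have bz: "b \<in> cyc n J0" using b(1) bnd_subset_cyc[OF Jc] by blast
  note bc = cyc_carrier[OF bz]
  have "\<zero> \<in> J0" using adjoin(1) unfolding ideal_crit by blast
  then have b0: "b \<in> bnd n {\<zero>}" using b(1) antimono(3)[of "{\<zero>}" J0 n] by blast
  have "a \<odot>\<^bsub>F n\<^esub> (z' \<ominus>\<^bsub>F n\<^esub> b) = \<zero>\<^bsub>F n\<^esub>"
    using b(2) bc zc a by (simp add: Fm.minus_eq Fm.smult_r_distr Fm.smult_r_minus Fm.M.r_neg)
  moreover have "z' \<ominus>\<^bsub>F n\<^esub> b \<in> cyc n J0" using Fm.submoduleD(6)[OF cyc_submodule[OF Jc]] z'(1) bz by blast
  ultimately have "z' \<ominus>\<^bsub>F n\<^esub> b \<in> cyc n (ideal_adjoin R J0 a)"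
    unfolding cyc_def annih_adjoin[OF adjoin(1) a] by blast
  moreover have "z \<ominus>\<^bsub>F n\<^esub> (z' \<ominus>\<^bsub>F n\<^esub> b) = (z \<ominus>\<^bsub>F n\<^esub> z') \<oplus>\<^bsub>F n\<^esub> b"
    using zc bc by (simp add: Fm.minus_eq Fm.M.minus_add Fm.M.a_assoc)
  ultimately show ?case using B(3)[OF _ z'(2) b0] by (intro bexI[of _ "z' \<ominus>\<^bsub>F n\<^esub> b"]) auto
qed

end


section \<open>Chains of primes\<close>

lemma (in module) smult_minus_distr:
  assumes "r \<in> carrier R" "x \<in> carrier M" "y \<in> carrier M"
  shows "r \<odot>\<^bsub>M\<^esub> (x \<ominus>\<^bsub>M\<^esub> y) = r \<odot>\<^bsub>M\<^esub> x \<ominus>\<^bsub>M\<^esub> r \<odot>\<^bsub>M\<^esub> y"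
  using assms by (simp add: minus_eq smult_r_distr smult_r_minus)

context cyclic_ext_complex
begin

text \<open>The \<open>n\<close>-th cohomology of \<open>Hom(R/J, F)\<close> is noetherian up to a power of \<open>y\<close>. Unlike
  finite generation this holds for modules annihilated by a power of \<open>y\<close>, and it still gives
  Nakayama's lemma for multiplication by \<open>y\<close>.\<close>

definition almost_noeth :: "'a \<Rightarrow> nat \<Rightarrow> 'a set \<Rightarrow> bool" where
  "almost_noeth y n J \<longleftrightarrow> (\<forall>U::nat \<Rightarrow> 'e set.
     (\<forall>j. submodule (U j) R (F n) \<and> bnd n J \<subseteq> U j \<and> U j \<subseteq> cyc n J \<and> U j \<subseteq> U (Suc j)) \<longrightarrow>
     (\<exists>(k::nat) m. \<forall>j. \<forall>u\<in>U j. (y [^] k) \<odot>\<^bsub>F n\<^esub> u \<in> U m))"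

text \<open>The cohomology for \<open>J + Ra\<close> lies between that for \<open>(J : a)\<close>
  one degree lower and that for \<open>J\<close>. A chain in it is controlled by its image in the
  latter and its preimage in the former, and the two exponents of \<open>y\<close> add.\<close>

lemma almost_noeth_adjoin:
  assumes y: "y \<in> carrier R" and J: "ideal J R" and a: "a \<in> carrier R"
    and J0: "almost_noeth y n J" and colon: "\<And>k. n = Suc k \<Longrightarrow> almost_noeth y k (ideal_colon R J a)"
  shows "almost_noeth y n (ideal_adjoin R J a)"
  unfolding almost_noeth_def
proof (intro allI impI)
  fix U :: "nat \<Rightarrow> 'e set"
  let ?J = "ideal_adjoin R J a"
  assume U: "\<forall>j. submodule (U j) R (F n) \<and> bnd n ?J \<subseteq> U j \<and> U j \<subseteq> cyc n ?J \<and> U j \<subseteq> U (Suc j)"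
  have Jc: "J \<subseteq> carrier R" using J unfolding ideal_crit by blast
  have Us: "submodule (U j) R (F n)" for j using U by blast
  note Ud = Fm.submoduleD[OF Us]
  note Bd = Fm.submoduleD[OF bnd_submodule[OF Jc]]
  have mono: "U j \<subseteq> U k" if "j \<le> k" for j k using chain_mono[of U] U that by blast
  note incl = ideal_adjoin_incl(1)[OF J a]
  have UJ: "U j \<subseteq> cyc n J" for j using U antimono(2)[OF incl, of n] by blast
  \<comment> \<open>The image of the chain in the cohomology for \<open>J\<close>.\<close>
  define V where "V j = {u \<oplus>\<^bsub>F n\<^esub> b | u b. u \<in> U j \<and> b \<in> bnd n J}" for j
  have VI: "z \<in> V j" if "z = u \<oplus>\<^bsub>F n\<^esub> b" "u \<in> U j" "b \<in> bnd n J" for z u b j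
    using that unfolding V_def by blast
  have "submodule (V j) R (F n) \<and> bnd n J \<subseteq> V j \<and> V j \<subseteq> cyc n J \<and> V j \<subseteq> V (Suc j)" for j
  proof (intro conjI)
    show "submodule (V j) R (F n)"
      unfolding Fm.submodule_crit
    proof (intro conjI ballI)
      show "V j \<subseteq> carrier (F n)" using Ud(1) Bd(1) unfolding V_def by auto
      show "\<zero>\<^bsub>F n\<^esub> \<in> V j" by (rule VI[of _ "\<zero>\<^bsub>F n\<^esub>" "\<zero>\<^bsub>F n\<^esub>"]) (use Ud(2) Bd(2) in auto)
    next
      fix v v' assume "v \<in> V j" "v' \<in> V j"
      then obtain u b u' b' where *: "u \<in> U j" "b \<in> bnd n J" "v = u \<oplus>\<^bsub>F n\<^esub> b"
        "u' \<in> U j" "b' \<in> bnd n J" "v' = u' \<oplus>\<^bsub>F n\<^esub> b'" unfolding V_def by blast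
      show "v \<oplus>\<^bsub>F n\<^esub> v' \<in> V j"
        by (rule VI[of _ "u \<oplus>\<^bsub>F n\<^esub> u'" "b \<oplus>\<^bsub>F n\<^esub> b'"])
          (use * Ud(1,3) Bd(1,3) in \<open>simp_all add: Fm.M.a_ac\<close>)
    next
      fix r v assume r: "r \<in> carrier R" and "v \<in> V j"
      then obtain u b where *: "u \<in> U j" "b \<in> bnd n J" "v = u \<oplus>\<^bsub>F n\<^esub> b" unfolding V_def by blast
      show "r \<odot>\<^bsub>F n\<^esub> v \<in> V j"
        by (rule VI[of _ "r \<odot>\<^bsub>F n\<^esub> u" "r \<odot>\<^bsub>F n\<^esub> b"])
          (use r * Ud(1,4) Bd(1,4) in \<open>simp_all add: Fm.smult_r_distr\<close>)
    qed
    show "bnd n J \<subseteq> V j"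
    proof
      fix b assume b: "b \<in> bnd n J"
      show "b \<in> V j" by (rule VI[of _ "\<zero>\<^bsub>F n\<^esub>" b]) (use b Ud(2) Bd(1) in auto)
    qed
    show "V j \<subseteq> cyc n J"
      using UJ bnd_subset_cyc[OF Jc] Fm.submoduleD(3)[OF cyc_submodule[OF Jc]] unfolding V_def by blast
    show "V j \<subseteq> V (Suc j)" using mono[of j "Suc j"] unfolding V_def by auto
  qed
  then obtain k1 m1 where km1: "\<And>j v. v \<in> V j \<Longrightarrow> (y [^] (k1::nat)) \<odot>\<^bsub>F n\<^esub> v \<in> V m1"
    using J0 unfolding almost_noeth_def by meson
  have "\<exists>(k::nat) m. \<forall>j. \<forall>u\<in>U j. u \<in> bnd n J \<longrightarrow> (y [^] k) \<odot>\<^bsub>F n\<^esub> u \<in> U m"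
  proof (cases n)
    case 0
    then have "(y [^] (0::nat)) \<odot>\<^bsub>F n\<^esub> u \<in> U 0" if "u \<in> bnd n J" for u
      using that Ud(2) by (simp add: bnd_0)
    then show ?thesis by blast
  next
    case (Suc p)
    let ?K = "ideal_colon R J a"
    have Kc: "?K \<subseteq> carrier R" unfolding ideal_colon_def by blast
    note Ad = Fm.submoduleD[OF annih_submodule[OF Jc]]
    \<comment> \<open>The preimage of \<open>U j\<close> under the connecting map, which sends the
      class of \<open>a w\<close> to the class of \<open>d p w\<close>.\<close>
    define Y where "Y j = {a \<odot>\<^bsub>F p\<^esub> w | w. w \<in> annih p J \<and> d p w \<in> U j}" for j
    have YI: "z \<in> Y j" if "z = a \<odot>\<^bsub>F p\<^esub> w" "w \<in> annih p J" "d p w \<in> U j" for z w j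
      using that unfolding Y_def by blast
    have "submodule (Y j) R (F p) \<and> bnd p ?K \<subseteq> Y j \<and> Y j \<subseteq> cyc p ?K \<and> Y j \<subseteq> Y (Suc j)" for j
    proof (intro conjI)
      show "submodule (Y j) R (F p)"
        unfolding Fm.submodule_crit
      proof (intro conjI ballI)
        show "Y j \<subseteq> carrier (F p)" using Ad(1) a unfolding Y_def by auto
        show "\<zero>\<^bsub>F p\<^esub> \<in> Y j" by (rule YI[of _ "\<zero>\<^bsub>F p\<^esub>"]) (use a Ud(2) Ad(2) Suc in auto)
      next
        fix v v' assume "v \<in> Y j" "v' \<in> Y j"
        then obtain w w' where *: "w \<in> annih p J" "d p w \<in> U j" "v = a \<odot>\<^bsub>F p\<^esub> w"
          "w' \<in> annih p J" "d p w' \<in> U j" "v' = a \<odot>\<^bsub>F p\<^esub> w'" unfolding Y_def by blast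
        show "v \<oplus>\<^bsub>F p\<^esub> v' \<in> Y j"
          by (rule YI[of _ "w \<oplus>\<^bsub>F p\<^esub> w'"])
            (use * a Ud(3)[of "d p w" j "d p w'"] Ad(1,3) Suc in \<open>simp_all add: Fm.smult_r_distr\<close>)
      next
        fix r v assume r: "r \<in> carrier R" and "v \<in> Y j"
        then obtain w where *: "w \<in> annih p J" "d p w \<in> U j" "v = a \<odot>\<^bsub>F p\<^esub> w" unfolding Y_def by blast
        show "r \<odot>\<^bsub>F p\<^esub> v \<in> Y j"
          by (rule YI[of _ "r \<odot>\<^bsub>F p\<^esub> w"])
            (use * a r Ud(4)[of r "d p w" j] Ad(1,4) Suc in \<open>simp_all add: Fm.smult_assoc1[symmetric] m_comm\<close>)
      qed
      show "bnd p ?K \<subseteq> Y j"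
      proof
        fix b assume "b \<in> bnd p ?K"
        then obtain b' where b': "b' \<in> bnd p J" "a \<odot>\<^bsub>F p\<^esub> b' = b" by (rule bnd_colon_lift[OF J a])
        have "b' \<in> cyc p J" using b'(1) bnd_subset_cyc[OF Jc] by blast
        then show "b \<in> Y j"
          using b'(2) Ud(2)[of j] Suc by (intro YI[of _ b']) (auto simp: cyc_def)
      qed
      show "Y j \<subseteq> cyc p ?K"
      proof
        fix v assume "v \<in> Y j"
        then obtain w where *: "w \<in> annih p J" "d p w \<in> U j" "v = a \<odot>\<^bsub>F p\<^esub> w" unfolding Y_def by blast
        have "d p w \<in> annih n ?J" using *(2) U cyc_annih by blast
        then have "a \<odot>\<^bsub>F n\<^esub> d p w = \<zero>\<^bsub>F n\<^esub>" unfolding annih_adjoin[OF J a] by blast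
        then show "v \<in> cyc p ?K"
          using smult_annih_colon[OF a *(1)] *(3) annih_carrier[OF *(1)] a Suc unfolding cyc_def by simp
      qed
      show "Y j \<subseteq> Y (Suc j)" using mono[of j "Suc j"] unfolding Y_def by auto
    qed
    then obtain k2 m2 where km2: "\<And>j v. v \<in> Y j \<Longrightarrow> (y [^] (k2::nat)) \<odot>\<^bsub>F p\<^esub> v \<in> Y m2"
      using colon[OF Suc] unfolding almost_noeth_def by meson
    have "(y [^] k2) \<odot>\<^bsub>F n\<^esub> u \<in> U m2" if u: "u \<in> U j" "u \<in> bnd n J" for u j
    proof -
      obtain w where w: "w \<in> annih p J" "u = d p w" using u(2) Suc by (auto simp: bnd_Suc)
      have "a \<odot>\<^bsub>F p\<^esub> w \<in> Y j" using w u(1) by (intro YI) auto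
      then obtain w' where w': "w' \<in> annih p J" "d p w' \<in> U m2"
        "(y [^] k2) \<odot>\<^bsub>F p\<^esub> (a \<odot>\<^bsub>F p\<^esub> w) = a \<odot>\<^bsub>F p\<^esub> w'" using km2 unfolding Y_def by blast
      note wc = annih_carrier[OF w(1)] annih_carrier[OF w'(1)]
      \<comment> \<open>Since \<open>a\<close> kills \<open>e\<close>, its differential is a
        boundary for \<open>J + Ra\<close> and belongs to every member of the chain. So
        \<open>y^k2 u\<close> and \<open>d p w'\<close> differ by an element of
        \<open>U m2\<close>.\<close>
      define e where "e = (y [^] k2) \<odot>\<^bsub>F p\<^esub> w \<ominus>\<^bsub>F p\<^esub> w'"
      have yk: "y [^] k2 \<in> carrier R" using y by simp
      have "e \<in> annih p J" unfolding e_def using Ad(6)[OF Ad(4)[OF yk w(1)] w'(1)] .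
      moreover have "a \<odot>\<^bsub>F p\<^esub> e = \<zero>\<^bsub>F p\<^esub>"
      proof -
        have "a \<odot>\<^bsub>F p\<^esub> ((y [^] k2) \<odot>\<^bsub>F p\<^esub> w) = (y [^] k2) \<odot>\<^bsub>F p\<^esub> (a \<odot>\<^bsub>F p\<^esub> w)"
          using wc a yk by (simp add: Fm.smult_assoc1[symmetric] m_comm)
        then show ?thesis
          unfolding e_def using wc a yk w'(3) by (simp add: Fm.smult_minus_distr Fm.M.minus_self)
      qed
      ultimately have "e \<in> annih p ?J" unfolding annih_adjoin[OF J a] by blast
      then have "d p e \<in> bnd n ?J" using Suc by (simp add: bnd_Suc)
      then have "d p e \<in> U m2" using U by blast
      then have "d p e \<oplus>\<^bsub>F n\<^esub> d p w' \<in> U m2" using Ud(3)[OF _ w'(2)] by simp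
      moreover have "d p e \<oplus>\<^bsub>F n\<^esub> d p w' = (y [^] k2) \<odot>\<^bsub>F n\<^esub> u"
        unfolding e_def w(2) using wc yk Suc by (simp add: Fm.M.minus_add_cancel)
      ultimately show ?thesis by simp
    qed
    then show ?thesis by blast
  qed
  then obtain k2 m2 where km2: "\<And>j u. u \<in> U j \<Longrightarrow> u \<in> bnd n J \<Longrightarrow> (y [^] (k2::nat)) \<odot>\<^bsub>F n\<^esub> u \<in> U m2"
    by blast
  have "(y [^] (k2 + k1)) \<odot>\<^bsub>F n\<^esub> u \<in> U (max m1 m2)" if u: "u \<in> U j" for u j
  proof -
    have y1: "y [^] k1 \<in> carrier R" and y2: "y [^] k2 \<in> carrier R" using y by simp_all
    have "u \<in> V j" by (rule VI[of _ u "\<zero>\<^bsub>F n\<^esub>"]) (use u Ud(1) Bd(2) in auto)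
    \<comment> \<open>The remainder \<open>b\<close> is a difference of elements of the chain and a
      boundary for \<open>J\<close>, so the second exponent \<open>k2\<close> applies to it.\<close>
    then obtain u' b where *: "u' \<in> U m1" "b \<in> bnd n J" "(y [^] k1) \<odot>\<^bsub>F n\<^esub> u = u' \<oplus>\<^bsub>F n\<^esub> b"
      using km1 unfolding V_def by blast
    note c = Ud(1)[OF u] Ud(1)[OF *(1)] Bd(1)[OF *(2)]
    have "(u' \<oplus>\<^bsub>F n\<^esub> b) \<ominus>\<^bsub>F n\<^esub> u' = b"
      using c by (simp add: Fm.minus_eq Fm.M.a_comm[of u' n b] Fm.M.a_assoc Fm.M.r_neg)
    moreover have "(y [^] k1) \<odot>\<^bsub>F n\<^esub> u \<in> U (max j m1)"
      using Ud(4)[OF y1 u] mono[of j "max j m1"] by auto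
    moreover have "u' \<in> U (max j m1)" using *(1) mono[of m1 "max j m1"] by auto
    ultimately have "b \<in> U (max j m1)" using *(3) Ud(6) by metis
    then have "(y [^] k2) \<odot>\<^bsub>F n\<^esub> b \<in> U (max m1 m2)" using km2 *(2) mono[of m2 "max m1 m2"] by auto
    moreover have "(y [^] k2) \<odot>\<^bsub>F n\<^esub> u' \<in> U (max m1 m2)"
      using Ud(4)[OF y2 *(1)] mono[of m1 "max m1 m2"] by auto
    moreover have "(y [^] (k2 + k1)) \<odot>\<^bsub>F n\<^esub> u = (y [^] k2) \<odot>\<^bsub>F n\<^esub> u' \<oplus>\<^bsub>F n\<^esub> (y [^] k2) \<odot>\<^bsub>F n\<^esub> b"
      using c y y1 y2 *(3) by (simp add: nat_pow_mult[symmetric] Fm.smult_assoc1 Fm.smult_r_distr)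
    ultimately show ?thesis using Ud(3) by simp
  qed
  then show "\<exists>(k::nat) m. \<forall>j. \<forall>u\<in>U j. (y [^] k) \<odot>\<^bsub>F n\<^esub> u \<in> U m" by blast
qed

lemma almost_noeth_all:
  assumes y: "y \<in> carrier R" and base: "\<And>k. k < n \<Longrightarrow> almost_noeth y k {\<zero>}"
    and "ideal J R" and "k < n"
  shows "almost_noeth y k J"
  using assms(3,4)
proof (induction k arbitrary: J rule: less_induct)
  case (less k)
  from less.prems(1) show ?case
  proof (induction rule: ideal_adjoin_induct)
    case zero
    show ?case using base less.prems(2) by blast
  next
    case (adjoin J0 a)
    have a: "a \<in> carrier R" using adjoin(3) less.prems(1) unfolding ideal_crit by blast
    show ?case
    proof (rule almost_noeth_adjoin[OF y adjoin(1) a adjoin(4)])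
      fix l assume "k = Suc l"
      then show "almost_noeth y l (ideal_colon R J0 a)"
        using less.IH[of l "ideal_colon R J0 a"] less.prems(2) ideal_colon_ideal[OF adjoin(1) a] by simp
    qed
  qed
qed

text \<open>Divide a class by \<open>y\<close> again and again. The submodules generated by the
  successive quotients ascend, and the chain condition up to a power of \<open>y\<close> makes one
  quotient a multiple of \<open>y\<close> times itself.\<close>

lemma almost_noeth_nakayama:
  assumes yn: "almost_noeth y n J" and y: "y \<in> \<mm>" and Jc: "J \<subseteq> carrier R"
    and div: "\<And>z. z \<in> cyc n J \<Longrightarrow> \<exists>z'\<in>cyc n J. z \<ominus>\<^bsub>F n\<^esub> y \<odot>\<^bsub>F n\<^esub> z' \<in> bnd n J"
  shows "acyc n J"
  unfolding acyc_def
proof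
  fix z assume z: "z \<in> cyc n J"
  have yR: "y \<in> carrier R" using mm_carrier[OF y] .
  note Bd = Fm.submoduleD[OF bnd_submodule[OF Jc]]
  note Zd = Fm.submoduleD[OF cyc_submodule[OF Jc]]
  have BZ: "b \<in> cyc n J" if "b \<in> bnd n J" for b using that bnd_subset_cyc[OF Jc] by blast
  have "\<exists>u. u 0 = z \<and> (\<forall>i. u i \<in> cyc n J \<and> u i \<ominus>\<^bsub>F n\<^esub> y \<odot>\<^bsub>F n\<^esub> u (Suc i) \<in> bnd n J)"
  proof -
    define g where "g v = (SOME z'. z' \<in> cyc n J \<and> v \<ominus>\<^bsub>F n\<^esub> y \<odot>\<^bsub>F n\<^esub> z' \<in> bnd n J)" for v
    have g: "g v \<in> cyc n J \<and> v \<ominus>\<^bsub>F n\<^esub> y \<odot>\<^bsub>F n\<^esub> g v \<in> bnd n J" if "v \<in> cyc n J" for v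
      unfolding g_def by (rule someI_ex) (use div[OF that] in blast)
    have it: "(g ^^ i) z \<in> cyc n J" for i by (induction i) (use z g in auto)
    show ?thesis by (rule exI[of _ "\<lambda>i. (g ^^ i) z"]) (use it g in simp)
  qed
  then obtain u where u0: "u 0 = z" and u: "\<And>i. u i \<in> cyc n J"
    and uS: "\<And>i. u i \<ominus>\<^bsub>F n\<^esub> y \<odot>\<^bsub>F n\<^esub> u (Suc i) \<in> bnd n J" by blast
  note uc = Zd(1)[OF u]
  have divs: "\<exists>b\<in>bnd n J. u i = b \<oplus>\<^bsub>F n\<^esub> (y [^] k) \<odot>\<^bsub>F n\<^esub> u (k + i)" for i and k :: nat
  proof (induction k arbitrary: i)
    case 0
    show ?case using Bd(2) uc by (intro bexI[of _ "\<zero>\<^bsub>F n\<^esub>"]) auto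
  next
    case (Suc k)
    obtain b where b: "b \<in> bnd n J" "u (Suc i) = b \<oplus>\<^bsub>F n\<^esub> (y [^] k) \<odot>\<^bsub>F n\<^esub> u (k + Suc i)"
      using Suc[of "Suc i"] by blast
    let ?b = "u i \<ominus>\<^bsub>F n\<^esub> y \<odot>\<^bsub>F n\<^esub> u (Suc i)"
    note bc = Bd(1)[OF b(1)] and b'c = Bd(1)[OF uS[of i]]
    have "u i = ?b \<oplus>\<^bsub>F n\<^esub> y \<odot>\<^bsub>F n\<^esub> u (Suc i)" using uc yR by (simp add: Fm.M.minus_add_cancel)
    also have "\<dots> = ?b \<oplus>\<^bsub>F n\<^esub> y \<odot>\<^bsub>F n\<^esub> (b \<oplus>\<^bsub>F n\<^esub> (y [^] k) \<odot>\<^bsub>F n\<^esub> u (k + Suc i))"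
      using b(2) by simp
    also have "y \<odot>\<^bsub>F n\<^esub> (b \<oplus>\<^bsub>F n\<^esub> (y [^] k) \<odot>\<^bsub>F n\<^esub> u (k + Suc i))
        = y \<odot>\<^bsub>F n\<^esub> b \<oplus>\<^bsub>F n\<^esub> (y [^] Suc k) \<odot>\<^bsub>F n\<^esub> u (Suc k + i)"
      using bc uc yR by (simp add: Fm.smult_r_distr Fm.smult_assoc1[symmetric] m_comm)
    also have "?b \<oplus>\<^bsub>F n\<^esub> (y \<odot>\<^bsub>F n\<^esub> b \<oplus>\<^bsub>F n\<^esub> (y [^] Suc k) \<odot>\<^bsub>F n\<^esub> u (Suc k + i))
        = (?b \<oplus>\<^bsub>F n\<^esub> y \<odot>\<^bsub>F n\<^esub> b) \<oplus>\<^bsub>F n\<^esub> (y [^] Suc k) \<odot>\<^bsub>F n\<^esub> u (Suc k + i)"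
      using bc b'c uc yR by (simp add: Fm.M.a_assoc)
    finally show ?case using Bd(3)[OF uS[of i] Bd(4)[OF yR b(1)]] by blast
  qed
  \<comment> \<open>These ascend because \<open>u j\<close> is \<open>y\<close> times
    \<open>u (Suc j)\<close> up to a boundary.\<close>
  define U where "U j = {b \<oplus>\<^bsub>F n\<^esub> r \<odot>\<^bsub>F n\<^esub> u j | b r. b \<in> bnd n J \<and> r \<in> carrier R}" for j
  have UI: "v \<in> U j" if "v = b \<oplus>\<^bsub>F n\<^esub> r \<odot>\<^bsub>F n\<^esub> u j" "b \<in> bnd n J" "r \<in> carrier R" for v b r j
    using that unfolding U_def by blast
  have "submodule (U j) R (F n) \<and> bnd n J \<subseteq> U j \<and> U j \<subseteq> cyc n J \<and> U j \<subseteq> U (Suc j)" for j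
  proof (intro conjI)
    show UZ: "U j \<subseteq> cyc n J" using BZ Zd(3,4) u unfolding U_def by blast
    show "submodule (U j) R (F n)"
      unfolding Fm.submodule_crit
    proof (intro conjI ballI)
      show "U j \<subseteq> carrier (F n)" using UZ Zd(1) by blast
      show "\<zero>\<^bsub>F n\<^esub> \<in> U j" by (rule UI[of _ "\<zero>\<^bsub>F n\<^esub>" \<zero>]) (use Bd(2) uc in auto)
    next
      fix v v' assume "v \<in> U j" "v' \<in> U j"
      then obtain b r b' r' where *: "b \<in> bnd n J" "r \<in> carrier R" "v = b \<oplus>\<^bsub>F n\<^esub> r \<odot>\<^bsub>F n\<^esub> u j"
        "b' \<in> bnd n J" "r' \<in> carrier R" "v' = b' \<oplus>\<^bsub>F n\<^esub> r' \<odot>\<^bsub>F n\<^esub> u j" unfolding U_def by blast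
      show "v \<oplus>\<^bsub>F n\<^esub> v' \<in> U j"
        by (rule UI[of _ "b \<oplus>\<^bsub>F n\<^esub> b'" "r \<oplus> r'"])
          (use * Bd(1,3) uc in \<open>simp_all add: Fm.smult_l_distr Fm.M.a_ac\<close>)
    next
      fix s v assume s: "s \<in> carrier R" and "v \<in> U j"
      then obtain b r where *: "b \<in> bnd n J" "r \<in> carrier R" "v = b \<oplus>\<^bsub>F n\<^esub> r \<odot>\<^bsub>F n\<^esub> u j"
        unfolding U_def by blast
      show "s \<odot>\<^bsub>F n\<^esub> v \<in> U j"
        by (rule UI[of _ "s \<odot>\<^bsub>F n\<^esub> b" "s \<otimes> r"])
          (use s * Bd(1,4) uc in \<open>simp_all add: Fm.smult_r_distr Fm.smult_assoc1\<close>)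
    qed
    show "bnd n J \<subseteq> U j"
    proof
      fix b assume b: "b \<in> bnd n J"
      show "b \<in> U j" by (rule UI[of _ b \<zero>]) (use b Bd(1) uc in auto)
    qed
    show "U j \<subseteq> U (Suc j)"
    proof
      fix v assume "v \<in> U j"
      then obtain b r where *: "b \<in> bnd n J" "r \<in> carrier R" "v = b \<oplus>\<^bsub>F n\<^esub> r \<odot>\<^bsub>F n\<^esub> u j"
        unfolding U_def by blast
      obtain b' where b': "b' \<in> bnd n J" "u j = b' \<oplus>\<^bsub>F n\<^esub> y \<odot>\<^bsub>F n\<^esub> u (Suc j)"
        using divs[of j 1] yR by auto
      have "v = (b \<oplus>\<^bsub>F n\<^esub> r \<odot>\<^bsub>F n\<^esub> b') \<oplus>\<^bsub>F n\<^esub> (r \<otimes> y) \<odot>\<^bsub>F n\<^esub> u (Suc j)"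
        unfolding *(3) b'(2) using * b'(1) Bd(1) uc yR
        by (simp add: Fm.smult_r_distr Fm.smult_assoc1 Fm.M.a_assoc)
      then show "v \<in> U (Suc j)" by (rule UI) (use * b' yR Bd(3,4) in auto)
    qed
  qed
  then obtain k m where km: "\<And>j v. v \<in> U j \<Longrightarrow> (y [^] (k::nat)) \<odot>\<^bsub>F n\<^esub> v \<in> U m"
    using yn unfolding almost_noeth_def by meson
  have yk: "y [^] k \<in> carrier R" using yR by simp
  have uU: "u j \<in> U j" for j by (rule UI[of _ "\<zero>\<^bsub>F n\<^esub>" \<one>]) (use Bd(2) uc in auto)
  \<comment> \<open>Modulo boundaries,
    \<open>u (Suc m) = y^k u (k + Suc m) = r u m = r y u (Suc m)\<close>: first by division, then by
    the chain condition, then by division again. As \<open>1 - r y\<close> is a unit,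
    \<open>u (Suc m)\<close> is a boundary.\<close>
  obtain b1 where b1: "b1 \<in> bnd n J" "u (Suc m) = b1 \<oplus>\<^bsub>F n\<^esub> (y [^] k) \<odot>\<^bsub>F n\<^esub> u (k + Suc m)"
    using divs[of "Suc m" k] by blast
  obtain b2 r where b2: "b2 \<in> bnd n J" "r \<in> carrier R"
    "(y [^] k) \<odot>\<^bsub>F n\<^esub> u (k + Suc m) = b2 \<oplus>\<^bsub>F n\<^esub> r \<odot>\<^bsub>F n\<^esub> u m"
    using km[OF uU] unfolding U_def by blast
  obtain b3 where b3: "b3 \<in> bnd n J" "u m = b3 \<oplus>\<^bsub>F n\<^esub> y \<odot>\<^bsub>F n\<^esub> u (Suc m)"
    using divs[of m 1] yR by auto
  note bc = Bd(1)[OF b1(1)] Bd(1)[OF b2(1)] Bd(1)[OF b3(1)]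
  let ?b = "b1 \<oplus>\<^bsub>F n\<^esub> b2 \<oplus>\<^bsub>F n\<^esub> r \<odot>\<^bsub>F n\<^esub> b3"
  have bB: "?b \<in> bnd n J" using Bd(3)[OF Bd(3)[OF b1(1) b2(1)] Bd(4)[OF b2(2) b3(1)]] .
  have "u (Suc m) = ?b \<oplus>\<^bsub>F n\<^esub> (r \<otimes> y) \<odot>\<^bsub>F n\<^esub> u (Suc m)"
  proof -
    have "u (Suc m) = b1 \<oplus>\<^bsub>F n\<^esub> (b2 \<oplus>\<^bsub>F n\<^esub> r \<odot>\<^bsub>F n\<^esub> (b3 \<oplus>\<^bsub>F n\<^esub> y \<odot>\<^bsub>F n\<^esub> u (Suc m)))"
      using b1(2) b2(3) b3(2) by simp
    then show ?thesis
      using bc b2(2) yR uc[of "Suc m"] by (simp add: Fm.smult_r_distr Fm.smult_assoc1 Fm.M.a_assoc)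
  qed
  moreover have "(\<one> \<ominus> r \<otimes> y) \<odot>\<^bsub>F n\<^esub> u (Suc m) = u (Suc m) \<ominus>\<^bsub>F n\<^esub> (r \<otimes> y) \<odot>\<^bsub>F n\<^esub> u (Suc m)"
    using b2(2) yR uc[of "Suc m"] by (simp add: minus_eq Fm.minus_eq Fm.smult_l_distr Fm.smult_l_minus)
  moreover have "(?b \<oplus>\<^bsub>F n\<^esub> (r \<otimes> y) \<odot>\<^bsub>F n\<^esub> u (Suc m)) \<ominus>\<^bsub>F n\<^esub> (r \<otimes> y) \<odot>\<^bsub>F n\<^esub> u (Suc m) = ?b"
    using bc b2(2) yR uc[of "Suc m"] by (simp add: Fm.minus_eq Fm.M.a_assoc Fm.M.r_neg)
  ultimately have e: "(\<one> \<ominus> r \<otimes> y) \<odot>\<^bsub>F n\<^esub> u (Suc m) = ?b" by simp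
  obtain s where s: "s \<in> carrier R" "s \<otimes> (\<one> \<ominus> r \<otimes> y) = \<one>" using unit_one_minus[OF b2(2) y] by blast
  have "u (Suc m) = s \<odot>\<^bsub>F n\<^esub> ?b"
  proof -
    have "s \<odot>\<^bsub>F n\<^esub> ((\<one> \<ominus> r \<otimes> y) \<odot>\<^bsub>F n\<^esub> u (Suc m)) = u (Suc m)"
      using s b2(2) yR uc[of "Suc m"] by (simp add: Fm.smult_assoc1[symmetric])
    then show ?thesis using e by simp
  qed
  then have "u (Suc m) \<in> bnd n J" using Bd(4)[OF s(1) bB] by simp
  moreover obtain b4 where "b4 \<in> bnd n J" "z = b4 \<oplus>\<^bsub>F n\<^esub> (y [^] Suc m) \<odot>\<^bsub>F n\<^esub> u (Suc m)"
    using divs[of 0 "Suc m"] u0 by auto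
  ultimately show "z \<in> bnd n J" using Bd(3,4) yR by (metis nat_pow_closed)
qed

lemma acyc_carrier: "acyc n (carrier R)"
proof -
  have "w = \<zero>\<^bsub>F n\<^esub>" if "w \<in> cyc n (carrier R)" for w
  proof -
    have "\<one> \<odot>\<^bsub>F n\<^esub> w = \<zero>\<^bsub>F n\<^esub>" using that one_closed unfolding cyc_def annih_def by blast
    then show ?thesis using cyc_carrier[OF that] by simp
  qed
  then show ?thesis
    using Fm.submoduleD(2)[OF bnd_submodule[OF subset_refl]] unfolding acyc_def by blast
qed

text \<open>An ideal \<open>q\<close> maximal with non-vanishing cohomology is prime: if
  \<open>a b\<close> is in \<open>q\<close> but neither factor is, then both \<open>q + Ra\<close>
  and \<open>(q : a)\<close> are larger, and \<open>acyc_middle\<close> would give vanishing for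
  \<open>q\<close>.\<close>

lemma not_acyc_prime:
  assumes "ideal J R" "\<not> acyc n J"
  shows "\<exists>q. primeideal q R \<and> J \<subseteq> q \<and> \<not> acyc n q"
proof -
  obtain q where q: "ideal q R \<and> J \<subseteq> q \<and> \<not> acyc n q"
    and max: "\<And>K. ideal K R \<and> J \<subseteq> K \<and> \<not> acyc n K \<Longrightarrow> q \<subseteq> K \<Longrightarrow> K = q"
    by (rule ex_maximal_ideal[of "\<lambda>q. ideal q R \<and> J \<subseteq> q \<and> \<not> acyc n q" J]) (use assms in auto)
  have qi: "ideal q R" using q by blast
  have larger: "acyc n K" if "ideal K R" "q \<subseteq> K" "b \<in> K" "b \<notin> q" for K b
    using max[of K] that q by auto
  have "primeideal q R"
  proof (rule primeidealI[OF qi is_cring])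
    show "carrier R \<noteq> q" using q acyc_carrier by blast
    fix a b assume a: "a \<in> carrier R" and b: "b \<in> carrier R" and ab: "a \<otimes> b \<in> q"
    show "a \<in> q \<or> b \<in> q"
    proof (rule ccontr)
      assume n: "\<not> (a \<in> q \<or> b \<in> q)"
      have "acyc n (ideal_adjoin R q a)"
        by (rule larger[of _ a]) (use n ideal_adjoin_ideal[OF qi a] ideal_adjoin_incl[OF qi a] in auto)
      moreover have "acyc n (ideal_colon R q a)"
      proof (rule larger[of _ b])
        show "ideal (ideal_colon R q a) R" "q \<subseteq> ideal_colon R q a" "b \<notin> q"
          using n ideal_colon_ideal[OF qi a] ideal_colon_incl[OF qi a] by auto
        show "b \<in> ideal_colon R q a" using a b ab unfolding ideal_colon_def by (simp add: m_comm)
      qed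
      ultimately show False using acyc_middle[OF qi a] q by blast
    qed
  qed
  then show ?thesis using q by blast
qed

text \<open>As \<open>p\<close> is prime, \<open>(p : y) = p\<close>, and the exact sequence is that
  of multiplication by \<open>y\<close> on R/p. Vanishing for \<open>p + Ry\<close> one degree
  higher would make \<open>y\<close> surjective on the cohomology for \<open>p\<close>, against
  Nakayama.\<close>

lemma not_acyc_adjoin:
  assumes p: "primeideal p R" and y: "y \<in> \<mm>" "y \<notin> p"
    and an: "almost_noeth y n p" and nac: "\<not> acyc n p"
  shows "\<not> acyc (Suc n) (ideal_adjoin R p y)"
proof
  assume ac: "acyc (Suc n) (ideal_adjoin R p y)"
  have pi: "ideal p R" using p unfolding primeideal_def by blast
  have pc: "p \<subseteq> carrier R" using pi unfolding ideal_crit by blast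
  have yR: "y \<in> carrier R" using mm_carrier[OF y(1)] .
  have colon: "ideal_colon R p y = p"
    using primeideal.I_prime[OF p] yR y(2) ideal_colon_incl[OF pi yR] unfolding ideal_colon_def by blast
  have "acyc n p"
  proof (rule almost_noeth_nakayama[OF an y(1) pc])
    fix z assume z: "z \<in> cyc n p"
    \<comment> \<open>Here \<open>y w = z\<close> is a cocycle, so \<open>d n w\<close> is killed by
      \<open>y\<close> and is a cocycle for \<open>p + Ry\<close>. The assumed vanishing gives
      \<open>w'\<close> with the same differential and \<open>y w' = 0\<close>; then
      \<open>z = y (w - w')\<close>.\<close>
    obtain w where w: "w \<in> annih n p" "y \<odot>\<^bsub>F n\<^esub> w = z"
      using annih_colon_lift[OF pi yR, of z n] cyc_annih[OF z] unfolding colon by blast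
    note wc = annih_carrier[OF w(1)]
    have "d n w \<in> bnd (Suc n) p" using w(1) by (simp add: bnd_Suc)
    then have "d n w \<in> cyc (Suc n) p" using bnd_subset_cyc[OF pc] by blast
    moreover have "y \<odot>\<^bsub>F (Suc n)\<^esub> d n w = \<zero>\<^bsub>F (Suc n)\<^esub>"
      using d_simps(3)[OF yR wc] w(2) z unfolding cyc_def by simp
    ultimately have "d n w \<in> cyc (Suc n) (ideal_adjoin R p y)"
      unfolding cyc_def annih_adjoin[OF pi yR] by blast
    then have "d n w \<in> d n ` annih n (ideal_adjoin R p y)"
      using ac unfolding acyc_def bnd_Suc by blast
    then obtain w' where w': "w' \<in> annih n p" "y \<odot>\<^bsub>F n\<^esub> w' = \<zero>\<^bsub>F n\<^esub>" "d n w = d n w'"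
      unfolding annih_adjoin[OF pi yR] by blast
    note w'c = annih_carrier[OF w'(1)]
    have "w \<ominus>\<^bsub>F n\<^esub> w' \<in> cyc n p"
      using Fm.submoduleD(6)[OF annih_submodule[OF pc] w(1) w'(1)] wc w'c w'(3)
      unfolding cyc_def by (simp add: Fm.M.minus_self)
    moreover have "z \<ominus>\<^bsub>F n\<^esub> y \<odot>\<^bsub>F n\<^esub> (w \<ominus>\<^bsub>F n\<^esub> w') = \<zero>\<^bsub>F n\<^esub>"
      using wc w'c yR w(2) w'(2) cyc_carrier[OF z]
      by (simp add: Fm.smult_minus_distr Fm.M.minus_zero_right Fm.M.minus_self)
    ultimately show "\<exists>z'\<in>cyc n p. z \<ominus>\<^bsub>F n\<^esub> y \<odot>\<^bsub>F n\<^esub> z' \<in> bnd n p"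
      using Fm.submoduleD(2)[OF bnd_submodule[OF pc]] by force
  qed
  then show False using nac by blast
qed

text \<open>Each new prime costs one degree: the \<open>n\<close>-th prime has non-vanishing
  cohomology in degree \<open>n\<close>, and passing on needs the chain condition in degree
  \<open>n\<close>. This gives \<open>s\<close> steps. The prime reached is not
  \<open>\<mm>\<close>, whose cohomology vanishes, so \<open>\<mm>\<close> extends the chain once
  more.\<close>

theorem long_prime_chain:
  assumes an: "\<And>y k. y \<in> \<mm> \<Longrightarrow> k < s \<Longrightarrow> almost_noeth y k {\<zero>}"
    and p: "primeideal p R" "\<not> acyc 0 p" and mm: "\<And>n. acyc n \<mm>"
  shows "\<exists>c::nat \<Rightarrow> 'a set. (\<forall>i\<le>Suc s. primeideal (c i) R \<and> p \<subseteq> c i) \<and> (\<forall>i<Suc s. c i \<subset> c (Suc i))"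
proof -
  have extend: "\<exists>c::nat \<Rightarrow> 'a set. (\<forall>i\<le>Suc n. primeideal (c i) R \<and> p \<subseteq> c i)
      \<and> (\<forall>i<Suc n. c i \<subset> c (Suc i)) \<and> c (Suc n) = q"
    if c: "\<forall>i\<le>n. primeideal (c i) R \<and> p \<subseteq> c i" "\<forall>i<n. c i \<subset> c (Suc i)"
      and q: "primeideal q R" "c n \<subset> q" for c :: "nat \<Rightarrow> 'a set" and n q
  proof -
    have "p \<subseteq> q" using c(1) q(2) by blast
    then show ?thesis
      by (intro exI[of _ "c(Suc n := q)"]) (use that in \<open>auto simp: le_Suc_eq less_Suc_eq\<close>)
  qed
  have "\<exists>c::nat \<Rightarrow> 'a set. (\<forall>i\<le>n. primeideal (c i) R \<and> p \<subseteq> c i) \<and> (\<forall>i<n. c i \<subset> c (Suc i))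
      \<and> \<not> acyc n (c n)" if "n \<le> s" for n
    using that
  proof (induction n)
    case 0
    show ?case by (rule exI[of _ "\<lambda>_. p"]) (use p in auto)
  next
    case (Suc n)
    then obtain c where c: "\<forall>i\<le>n. primeideal (c i) R \<and> p \<subseteq> c i" "\<forall>i<n. c i \<subset> c (Suc i)"
      "\<not> acyc n (c n)" by auto
    have cn: "primeideal (c n) R" using c(1) by blast
    then have cni: "ideal (c n) R" unfolding primeideal_def by blast
    have "c n \<noteq> \<mm>" using c(3) mm by metis
    then obtain y where y: "y \<in> \<mm>" "y \<notin> c n" using primeideal_subset[OF cn] by blast
    have yR: "y \<in> carrier R" using mm_carrier[OF y(1)] .
    have "almost_noeth y n (c n)"
      by (rule almost_noeth_all[OF yR, of s]) (use an[OF y(1)] cni Suc.prems in auto)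
    then have "\<not> acyc (Suc n) (ideal_adjoin R (c n) y)" using not_acyc_adjoin[OF cn y _ c(3)] by blast
    then obtain q where q: "primeideal q R" "ideal_adjoin R (c n) y \<subseteq> q" "\<not> acyc (Suc n) q"
      using not_acyc_prime[OF ideal_adjoin_ideal[OF cni yR]] by blast
    have "c n \<subset> q" using q(2) ideal_adjoin_incl[OF cni yR] y(2) by blast
    then show ?case using extend[OF c(1,2) q(1)] q(3) by metis
  qed
  from this[OF order_refl] obtain c where "(\<forall>i\<le>s. primeideal (c i) R \<and> p \<subseteq> c i)
      \<and> (\<forall>i<s. c i \<subset> c (Suc i)) \<and> \<not> acyc s (c s)" by (rule exE)
  then have c: "\<forall>i\<le>s. primeideal (c i) R \<and> p \<subseteq> c i" "\<forall>i<s. c i \<subset> c (Suc i)"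
    "\<not> acyc s (c s)" by simp_all
  have "primeideal (c s) R" using c(1) by blast
  moreover have "c s \<noteq> \<mm>" using c(3) mm by metis
  ultimately have "c s \<subset> \<mm>" using primeideal_subset by blast
  then show ?thesis using extend[OF c(1,2) primeideal_mm] by blast
qed

end


section \<open>Complexes modulo torsion\<close>

text \<open>Exactness is not assumed here, so that the two resolutions and the total complex are all
  instances.\<close>

locale baer_complex = noeth_local_ring R \<mm> for R (structure) and \<mm> +
  fixes C :: "nat \<Rightarrow> ('a, 'e) module" and d :: "nat \<Rightarrow> 'e \<Rightarrow> 'e"
  assumes C_baer: "baer_module R (C n)"
    and d_hom: "d n \<in> mod_hom R (C n) (C (Suc n))"
    and d_d: "z \<in> carrier (C n) \<Longrightarrow> d (Suc n) (d n z) = \<zero>\<^bsub>C (Suc (Suc n))\<^esub>"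
begin

lemma C_module: "module R (C n)"
  using C_baer unfolding baer_module_def by blast

sublocale Cm: module R "C n" for n by (rule C_module)

lemmas d_simps [simp] = mod_homD[OF d_hom] mod_hom_zero[OF C_module C_module d_hom]
  mod_hom_neg[OF C_module C_module d_hom] mod_hom_minus[OF C_module C_module d_hom]

abbreviation \<Gamma> :: "nat \<Rightarrow> 'e set" where "\<Gamma> n \<equiv> tors R \<mm> (C n)"

abbreviation Q :: "nat \<Rightarrow> ('a, 'e set) module" where "Q n \<equiv> mod_quot (C n) (\<Gamma> n)"

definition cl :: "nat \<Rightarrow> 'e \<Rightarrow> 'e set" where "cl n z = \<Gamma> n +>\<^bsub>C n\<^esub> z"

definition dq :: "nat \<Rightarrow> 'e set \<Rightarrow> 'e set" where
  "dq n W = cl (Suc n) (d n (SOME z. z \<in> carrier (C n) \<and> W = cl n z))"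

lemmas \<Gamma>_submodule = tors_submodule[OF C_module]

lemmas \<Gamma>_D = Cm.submoduleD[OF \<Gamma>_submodule]

lemma d_tors: "z \<in> \<Gamma> n \<Longrightarrow> d n z \<in> \<Gamma> (Suc n)"
proof -
  assume z: "z \<in> \<Gamma> n"
  then have zc: "z \<in> carrier (C n)" by (simp add: tors_def)
  have "\<exists>k::nat. (a [^] k) \<odot>\<^bsub>C (Suc n)\<^esub> d n z = \<zero>\<^bsub>C (Suc n)\<^esub>" if a: "a \<in> \<mm>" for a
  proof -
    obtain k :: nat where k: "(a [^] k) \<odot>\<^bsub>C n\<^esub> z = \<zero>\<^bsub>C n\<^esub>" using z a unfolding tors_def by blast
    have "a [^] k \<in> carrier R" using mm_carrier[OF a] by simp
    then have "(a [^] k) \<odot>\<^bsub>C (Suc n)\<^esub> d n z = \<zero>\<^bsub>C (Suc n)\<^esub>" using d_simps(3)[of "a [^] k" z n] zc k by simp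
    then show ?thesis by blast
  qed
  then show "d n z \<in> \<Gamma> (Suc n)" using zc unfolding tors_def by simp
qed

lemma
  shows carrier_Q: "carrier (Q n) = cl n ` carrier (C n)"
    and cl_add: "a \<in> carrier (C n) \<Longrightarrow> b \<in> carrier (C n) \<Longrightarrow> cl n a \<oplus>\<^bsub>Q n\<^esub> cl n b = cl n (a \<oplus>\<^bsub>C n\<^esub> b)"
    and cl_zero: "\<zero>\<^bsub>Q n\<^esub> = \<Gamma> n"
    and cl_smult: "a \<in> carrier (C n) \<Longrightarrow> r \<in> carrier R \<Longrightarrow> r \<odot>\<^bsub>Q n\<^esub> cl n a = cl n (r \<odot>\<^bsub>C n\<^esub> a)"
  unfolding cl_def using mod_quot_simps[OF C_module \<Gamma>_submodule] by auto

lemma cl_eq: "a \<in> carrier (C n) \<Longrightarrow> b \<in> carrier (C n) \<Longrightarrow> cl n a = cl n b \<longleftrightarrow> a \<ominus>\<^bsub>C n\<^esub> b \<in> \<Gamma> n"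
  unfolding cl_def by (rule Cm.coset_eq_iff[OF \<Gamma>_submodule])

lemma cl_eq_zero: "a \<in> carrier (C n) \<Longrightarrow> cl n a = \<zero>\<^bsub>Q n\<^esub> \<longleftrightarrow> a \<in> \<Gamma> n"
  unfolding cl_def cl_zero by (rule Cm.coset_zero_iff[OF \<Gamma>_submodule])

lemma Q_module: "module R (Q n)"
  by (rule mod_quot_module[OF C_module \<Gamma>_submodule])

lemma dq_cl: "z \<in> carrier (C n) \<Longrightarrow> dq n (cl n z) = cl (Suc n) (d n z)"
proof -
  assume z: "z \<in> carrier (C n)"
  define z' where "z' = (SOME z'. z' \<in> carrier (C n) \<and> cl n z = cl n z')"
  have z': "z' \<in> carrier (C n) \<and> cl n z = cl n z'"
    unfolding z'_def by (rule someI[of _ z]) (use z in auto)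
  then have "d n (z \<ominus>\<^bsub>C n\<^esub> z') \<in> \<Gamma> (Suc n)" using cl_eq z d_tors by blast
  then have "cl (Suc n) (d n z) = cl (Suc n) (d n z')" using z z' by (simp add: cl_eq)
  then show ?thesis unfolding dq_def z'_def by simp
qed

sublocale q: cyclic_ext_complex R \<mm> Q dq
proof (intro cyclic_ext_complex.intro cyclic_ext_complex_axioms.intro noeth_local_ring_axioms)
  show "module R (Q n)" for n by (rule Q_module)
  show "dq n \<in> mod_hom R (Q n) (Q (Suc n))" for n
  proof (rule mod_homI)
    fix W assume "W \<in> carrier (Q n)"
    then show "dq n W \<in> carrier (Q (Suc n))" by (auto simp: carrier_Q dq_cl)
  next
    fix W W' assume "W \<in> carrier (Q n)" "W' \<in> carrier (Q n)"
    then show "dq n (W \<oplus>\<^bsub>Q n\<^esub> W') = dq n W \<oplus>\<^bsub>Q (Suc n)\<^esub> dq n W'"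
      by (auto simp: carrier_Q dq_cl cl_add)
  next
    fix r W assume "r \<in> carrier R" "W \<in> carrier (Q n)"
    then show "dq n (r \<odot>\<^bsub>Q n\<^esub> W) = r \<odot>\<^bsub>Q (Suc n)\<^esub> dq n W"
      by (auto simp: carrier_Q dq_cl cl_smult)
  qed
  show "dq (Suc n) (dq n W) = \<zero>\<^bsub>Q (Suc (Suc n))\<^esub>" if "W \<in> carrier (Q n)" for n W
  proof -
    have "cl k \<zero>\<^bsub>C k\<^esub> = \<zero>\<^bsub>Q k\<^esub>" for k using cl_eq_zero[of "\<zero>\<^bsub>C k\<^esub>" k] \<Gamma>_D(2) by simp
    then show ?thesis using that by (auto simp: carrier_Q dq_cl d_d)
  qed
  show "cyclic_ext R (Q n)" for n by (rule cyclic_ext_mod_tors[OF C_baer])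
qed

section \<open>Cocycles and coboundaries modulo torsion, in terms of representatives\<close>

lemma annih_cl:
  assumes "J \<subseteq> carrier R" "z \<in> carrier (C n)"
  shows "cl n z \<in> q.annih n J \<longleftrightarrow> (\<forall>j\<in>J. j \<odot>\<^bsub>C n\<^esub> z \<in> \<Gamma> n)"
proof -
  have "j \<odot>\<^bsub>Q n\<^esub> cl n z = \<zero>\<^bsub>Q n\<^esub> \<longleftrightarrow> j \<odot>\<^bsub>C n\<^esub> z \<in> \<Gamma> n" if "j \<in> J" for j
  proof -
    have "j \<in> carrier R" using that assms(1) by blast
    then show ?thesis using assms(2) by (simp add: cl_smult cl_eq_zero)
  qed
  then show ?thesis using assms(2) unfolding q.annih_def by (auto simp: carrier_Q)
qed

lemma cyc_cl:
  assumes "J \<subseteq> carrier R" "z \<in> carrier (C n)"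
  shows "cl n z \<in> q.cyc n J \<longleftrightarrow> (\<forall>j\<in>J. j \<odot>\<^bsub>C n\<^esub> z \<in> \<Gamma> n) \<and> d n z \<in> \<Gamma> (Suc n)"
  using annih_cl[OF assms] assms(2) unfolding q.cyc_def by (simp add: dq_cl cl_eq_zero)

lemma cyc_zero_cl: "z \<in> carrier (C n) \<Longrightarrow> cl n z \<in> q.cyc n {\<zero>} \<longleftrightarrow> d n z \<in> \<Gamma> (Suc n)"
  using cyc_cl[of "{\<zero>}" z n] \<Gamma>_D(2) by simp

lemma bnd_zero_cl:
  assumes "w \<in> carrier (C n)"
  shows "cl (Suc n) (d n w) \<in> q.bnd (Suc n) {\<zero>}"
  using assms \<Gamma>_D(2) annih_cl[of "{\<zero>}" w n] by (force simp: q.bnd_Suc dq_cl[symmetric])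

lemma bnd_zero_clD:
  assumes "cl (Suc n) z \<in> q.bnd (Suc n) {\<zero>}" "z \<in> carrier (C (Suc n))"
  shows "\<exists>w\<in>carrier (C n). z \<ominus>\<^bsub>C (Suc n)\<^esub> d n w \<in> \<Gamma> (Suc n)"
proof -
  obtain W where "W \<in> carrier (Q n)" "cl (Suc n) z = dq n W"
    using assms(1) q.annih_carrier by (auto simp: q.bnd_Suc)
  then obtain w where w: "w \<in> carrier (C n)" "cl (Suc n) z = cl (Suc n) (d n w)"
    by (auto simp: carrier_Q dq_cl)
  then show ?thesis using assms(2) by (auto simp: cl_eq)
qed

text \<open>Nothing nonzero is killed by such an ideal, because \<open>Q n\<close> is torsion-free
  by \<open>tors_closed\<close>.\<close>

lemma annih_zero:
  assumes J: "J \<subseteq> carrier R" and nil: "\<And>b. b \<in> \<mm> \<Longrightarrow> \<exists>k::nat. b [^] k \<in> J" and W: "W \<in> q.annih n J"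
  shows "W = \<zero>\<^bsub>Q n\<^esub>"
proof -
  obtain z where z: "z \<in> carrier (C n)" "W = cl n z" using q.annih_carrier[OF W] by (auto simp: carrier_Q)
  have "\<forall>j\<in>J. j \<odot>\<^bsub>C n\<^esub> z \<in> \<Gamma> n" using W z annih_cl[OF J] by blast
  then have "z \<in> \<Gamma> n" using nil by (intro tors_closed C_module z(1)) blast
  then show ?thesis using z cl_eq_zero by blast
qed

lemma acyc_mm: "q.acyc n \<mm>"
  unfolding q.acyc_def
proof
  fix W assume "W \<in> q.cyc n \<mm>"
  then have "W = \<zero>\<^bsub>Q n\<^esub>"
    using mm_carrier by (intro annih_zero[OF mm_subset _ q.cyc_annih]) (auto intro: exI[of _ "1::nat"])
  then show "W \<in> q.bnd n \<mm>" using q.Fm.submoduleD(2)[OF q.bnd_submodule[OF mm_subset]] by blast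
qed

text \<open>Under the hypotheses on \<open>C\<close>, the quotient of \<open>C\<close> by its torsion is acyclic: a class in the lowest
  degree with non-zero cohomology would be torsion, hence lift to a torsion element of the quotient.\<close>

theorem torsion_exact:
  assumes ker: "\<And>z. z \<in> carrier (C 0) \<Longrightarrow> d 0 z = \<zero>\<^bsub>C (Suc 0)\<^esub> \<Longrightarrow> z \<in> \<Gamma> 0"
    and exact: "\<And>n z. z \<in> carrier (C (Suc n)) \<Longrightarrow> d (Suc n) z = \<zero>\<^bsub>C (Suc (Suc n))\<^esub> \<Longrightarrow>
      \<exists>w\<in>carrier (C n). z = d n w"
    and z: "z \<in> \<Gamma> (Suc n)" "d (Suc n) z = \<zero>\<^bsub>C (Suc (Suc n))\<^esub>"
  shows "\<exists>w\<in>\<Gamma> n. z = d n w"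
proof -
  have acyc: "q.acyc n {\<zero>}" for n
  proof (induction n rule: less_induct)
    case (less n)
    show ?case
      unfolding q.acyc_def
    proof
      fix W assume W: "W \<in> q.cyc n {\<zero>}"
      obtain z where z: "z \<in> carrier (C n)" "W = cl n z" using q.cyc_carrier[OF W] by (auto simp: carrier_Q)
      have dz: "d n z \<in> \<Gamma> (Suc n)" using W z cyc_zero_cl by blast
      define I where "I = {r \<in> carrier R. r \<odot>\<^bsub>C (Suc n)\<^esub> d n z = \<zero>\<^bsub>C (Suc n)\<^esub>}"
      have I: "ideal I R" unfolding I_def by (rule Cm.annihilator_ideal) (use z in simp)
      have Ic: "I \<subseteq> carrier R" unfolding I_def by blast
      have nil: "\<exists>k::nat. b [^] k \<in> I" if "b \<in> \<mm>" for b
        using dz that mm_carrier[OF that] unfolding tors_def I_def by blast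
      have dI: "d n (a \<odot>\<^bsub>C n\<^esub> z) = \<zero>\<^bsub>C (Suc n)\<^esub>" if "a \<in> I" for a
        using that z unfolding I_def by simp
      show "W \<in> q.bnd n {\<zero>}"
      proof (cases n)
        case 0
        have "z \<in> \<Gamma> n"
        proof (rule tors_closed[OF C_module z(1)])
          fix b assume "b \<in> \<mm>"
          then obtain k :: nat where k: "b [^] k \<in> I" using nil by blast
          have "(b [^] k) \<odot>\<^bsub>C n\<^esub> z \<in> carrier (C n)" using subsetD[OF Ic k] z(1) by simp
          then have "(b [^] k) \<odot>\<^bsub>C n\<^esub> z \<in> \<Gamma> n" using ker dI[OF k] 0 by simp
          then show "\<exists>k::nat. (b [^] k) \<odot>\<^bsub>C n\<^esub> z \<in> \<Gamma> n" by blast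
        qed
        then show ?thesis using z 0 cl_eq_zero[OF z(1)] by (simp add: q.bnd_0)
      next
        case (Suc k)
        \<comment> \<open>For \<open>a\<close> in \<open>I\<close> the element \<open>a z\<close> is
          a cocycle of \<open>C\<close> itself, hence a coboundary, so \<open>I\<close> kills the
          class of \<open>W\<close>. Lower degrees being acyclic, the class is represented by an
          element that \<open>I\<close> kills, which is zero by \<open>annih_zero\<close>.\<close>
        have "\<exists>W'\<in>q.cyc n I. W \<ominus>\<^bsub>Q n\<^esub> W' \<in> q.bnd n {\<zero>}"
        proof (rule q.cyc_lift_to_annihilator[OF less.IH I W])
          fix a assume a: "a \<in> I"
          then have aR: "a \<in> carrier R" using Ic by blast
          obtain w where w: "w \<in> carrier (C k)" "a \<odot>\<^bsub>C n\<^esub> z = d k w"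
            using exact[of "a \<odot>\<^bsub>C n\<^esub> z" k] dI[OF a] z(1) aR Suc by auto
          then have "a \<odot>\<^bsub>Q n\<^esub> W = cl n (d k w)" using z aR by (simp add: cl_smult)
          then show "a \<odot>\<^bsub>Q n\<^esub> W \<in> q.bnd n {\<zero>}" using bnd_zero_cl[OF w(1)] Suc by simp
        qed
        then obtain W' where W': "W' \<in> q.cyc n I" "W \<ominus>\<^bsub>Q n\<^esub> W' \<in> q.bnd n {\<zero>}" by blast
        have "W' = \<zero>\<^bsub>Q n\<^esub>" by (rule annih_zero[OF Ic nil q.cyc_annih[OF W'(1)]])
        then show ?thesis using W'(2) q.cyc_carrier[OF W] by (simp add: q.Fm.M.minus_zero_right)
      qed
    qed
  qed
  have zc: "z \<in> carrier (C (Suc n))" using z(1) \<Gamma>_D(1) by blast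
  obtain w where w: "w \<in> carrier (C n)" "z = d n w" using exact[OF zc z(2)] by blast
  \<comment> \<open>The preimage \<open>w\<close> need not be torsion, but it is a cocycle modulo
    torsion. By acyclicity it differs from a torsion element by zero or by a coboundary, which does
    not change \<open>d n w\<close>.\<close>
  then have wb: "cl n w \<in> q.bnd n {\<zero>}" using cyc_zero_cl[OF w(1)] acyc z(1) unfolding q.acyc_def by blast
  show ?thesis
  proof (cases n)
    case 0
    then have "w \<in> \<Gamma> n" using wb cl_eq_zero[OF w(1)] by (simp add: q.bnd_0)
    then show ?thesis using w by blast
  next
    case (Suc k)
    then obtain v where v: "v \<in> carrier (C k)" "w \<ominus>\<^bsub>C n\<^esub> d k v \<in> \<Gamma> n"
      using bnd_zero_clD[of k w] wb w(1) by auto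
    have "d n (w \<ominus>\<^bsub>C n\<^esub> d k v) = z"
      using w v(1) Suc by (simp add: d_d Cm.M.minus_zero_right)
    then show ?thesis using v(2) by blast
  qed
qed

text \<open>The cohomology in degree \<open>k\<close> of the complex modulo torsion is, up to the torsion of \<open>M\<close>, an
  extension of the degree \<open>Suc k\<close> cohomology of the torsion complex by \<open>H\<^sup>k\<close>.\<close>

lemma almost_noeth_mod_torsion:
  assumes M: "module R M" and acc: "acc_on R M (carrier M)" and \<epsilon>: "\<epsilon> \<in> mod_hom R M (C 0)"
    and ker: "\<And>z. z \<in> carrier (C 0) \<Longrightarrow> d 0 z = \<zero>\<^bsub>C (Suc 0)\<^esub> \<Longrightarrow> z \<in> \<epsilon> ` carrier M"
    and exact: "\<And>n z. z \<in> carrier (C (Suc n)) \<Longrightarrow> d (Suc n) z = \<zero>\<^bsub>C (Suc (Suc n))\<^esub> \<Longrightarrow>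
      \<exists>w\<in>carrier (C n). z = d n w"
    and y: "y \<in> carrier R"
    and kill: "\<And>z. z \<in> \<Gamma> (Suc k) \<Longrightarrow> d (Suc k) z = \<zero>\<^bsub>C (Suc (Suc k))\<^esub> \<Longrightarrow>
      \<exists>w\<in>\<Gamma> k. (y [^] (l::nat)) \<odot>\<^bsub>C (Suc k)\<^esub> z = d k w"
  shows "q.almost_noeth y k {\<zero>}"
  unfolding q.almost_noeth_def
proof (intro allI impI)
  fix U :: "nat \<Rightarrow> 'e set set"
  assume U: "\<forall>j. submodule (U j) R (Q k) \<and> q.bnd k {\<zero>} \<subseteq> U j \<and> U j \<subseteq> q.cyc k {\<zero>} \<and> U j \<subseteq> U (Suc j)"
  have Us: "submodule (U j) R (Q k)" for j using U by blast
  note Ud = q.Fm.submoduleD[OF Us]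
  have yl: "y [^] l \<in> carrier R" using y by simp
  \<comment> \<open>After multiplication by \<open>y^l\<close> a cocycle modulo torsion has an
    actual cocycle as representative: \<open>d k z\<close> is a torsion cocycle, so
    \<open>y^l d k z = d k g\<close> with \<open>g\<close> torsion, and \<open>y^l z - g\<close>
    will do.\<close>
  have red: "\<exists>z'\<in>carrier (C k). d k z' = \<zero>\<^bsub>C (Suc k)\<^esub> \<and> (y [^] l) \<odot>\<^bsub>Q k\<^esub> W = cl k z'" if "W \<in> U j" for W j
  proof -
    have "W \<in> q.cyc k {\<zero>}" using that U by blast
    then obtain z where z: "z \<in> carrier (C k)" "W = cl k z" "d k z \<in> \<Gamma> (Suc k)"
      using q.cyc_carrier cyc_zero_cl by (force simp: carrier_Q)
    obtain g where g: "g \<in> \<Gamma> k" "(y [^] l) \<odot>\<^bsub>C (Suc k)\<^esub> d k z = d k g"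
      using kill[OF z(3)] d_d[OF z(1)] by blast
    have gc: "g \<in> carrier (C k)" using g(1) \<Gamma>_D(1) by blast
    let ?z = "(y [^] l) \<odot>\<^bsub>C k\<^esub> z \<ominus>\<^bsub>C k\<^esub> g"
    have "d k ?z = \<zero>\<^bsub>C (Suc k)\<^esub>" using z(1) gc yl g(2) by (simp add: Cm.M.minus_self)
    moreover have "(y [^] l) \<odot>\<^bsub>C k\<^esub> z \<ominus>\<^bsub>C k\<^esub> ?z = g"
      using z(1) gc yl by (simp add: Cm.minus_eq Cm.M.minus_add Cm.M.r_neg1 Cm.M.r_neg2)
    then have "cl k ((y [^] l) \<odot>\<^bsub>C k\<^esub> z) = cl k ?z" using cl_eq z(1) gc yl g(1) by simp
    ultimately show ?thesis using z gc yl by (intro bexI[of _ ?z]) (auto simp: cl_smult)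
  qed
  show "\<exists>(l::nat) m. \<forall>j. \<forall>W\<in>U j. (y [^] l) \<odot>\<^bsub>Q k\<^esub> W \<in> U m"
  proof (cases k)
    case (Suc p)
    \<comment> \<open>In positive degree actual cocycles are coboundaries, which belong to every
      member of the chain.\<close>
    have "(y [^] l) \<odot>\<^bsub>Q k\<^esub> W \<in> U 0" if W: "W \<in> U j" for W j
    proof -
      obtain z' where z': "z' \<in> carrier (C k)" "d k z' = \<zero>\<^bsub>C (Suc k)\<^esub>" "(y [^] l) \<odot>\<^bsub>Q k\<^esub> W = cl k z'"
        using red[OF W] by blast
      then obtain w where "w \<in> carrier (C p)" "z' = d p w" using exact Suc by blast
      then have "cl k z' \<in> q.bnd k {\<zero>}" using bnd_zero_cl Suc by blast
      then show ?thesis using z'(3) U by auto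
    qed
    then show ?thesis by blast
  next
    case 0
    interpret M: module R M by fact
    note \<epsilon>' = mod_homD[OF \<epsilon>] mod_hom_zero[OF M C_module \<epsilon>]
    \<comment> \<open>In degree zero the actual cocycles form the image of \<open>M\<close>, so the
      chain is pulled back to \<open>M\<close>.\<close>
    define V where "V j = {m \<in> carrier M. cl 0 (\<epsilon> m) \<in> U j}" for j
    have "\<forall>j. submodule (V j) R M \<and> V j \<subseteq> carrier M \<and> V j \<subseteq> V (Suc j)"
    proof (intro allI conjI)
      fix j
      show "V j \<subseteq> carrier M" unfolding V_def by blast
      show "V j \<subseteq> V (Suc j)" using U unfolding V_def by blast
      have "cl 0 \<zero>\<^bsub>C 0\<^esub> = \<zero>\<^bsub>Q 0\<^esub>" using cl_eq_zero[of "\<zero>\<^bsub>C 0\<^esub>" 0] \<Gamma>_D(2)[of 0] by simp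
      then show "submodule (V j) R M"
        using Ud 0 unfolding M.submodule_crit V_def
        by (auto simp: \<epsilon>' cl_add[symmetric] cl_smult[symmetric])
    qed
    then obtain N where N: "\<And>j. V j \<subseteq> V N" using acc unfolding acc_on_def by meson
    have "(y [^] l) \<odot>\<^bsub>Q k\<^esub> W \<in> U N" if W: "W \<in> U j" for W j
    proof -
      obtain z' where z': "z' \<in> carrier (C k)" "d k z' = \<zero>\<^bsub>C (Suc k)\<^esub>" "(y [^] l) \<odot>\<^bsub>Q k\<^esub> W = cl k z'"
        using red[OF W] by blast
      then obtain m where m: "m \<in> carrier M" "z' = \<epsilon> m" using ker 0 by blast
      have "cl k z' \<in> U j" using z'(3) Ud(4)[OF yl W] by simp
      then have "m \<in> V j" using m 0 unfolding V_def by simp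
      then have "m \<in> V N" using N by blast
      then show ?thesis using z'(3) m 0 unfolding V_def by simp
    qed
    then show ?thesis by blast
  qed
qed

text \<open>The class of \<open>u\<close> is a nonzero degree-zero cocycle killed by
  \<open>p\<close>, and there are no nonzero coboundaries in degree zero. So the cohomology for
  \<open>p\<close> does not vanish there.\<close>

lemma prime_chain_of_torsion_colon:
  assumes chain: "\<And>y k. y \<in> \<mm> \<Longrightarrow> k < s \<Longrightarrow> q.almost_noeth y k {\<zero>}"
    and u: "u \<in> carrier (C 0)" "d 0 u = \<zero>\<^bsub>C (Suc 0)\<^esub>" "u \<notin> \<Gamma> 0"
    and p: "primeideal p R" "\<And>r. r \<in> p \<Longrightarrow> r \<odot>\<^bsub>C 0\<^esub> u \<in> \<Gamma> 0"
  shows "\<exists>c::nat \<Rightarrow> 'a set. (\<forall>i\<le>Suc s. primeideal (c i) R \<and> p \<subseteq> c i) \<and> (\<forall>i<Suc s. c i \<subset> c (Suc i))"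
proof (rule q.long_prime_chain[OF chain p(1) _ acyc_mm])
  have "p \<subseteq> carrier R" using p(1) unfolding primeideal_def ideal_crit by blast
  then have "cl 0 u \<in> q.cyc 0 p" using u(1,2) p(2) \<Gamma>_D(2) by (auto simp: cyc_cl)
  moreover have "cl 0 u \<notin> q.bnd 0 p" using u cl_eq_zero by (simp add: q.bnd_0)
  ultimately show "\<not> q.acyc 0 p" unfolding q.acyc_def by blast
qed

section \<open>Cohomology of the torsion complex through representatives\<close>

definition tcyc :: "nat \<Rightarrow> 'e set" where
  "tcyc n = {z \<in> \<Gamma> n. d n z = \<zero>\<^bsub>C (Suc n)\<^esub>}"

definition tbnd :: "nat \<Rightarrow> 'e set" where
  "tbnd n = (case n of 0 \<Rightarrow> {\<zero>\<^bsub>C 0\<^esub>} | Suc k \<Rightarrow> d k ` \<Gamma> k)"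

text \<open>For a resolution this is \<open>local_cohomology\<close>, see
  \<open>local_cohomology_eq\<close>.\<close>

definition H :: "nat \<Rightarrow> ('a, 'e set) module" where
  "H n = mod_quot ((C n)\<lparr>carrier := tcyc n\<rparr>) (tbnd n)"

definition hc :: "nat \<Rightarrow> 'e \<Rightarrow> 'e set" where
  "hc n z = tbnd n +>\<^bsub>C n\<^esub> z"

lemma tcyc_submodule: "submodule (tcyc n) R (C n)"
  using \<Gamma>_submodule[of n] unfolding Cm.submodule_crit tcyc_def by (auto simp: subset_eq)

lemmas tcyc_D = Cm.submoduleD[OF tcyc_submodule]

lemma tbnd_submodule: "submodule (tbnd n) R (C n)"
proof (cases n)
  case 0
  then show ?thesis unfolding Cm.submodule_crit tbnd_def by auto
next
  case (Suc k)
  note G = \<Gamma>_D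
  show ?thesis
    unfolding Cm.submodule_crit tbnd_def Suc nat.case
  proof (intro conjI ballI)
    show "d k ` \<Gamma> k \<subseteq> carrier (C (Suc k))" using G(1) by auto
    show "\<zero>\<^bsub>C (Suc k)\<^esub> \<in> d k ` \<Gamma> k" using \<Gamma>_D(2)[of k] by (intro image_eqI[of _ _ "\<zero>\<^bsub>C k\<^esub>"]) auto
  next
    fix u v assume "u \<in> d k ` \<Gamma> k" "v \<in> d k ` \<Gamma> k"
    then obtain u' v' where "u' \<in> \<Gamma> k" "v' \<in> \<Gamma> k" "u = d k u'" "v = d k v'" by blast
    then show "u \<oplus>\<^bsub>C (Suc k)\<^esub> v \<in> d k ` \<Gamma> k"
      using G by (intro image_eqI[of _ _ "u' \<oplus>\<^bsub>C k\<^esub> v'"]) auto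
  next
    fix r u assume r: "r \<in> carrier R" and "u \<in> d k ` \<Gamma> k"
    then obtain u' where "u' \<in> \<Gamma> k" "u = d k u'" by blast
    then show "r \<odot>\<^bsub>C (Suc k)\<^esub> u \<in> d k ` \<Gamma> k"
      using G r by (intro image_eqI[of _ _ "r \<odot>\<^bsub>C k\<^esub> u'"]) auto
  qed
qed

lemmas tbnd_D = Cm.submoduleD[OF tbnd_submodule]

lemma tbnd_0: "tbnd 0 = {\<zero>\<^bsub>C 0\<^esub>}" and tbnd_Suc: "tbnd (Suc k) = d k ` \<Gamma> k"
  unfolding tbnd_def by auto

lemma tbnd_tcyc: "z \<in> tbnd n \<Longrightarrow> z \<in> tcyc n"
proof (cases n)
  case 0
  then show "z \<in> tbnd n \<Longrightarrow> z \<in> tcyc n" using tcyc_D(2)[of 0] by (simp add: tbnd_0)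
next
  case (Suc k)
  then show "z \<in> tbnd n \<Longrightarrow> z \<in> tcyc n"
    using d_tors \<Gamma>_D(1) by (auto simp: tbnd_Suc tcyc_def d_d)
qed

lemma tbnd_submodule': "submodule (tbnd n) R ((C n)\<lparr>carrier := tcyc n\<rparr>)"
proof -
  interpret Z: module R "(C n)\<lparr>carrier := tcyc n\<rparr>" by (rule Cm.submodule_module[OF tcyc_submodule])
  show ?thesis using tbnd_tcyc tbnd_D unfolding Z.submodule_crit by auto
qed

lemma
  shows carrier_H: "carrier (H n) = hc n ` tcyc n"
    and hc_add: "a \<in> tcyc n \<Longrightarrow> b \<in> tcyc n \<Longrightarrow> hc n a \<oplus>\<^bsub>H n\<^esub> hc n b = hc n (a \<oplus>\<^bsub>C n\<^esub> b)"
    and H_zero: "\<zero>\<^bsub>H n\<^esub> = tbnd n"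
    and hc_smult: "a \<in> tcyc n \<Longrightarrow> r \<in> carrier R \<Longrightarrow> r \<odot>\<^bsub>H n\<^esub> hc n a = hc n (r \<odot>\<^bsub>C n\<^esub> a)"
    and H_module: "module R (H n)"
  unfolding hc_def H_def
  using mod_quot_simps[OF Cm.submodule_module[OF tcyc_submodule] tbnd_submodule']
    mod_quot_module[OF Cm.submodule_module[OF tcyc_submodule] tbnd_submodule'] by auto

lemma hc_eq_zero: "a \<in> tcyc n \<Longrightarrow> hc n a = \<zero>\<^bsub>H n\<^esub> \<longleftrightarrow> a \<in> tbnd n"
  unfolding hc_def H_zero using tcyc_D(1) by (intro Cm.coset_zero_iff[OF tbnd_submodule]) auto

lemma kills_H:
  assumes "I \<subseteq> carrier R"
  shows "kills I (H n) \<longleftrightarrow> (\<forall>a\<in>I. \<forall>z\<in>tcyc n. a \<odot>\<^bsub>C n\<^esub> z \<in> tbnd n)"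
proof -
  have "a \<odot>\<^bsub>H n\<^esub> hc n z = \<zero>\<^bsub>H n\<^esub> \<longleftrightarrow> a \<odot>\<^bsub>C n\<^esub> z \<in> tbnd n" if "a \<in> I" "z \<in> tcyc n" for a z
  proof -
    have a: "a \<in> carrier R" using that assms by blast
    then show ?thesis using that tcyc_D(4) by (simp add: hc_smult hc_eq_zero)
  qed
  then show ?thesis unfolding kills_def carrier_H by auto
qed

end


section \<open>Annihilators of parameter elements\<close>

lemma a_kernel_mem: "z \<in> a_kernel A B f \<longleftrightarrow> z \<in> carrier A \<and> f z = \<zero>\<^bsub>B\<^esub>"
  by (simp add: a_kernel_def')

lemma mod_smult_image_submodule:
  assumes "module R M" "x \<in> carrier R"
  shows "submodule (mod_smult_image x M) R M"
proof -
  interpret M: module R M by fact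
  have I: "z \<in> mod_smult_image x M" if "z = x \<odot>\<^bsub>M\<^esub> m" "m \<in> carrier M" for z m
    using that unfolding mod_smult_image_def by blast
  show ?thesis
    unfolding M.submodule_crit
  proof (intro conjI ballI)
    show "mod_smult_image x M \<subseteq> carrier M" using assms(2) unfolding mod_smult_image_def by auto
    show "\<zero>\<^bsub>M\<^esub> \<in> mod_smult_image x M" by (rule I[of _ "\<zero>\<^bsub>M\<^esub>"]) (use assms(2) in auto)
  next
    fix u v assume "u \<in> mod_smult_image x M" "v \<in> mod_smult_image x M"
    then obtain a b where *: "a \<in> carrier M" "b \<in> carrier M" "u = x \<odot>\<^bsub>M\<^esub> a" "v = x \<odot>\<^bsub>M\<^esub> b"
      unfolding mod_smult_image_def by blast
    show "u \<oplus>\<^bsub>M\<^esub> v \<in> mod_smult_image x M"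
      by (rule I[of _ "a \<oplus>\<^bsub>M\<^esub> b"]) (use * assms(2) in \<open>auto simp: M.smult_r_distr\<close>)
  next
    fix r u assume r: "r \<in> carrier R" and "u \<in> mod_smult_image x M"
    then obtain a where *: "a \<in> carrier M" "u = x \<odot>\<^bsub>M\<^esub> a" unfolding mod_smult_image_def by blast
    have "r \<odot>\<^bsub>M\<^esub> u = x \<odot>\<^bsub>M\<^esub> (r \<odot>\<^bsub>M\<^esub> a)"
      using * r assms(2) by (simp add: M.smult_assoc1[symmetric] M.R.m_comm)
    then show "r \<odot>\<^bsub>M\<^esub> u \<in> mod_smult_image x M" by (rule I) (use * r in auto)
  qed
qed

text \<open>If \<open>a M \<subseteq> x M\<close> and \<open>x u = 0\<close> then \<open>a\<^sup>k u = x\<^sup>k q\<close> for some \<open>q\<close>, which vanishes for large \<open>k\<close> since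
  the kernels of the powers of \<open>x\<close> stabilise.\<close>

lemma annihilator_quotient_power:
  assumes M: "module R M" and acc: "acc_on R M (carrier M)" and x: "x \<in> carrier R" and a: "a \<in> carrier R"
    and aM: "\<And>m. m \<in> carrier M \<Longrightarrow> a \<odot>\<^bsub>M\<^esub> m \<in> mod_smult_image x M"
    and u: "u \<in> carrier M" "x \<odot>\<^bsub>M\<^esub> u = \<zero>\<^bsub>M\<^esub>"
  shows "\<exists>n::nat. (a [^]\<^bsub>R\<^esub> n) \<odot>\<^bsub>M\<^esub> u = \<zero>\<^bsub>M\<^esub>"
proof -
  interpret M: module R M by fact
  have pw: "b [^]\<^bsub>R\<^esub> (k::nat) \<in> carrier R" if "b \<in> carrier R" for b k using that by simp
  define V where "V n = {z \<in> carrier M. (x [^]\<^bsub>R\<^esub> (n::nat)) \<odot>\<^bsub>M\<^esub> z = \<zero>\<^bsub>M\<^esub>}" for n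
  have comm: "(b [^]\<^bsub>R\<^esub> (n::nat)) \<odot>\<^bsub>M\<^esub> (r \<odot>\<^bsub>M\<^esub> z) = r \<odot>\<^bsub>M\<^esub> ((b [^]\<^bsub>R\<^esub> n) \<odot>\<^bsub>M\<^esub> z)"
    if "b \<in> carrier R" "r \<in> carrier R" "z \<in> carrier M" for b n r z
    using that by (simp add: M.smult_assoc1[symmetric] M.R.m_comm)
  have suc: "(b [^]\<^bsub>R\<^esub> Suc n) \<odot>\<^bsub>M\<^esub> z = (b [^]\<^bsub>R\<^esub> n) \<odot>\<^bsub>M\<^esub> (b \<odot>\<^bsub>M\<^esub> z)"
    if "b \<in> carrier R" "z \<in> carrier M" for b n z
    using that by (simp add: M.smult_assoc1)
  have "\<forall>n. submodule (V n) R M \<and> V n \<subseteq> carrier M \<and> V n \<subseteq> V (Suc n)"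
  proof (intro allI conjI)
    fix n
    show "submodule (V n) R M"
      unfolding M.submodule_crit V_def using x by (auto simp: M.smult_r_distr comm)
    show "V n \<subseteq> carrier M" unfolding V_def by blast
    have "(x [^]\<^bsub>R\<^esub> Suc n) \<odot>\<^bsub>M\<^esub> z = \<zero>\<^bsub>M\<^esub>"
      if "z \<in> carrier M" "(x [^]\<^bsub>R\<^esub> n) \<odot>\<^bsub>M\<^esub> z = \<zero>\<^bsub>M\<^esub>" for z
      unfolding suc[OF x that(1)] comm[OF x x that(1)] that(2) using x by simp
    then show "V n \<subseteq> V (Suc n)" unfolding V_def by blast
  qed
  then obtain n where n: "\<And>k. V k \<subseteq> V n" using acc unfolding acc_on_def by meson
  have "\<exists>q\<in>carrier M. (x [^]\<^bsub>R\<^esub> (k::nat)) \<odot>\<^bsub>M\<^esub> q = (a [^]\<^bsub>R\<^esub> k) \<odot>\<^bsub>M\<^esub> u" for k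
  proof (induction k)
    case 0
    show ?case using u(1) by auto
  next
    case (Suc k)
    then obtain q where q: "q \<in> carrier M" "(x [^]\<^bsub>R\<^esub> k) \<odot>\<^bsub>M\<^esub> q = (a [^]\<^bsub>R\<^esub> k) \<odot>\<^bsub>M\<^esub> u" by blast
    obtain q' where q': "q' \<in> carrier M" "a \<odot>\<^bsub>M\<^esub> q = x \<odot>\<^bsub>M\<^esub> q'"
      using aM[OF q(1)] unfolding mod_smult_image_def by blast
    have "(x [^]\<^bsub>R\<^esub> Suc k) \<odot>\<^bsub>M\<^esub> q' = (x [^]\<^bsub>R\<^esub> k) \<odot>\<^bsub>M\<^esub> (a \<odot>\<^bsub>M\<^esub> q)"
      by (simp only: suc[OF x q'(1)] q'(2))
    also have "\<dots> = (a [^]\<^bsub>R\<^esub> Suc k) \<odot>\<^bsub>M\<^esub> u"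
      by (simp only: comm[OF x a q(1)] q(2) suc[OF a u(1)] comm[OF a a u(1)])
    finally show ?case using q'(1) by blast
  qed
  then obtain q where q: "q \<in> carrier M" "(x [^]\<^bsub>R\<^esub> n) \<odot>\<^bsub>M\<^esub> q = (a [^]\<^bsub>R\<^esub> n) \<odot>\<^bsub>M\<^esub> u" by blast
  \<comment> \<open>Since \<open>x\<close> kills \<open>u\<close>, one more power of
    \<open>x\<close> kills \<open>q\<close>. By the choice of \<open>n\<close> already the
    \<open>n\<close>-th power does, that is, \<open>a^n u = 0\<close>.\<close>
  have "(x [^]\<^bsub>R\<^esub> Suc n) \<odot>\<^bsub>M\<^esub> q = x \<odot>\<^bsub>M\<^esub> ((a [^]\<^bsub>R\<^esub> n) \<odot>\<^bsub>M\<^esub> u)"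
    by (simp only: suc[OF x q(1)] comm[OF x x q(1)] q(2))
  also have "\<dots> = \<zero>\<^bsub>M\<^esub>" using x a u comm[of a x u n] by simp
  finally have "q \<in> V (Suc n)" unfolding V_def using q(1) by simp
  then have "q \<in> V n" using n by blast
  then show ?thesis using q(2) unfolding V_def by auto
qed

lemma mod_dim_ge:
  assumes "\<forall>i\<le>n. primeideal (c i) R \<and> mod_annihilator R M \<subseteq> c i" "\<forall>i<n. c i \<subset> c (Suc i)"
  shows "ereal (real n) \<le> mod_dim R M"
  unfolding mod_dim_def by (rule SUP_upper) (use assms in blast)

locale resolved_module = noeth_local_ring R \<mm> for R (structure) and \<mm> +
  fixes M :: "('a, 'm) module" and \<epsilon> :: "'m \<Rightarrow> 'e" and C :: "('a, 'e) cochain_complex"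
  assumes M_module: "module R M" and resolution: "injective_resolution R M \<epsilon> C"
begin

lemmas res = resolution[unfolded injective_resolution_def]

lemma obj_injective: "injective_module R (obj C n)"
  and \<epsilon>_hom: "\<epsilon> \<in> mod_hom R M (obj C 0)"
  and diff_hom: "diff C n \<in> mod_hom R (obj C n) (obj C (Suc n))"
  and \<epsilon>_inj: "inj_on \<epsilon> (carrier M)"
  using res by blast+

lemma exact_0: "z \<in> carrier (obj C 0) \<Longrightarrow> diff C 0 z = \<zero>\<^bsub>obj C (Suc 0)\<^esub> \<longleftrightarrow> z \<in> \<epsilon> ` carrier M"
  using res a_kernel_mem[of z "obj C 0" "obj C 1" "diff C 0"] by simp

lemma exact_Suc: "z \<in> carrier (obj C (Suc n)) \<Longrightarrow>
    diff C (Suc n) z = \<zero>\<^bsub>obj C (Suc (Suc n))\<^esub> \<longleftrightarrow> z \<in> diff C n ` carrier (obj C n)"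
  using res a_kernel_mem[of z "obj C (Suc n)" "obj C (Suc (Suc n))" "diff C (Suc n)"] by simp

sublocale baer_complex R \<mm> "obj C" "diff C"
proof (intro baer_complex.intro baer_complex_axioms.intro noeth_local_ring_axioms)
  fix n
  show "baer_module R (obj C n)" by (rule injective_imp_baer[OF obj_injective])
  show "diff C n \<in> mod_hom R (obj C n) (obj C (Suc n))" by (rule diff_hom)
  fix z assume "z \<in> carrier (obj C n)"
  then show "diff C (Suc n) (diff C n z) = \<zero>\<^bsub>obj C (Suc (Suc n))\<^esub>"
    using exact_Suc mod_homD(1)[OF diff_hom] by blast
qed

sublocale M: module R M by (rule M_module)

lemmas \<epsilon>_simps = mod_homD[OF \<epsilon>_hom] mod_hom_zero[OF M_module C_module \<epsilon>_hom]

lemma local_cohomology_eq: "local_cohomology R \<mm> C n = H n"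
proof -
  have "{z \<in> \<Gamma> n. diff C n z = \<zero>\<^bsub>torsion_submodule R \<mm> (obj C (Suc n))\<^esub>} = tcyc n"
    unfolding tcyc_def torsion_submodule_def by simp
  then have 1: "a_kernel (torsion_submodule R \<mm> (obj C n)) (torsion_submodule R \<mm> (obj C (Suc n))) (diff C n) = tcyc n"
    unfolding a_kernel_def' carrier_torsion_submodule[OF C_module] .
  have "\<zero>\<^bsub>torsion_submodule R \<mm> (obj C 0)\<^esub> = \<zero>\<^bsub>obj C 0\<^esub>"
    by (simp add: torsion_submodule_def)
  then have 2: "coboundaries (torsion_complex R \<mm> C) n = tbnd n"
    by (cases n) (simp_all add: coboundaries_def torsion_complex_def tbnd_def
        carrier_torsion_submodule[OF C_module])
  have 3: "(torsion_submodule R \<mm> (obj C n))\<lparr>carrier := tcyc n\<rparr> = (obj C n)\<lparr>carrier := tcyc n\<rparr>"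
    by (simp add: torsion_submodule_def)
  show ?thesis
    unfolding local_cohomology_def cohomology_def H_def 2
    by (simp add: torsion_complex_def 1 3)
qed

lemma \<epsilon>_tors: "u \<in> carrier M \<Longrightarrow> \<epsilon> u \<in> \<Gamma> 0 \<longleftrightarrow> u \<in> tors R \<mm> M"
proof -
  assume u: "u \<in> carrier M"
  have "(a [^] (n::nat)) \<odot>\<^bsub>obj C 0\<^esub> \<epsilon> u = \<zero>\<^bsub>obj C 0\<^esub> \<longleftrightarrow> (a [^] n) \<odot>\<^bsub>M\<^esub> u = \<zero>\<^bsub>M\<^esub>" if "a \<in> \<mm>" for a n
  proof -
    have an: "a [^] n \<in> carrier R" using mm_carrier[OF that] by simp
    then have "(a [^] n) \<odot>\<^bsub>obj C 0\<^esub> \<epsilon> u = \<epsilon> ((a [^] n) \<odot>\<^bsub>M\<^esub> u)" using \<epsilon>_simps(3) u by simp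
    then show ?thesis
      using \<epsilon>_simps(4) an u \<epsilon>_inj by (metis M.M.zero_closed M.smult_closed inj_onD)
  qed
  then show ?thesis using u \<epsilon>_simps(1)[OF u] unfolding tors_def by auto
qed

text \<open>A non-torsion \<open>u\<close> would give a prime \<open>p\<close> containing the
  annihilator of \<open>M/xM\<close> and the start of a chain of length \<open>d\<close>. Then M/xM
  would have dimension at least \<open>d\<close>.\<close>

theorem annihilator_parameter_torsion:
  assumes gcm: "generalized_Cohen_Macaulay R \<mm> M C d" and param: "parameter_element R \<mm> M x"
    and u: "u \<in> carrier M" "x \<odot>\<^bsub>M\<^esub> u = \<zero>\<^bsub>M\<^esub>"
  shows "u \<in> tors R \<mm> M"
proof (rule ccontr)
  assume nt: "u \<notin> tors R \<mm> M"
  have xm: "x \<in> \<mm>" and dimq: "mod_dim R (mod_quot M (mod_smult_image x M)) = mod_dim R M - 1"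
    using param unfolding parameter_element_def by auto
  have xR: "x \<in> carrier R" using mm_carrier[OF xm] .
  have fg: "finitely_generated_module R M" and dim: "mod_dim R M = ereal (real d)" and d: "0 < d"
    using gcm unfolding generalized_Cohen_Macaulay_def by auto
  note acc = acc_finitely_generated[OF fg]
  note T = M.submoduleD[OF tors_submodule[OF M_module]]
  \<comment> \<open>The annihilator of the class of \<open>v\<close> in \<open>M\<close> modulo
    torsion; a maximal one is an associated prime.\<close>
  define col where "col v = {r \<in> carrier R. r \<odot>\<^bsub>M\<^esub> v \<in> tors R \<mm> M}" for v
  have col_ideal: "ideal (col v) R" if "v \<in> carrier M" for v
    unfolding ideal_crit col_def using that T by (auto simp: M.smult_l_distr M.smult_assoc1)
  \<comment> \<open>Only elements killed by \<open>x\<close> compete. This puts into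
    \<open>p\<close> the whole annihilator of M/xM, and not just \<open>x\<close>.\<close>
  let ?P = "\<lambda>I. \<exists>v\<in>carrier M. x \<odot>\<^bsub>M\<^esub> v = \<zero>\<^bsub>M\<^esub> \<and> v \<notin> tors R \<mm> M \<and> I = col v"
  obtain p where "?P p" and max: "\<And>I. ?P I \<Longrightarrow> p \<subseteq> I \<Longrightarrow> I = p"
    by (rule ex_maximal_ideal[of ?P "col u"]) (use u nt col_ideal in auto)
  then obtain v where v: "v \<in> carrier M" "x \<odot>\<^bsub>M\<^esub> v = \<zero>\<^bsub>M\<^esub>" "v \<notin> tors R \<mm> M" and pv: "p = col v" by blast
  have p_ideal: "ideal p R" unfolding pv by (rule col_ideal[OF v(1)])
  have p: "primeideal p R"
  proof (rule primeidealI[OF p_ideal is_cring])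
    have "\<one> \<notin> p" using v(1,3) unfolding pv col_def by simp
    then show "carrier R \<noteq> p" using one_closed by blast
    fix a b assume a: "a \<in> carrier R" and b: "b \<in> carrier R" and ab: "a \<otimes> b \<in> p"
    show "a \<in> p \<or> b \<in> p"
    proof (rule disjCI)
      assume "b \<notin> p"
      then have "b \<odot>\<^bsub>M\<^esub> v \<notin> tors R \<mm> M" using b unfolding pv col_def by blast
      moreover have "x \<odot>\<^bsub>M\<^esub> (b \<odot>\<^bsub>M\<^esub> v) = b \<odot>\<^bsub>M\<^esub> (x \<odot>\<^bsub>M\<^esub> v)"
        using xR b v(1) by (simp add: M.smult_assoc1[symmetric] m_comm)
      ultimately have "?P (col (b \<odot>\<^bsub>M\<^esub> v))" using v(1,2) b by auto
      moreover have "p \<subseteq> col (b \<odot>\<^bsub>M\<^esub> v)"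
      proof
        fix r assume "r \<in> p"
        then have r: "r \<in> carrier R" "r \<odot>\<^bsub>M\<^esub> v \<in> tors R \<mm> M" unfolding pv col_def by auto
        have "r \<odot>\<^bsub>M\<^esub> (b \<odot>\<^bsub>M\<^esub> v) = b \<odot>\<^bsub>M\<^esub> (r \<odot>\<^bsub>M\<^esub> v)"
          using r(1) b v(1) by (simp add: M.smult_assoc1[symmetric] m_comm)
        then show "r \<in> col (b \<odot>\<^bsub>M\<^esub> v)" using r T(4)[OF b r(2)] unfolding col_def by simp
      qed
      ultimately have "col (b \<odot>\<^bsub>M\<^esub> v) = p" by (rule max)
      moreover have "a \<in> col (b \<odot>\<^bsub>M\<^esub> v)"
        using ab a b v(1) unfolding pv col_def by (simp add: M.smult_assoc1)
      ultimately show "a \<in> p" by simp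
    qed
  qed
  obtain K :: nat where K: "0 < K" "\<And>i. i < d \<Longrightarrow> kills (ideal_power R \<mm> K) (H i)"
    using gcm unfolding generalized_Cohen_Macaulay_def local_cohomology_eq by blast
  \<comment> \<open>Degree \<open>k\<close> modulo torsion involves \<open>H (Suc k)\<close>, which
    a power of \<open>\<mm>\<close> kills as long as \<open>k + 1 < d\<close>.\<close>
  have chain: "q.almost_noeth y k {\<zero>}" if y: "y \<in> \<mm>" and k: "k < d - 1" for y k
  proof (rule almost_noeth_mod_torsion[OF M_module acc \<epsilon>_hom _ _ mm_carrier[OF y]])
    show "z \<in> \<epsilon> ` carrier M" if "z \<in> carrier (obj C 0)" "diff C 0 z = \<zero>\<^bsub>obj C (Suc 0)\<^esub>" for z
      using exact_0[OF that(1)] that(2) by simp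
    show "\<exists>w\<in>carrier (obj C n). z = diff C n w"
      if "z \<in> carrier (obj C (Suc n))" "diff C (Suc n) z = \<zero>\<^bsub>obj C (Suc (Suc n))\<^esub>" for n z
      using exact_Suc[OF that(1)] that(2) by auto
    fix z assume z: "z \<in> \<Gamma> (Suc k)" "diff C (Suc k) z = \<zero>\<^bsub>obj C (Suc (Suc k))\<^esub>"
    have sub: "ideal_power R \<mm> K \<subseteq> carrier R"
      using ideal_power_ideal[OF ideal_mm] unfolding ideal_crit by blast
    have "kills (ideal_power R \<mm> K) (H (Suc k))" using K(2) k by simp
    then have "(y [^] K) \<odot>\<^bsub>obj C (Suc k)\<^esub> z \<in> tbnd (Suc k)"
      using kills_H[OF sub] ideal_power_elem[OF ideal_mm y] z unfolding tcyc_def by blast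
    then show "\<exists>w\<in>\<Gamma> k. (y [^] K) \<odot>\<^bsub>obj C (Suc k)\<^esub> z = diff C k w" by (auto simp: tbnd_Suc)
  qed
  have "\<exists>c::nat \<Rightarrow> 'a set. (\<forall>i\<le>Suc (d - 1). primeideal (c i) R \<and> p \<subseteq> c i)
      \<and> (\<forall>i<Suc (d - 1). c i \<subset> c (Suc i))"
  proof (rule prime_chain_of_torsion_colon[OF chain _ _ _ p])
    show "\<epsilon> v \<in> carrier (obj C 0)" "\<epsilon> v \<notin> \<Gamma> 0" using \<epsilon>_simps(1) \<epsilon>_tors v by auto
    then show "diff C 0 (\<epsilon> v) = \<zero>\<^bsub>obj C (Suc 0)\<^esub>" using exact_0 v(1) by blast
    show "r \<odot>\<^bsub>obj C 0\<^esub> \<epsilon> v \<in> \<Gamma> 0" if "r \<in> p" for r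
      using that v(1) \<epsilon>_tors[of "r \<odot>\<^bsub>M\<^esub> v"] unfolding pv col_def by (auto simp: \<epsilon>_simps(3))
  qed
  then obtain c :: "nat \<Rightarrow> 'a set" where c: "\<forall>i\<le>d. primeideal (c i) R \<and> p \<subseteq> c i" "\<forall>i<d. c i \<subset> c (Suc i)"
    using d by auto
  let ?X = "mod_smult_image x M"
  note X = mod_smult_image_submodule[OF M_module xR]
  note qs = mod_quot_simps[OF M_module X]
  have ann: "mod_annihilator R (mod_quot M ?X) \<subseteq> p"
  proof
    fix a assume "a \<in> mod_annihilator R (mod_quot M ?X)"
    then have a: "a \<in> carrier R" and az: "\<And>Z. Z \<in> carrier (mod_quot M ?X) \<Longrightarrow> a \<odot>\<^bsub>mod_quot M ?X\<^esub> Z = \<zero>\<^bsub>mod_quot M ?X\<^esub>"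
      unfolding mod_annihilator_def by auto
    have "a \<odot>\<^bsub>M\<^esub> m \<in> ?X" if m: "m \<in> carrier M" for m
      using az[of "?X +>\<^bsub>M\<^esub> m"] m a M.coset_zero_iff[OF X, of "a \<odot>\<^bsub>M\<^esub> m"] by (simp add: qs)
    \<comment> \<open>From \<open>a M\<close> inside \<open>x M\<close> and \<open>x v = 0\<close>
      some power of \<open>a\<close> kills \<open>v\<close>; that power lies in the prime
      \<open>p\<close>, hence so does \<open>a\<close>.\<close>
    then obtain n :: nat where "(a [^] n) \<odot>\<^bsub>M\<^esub> v = \<zero>\<^bsub>M\<^esub>"
      using annihilator_quotient_power[OF M_module acc xR a _ v(1,2)] by blast
    then have "a [^] n \<in> p" using a T(2) unfolding pv col_def by simp
    then show "a \<in> p"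
    proof (induction n)
      case 0
      then show ?case using primeideal.I_notcarr[OF p] ideal.one_imp_carrier[OF p_ideal] by simp
    next
      case (Suc n)
      then show ?case using primeideal.I_prime[OF p, of "a [^] n" a] a by auto
    qed
  qed
  have "ereal (real d) \<le> mod_dim R (mod_quot M ?X)"
    by (rule mod_dim_ge[of d c]) (use c ann in blast)+
  then show False unfolding dimq dim by (simp add: one_ereal_def)
qed

end


section \<open>Comparison of the two resolutions\<close>

context baer_complex
begin

text \<open>The complex moved up by one degree, with zero in degree zero. Then \<open>pd n\<close>
  is the differential into \<open>C n\<close> for every \<open>n\<close>, and coboundaries need no
  case distinction.\<close>

definition pobj :: "nat \<Rightarrow> ('a, 'e) module" where
  "pobj = case_nat (zero_module (C 0)) C"

definition pd :: "nat \<Rightarrow> 'e \<Rightarrow> 'e" where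
  "pd = case_nat (\<lambda>_. \<zero>\<^bsub>C 0\<^esub>) d"

lemma pobj_simps [simp]: "pobj 0 = zero_module (C 0)" "pobj (Suc n) = C n"
  by (simp_all add: pobj_def)

lemma pd_simps [simp]: "pd 0 z = \<zero>\<^bsub>C 0\<^esub>" "pd (Suc n) = d n"
  by (simp_all add: pd_def)

lemma pobj_baer: "baer_module R (pobj n)"
  by (cases n) (simp_all add: C_baer baer_zero_module[OF C_module])

lemma pobj_module: "module R (pobj n)"
  using pobj_baer unfolding baer_module_def by blast

lemma pd_hom: "pd n \<in> mod_hom R (pobj n) (C n)"
  by (cases n) (auto simp: d_hom intro: mod_homI)

lemma d_pd: "z \<in> carrier (pobj n) \<Longrightarrow> d n (pd n z) = \<zero>\<^bsub>C (Suc n)\<^esub>"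
  by (cases n) (simp_all add: d_d)

lemma tbnd_pd: "tbnd n = pd n ` tors R \<mm> (pobj n)"
proof (cases n)
  case 0
  have "\<zero>\<^bsub>C 0\<^esub> \<in> tors R \<mm> (zero_module (C 0))"
    using mm_carrier by (auto simp: tors_def)
  then show ?thesis using 0 by (auto simp: tbnd_0)
next
  case (Suc k)
  then show ?thesis by (simp add: tbnd_Suc)
qed

end

section \<open>Homomorphisms, torsion and direct sums\<close>

lemma (in noeth_local_ring) mod_hom_tors:
  assumes A: "module R A" and B: "module R B" and f: "f \<in> mod_hom R A B" and z: "z \<in> tors R \<mm> A"
  shows "f z \<in> tors R \<mm> B"
proof -
  have zc: "z \<in> carrier A" using z by (simp add: tors_def)
  have "\<exists>k::nat. (a [^] k) \<odot>\<^bsub>B\<^esub> f z = \<zero>\<^bsub>B\<^esub>" if a: "a \<in> \<mm>" for a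
  proof -
    obtain k :: nat where k: "(a [^] k) \<odot>\<^bsub>A\<^esub> z = \<zero>\<^bsub>A\<^esub>" using z a unfolding tors_def by blast
    have "a [^] k \<in> carrier R" using mm_carrier[OF a] by simp
    then show ?thesis using mod_homD(3)[OF f _ zc] k mod_hom_zero[OF A B f] by metis
  qed
  then show ?thesis using mod_homD(1)[OF f zc] unfolding tors_def by simp
qed

lemma (in noeth_local_ring) tors_mod_sum:
  assumes A: "module R A" and B: "module R B"
  shows "tors R \<mm> (mod_sum A B) = tors R \<mm> A \<times> tors R \<mm> B"
proof (intro equalityI subsetI)
  fix z assume "z \<in> tors R \<mm> (mod_sum A B)"
  then show "z \<in> tors R \<mm> A \<times> tors R \<mm> B" by (fastforce simp: tors_def mod_sum_def)
next
  interpret A: module R A by fact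
  interpret B: module R B by fact
  fix z assume "z \<in> tors R \<mm> A \<times> tors R \<mm> B"
  then obtain u v where z: "z = (u, v)" "u \<in> tors R \<mm> A" "v \<in> tors R \<mm> B" by auto
  have c: "u \<in> carrier A" "v \<in> carrier B" using z by (auto simp: tors_def)
  have "\<exists>n::nat. (a [^] n) \<odot>\<^bsub>A\<^esub> u = \<zero>\<^bsub>A\<^esub> \<and> (a [^] n) \<odot>\<^bsub>B\<^esub> v = \<zero>\<^bsub>B\<^esub>" if a: "a \<in> \<mm>" for a
  proof -
    have aR: "a \<in> carrier R" using mm_carrier[OF a] .
    obtain k l :: nat where "(a [^] k) \<odot>\<^bsub>A\<^esub> u = \<zero>\<^bsub>A\<^esub>" "(a [^] l) \<odot>\<^bsub>B\<^esub> v = \<zero>\<^bsub>B\<^esub>"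
      using z(2,3) a unfolding tors_def by blast
    then have "(a [^] (l + k)) \<odot>\<^bsub>A\<^esub> u = \<zero>\<^bsub>A\<^esub>" "(a [^] (k + l)) \<odot>\<^bsub>B\<^esub> v = \<zero>\<^bsub>B\<^esub>"
      using tors_mono_pow[OF A c(1) aR] tors_mono_pow[OF B c(2) aR] by auto
    then show ?thesis by (metis add.commute)
  qed
  then show "z \<in> tors R \<mm> (mod_sum A B)" using z(1) c by (auto simp: tors_def mod_sum_def)
qed

lemma mod_hom_smult:
  assumes "module R A" "module R B" "f \<in> mod_hom R A B" "x \<in> carrier R"
  shows "(\<lambda>z. x \<odot>\<^bsub>B\<^esub> f z) \<in> mod_hom R A B"
proof -
  interpret A: module R A by fact
  interpret B: module R B by fact
  note f = mod_homD[OF assms(3)]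
  show ?thesis
    by (rule mod_homI) (use f assms(4) in \<open>simp_all add: B.smult_r_distr B.smult_assoc1[symmetric] A.R.m_comm\<close>)
qed

lemma mod_hom_diff:
  assumes "module R A" "module R B" "f \<in> mod_hom R A B" "g \<in> mod_hom R A B"
  shows "(\<lambda>z. f z \<ominus>\<^bsub>B\<^esub> g z) \<in> mod_hom R A B"
proof -
  interpret A: module R A by fact
  interpret B: module R B by fact
  note f = mod_homD[OF assms(3)] and g = mod_homD[OF assms(4)]
  show ?thesis
    by (rule mod_homI)
      (use f g in \<open>simp_all add: B.M.minus_eq B.smult_r_distr B.smult_r_minus B.M.minus_add B.M.a_ac\<close>)
qed

lemma mod_hom_compose:
  assumes "f \<in> mod_hom R A B" "g \<in> mod_hom R B D"
  shows "(\<lambda>z. g (f z)) \<in> mod_hom R A D"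
  using mod_homD[OF assms(1)] mod_homD[OF assms(2)] by (intro mod_homI) simp_all

locale quotient_resolutions =
  C: resolved_module R \<mm> M \<epsilon> C +
  D: resolved_module R \<mm> "mod_quot M (mod_smult_image x M)" \<eta> D
  for R (structure) and \<mm> and M :: "('a, 'm) module" and \<epsilon> :: "'m \<Rightarrow> 'e"
    and C :: "('a, 'e) cochain_complex" and x and \<eta> :: "'m set \<Rightarrow> 'f"
    and D :: "('a, 'f) cochain_complex" +
  assumes x: "x \<in> carrier R"
begin

abbreviation "xM \<equiv> mod_smult_image x M"

lemmas xM_submodule = mod_smult_image_submodule[OF C.M_module x]

lemma xM_I: "m \<in> carrier M \<Longrightarrow> x \<odot>\<^bsub>M\<^esub> m \<in> xM"
  unfolding mod_smult_image_def by blast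

lemma aug_hom: "(\<lambda>m. \<eta> (xM +>\<^bsub>M\<^esub> m)) \<in> mod_hom R M (obj D 0)"
  using mod_hom_compose[OF quot_map_hom[OF C.M_module xM_submodule] D.\<epsilon>_hom] .

lemma aug_zero_iff: "m \<in> carrier M \<Longrightarrow> \<eta> (xM +>\<^bsub>M\<^esub> m) = \<zero>\<^bsub>obj D 0\<^esub> \<longleftrightarrow> m \<in> xM"
proof -
  assume m: "m \<in> carrier M"
  note qs = mod_quot_simps[OF C.M_module xM_submodule]
  have "xM +>\<^bsub>M\<^esub> m \<in> carrier (mod_quot M xM)" using m qs(1) by blast
  then have "\<eta> (xM +>\<^bsub>M\<^esub> m) = \<zero>\<^bsub>obj D 0\<^esub> \<longleftrightarrow> xM +>\<^bsub>M\<^esub> m = \<zero>\<^bsub>mod_quot M xM\<^esub>"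
    using D.\<epsilon>_simps(4) D.\<epsilon>_inj D.M.M.zero_closed by (metis inj_onD)
  then show ?thesis using C.M.coset_zero_iff[OF xM_submodule m] qs(3) by simp
qed

lemma aug_surj:
  assumes "e \<in> carrier (obj D 0)" "diff D 0 e = \<zero>\<^bsub>obj D (Suc 0)\<^esub>"
  shows "\<exists>m\<in>carrier M. e = \<eta> (xM +>\<^bsub>M\<^esub> m)"
  using D.exact_0[OF assms(1)] assms(2) mod_quot_simps(1)[OF C.M_module xM_submodule] by auto

lemma ex_chain_map:
  "\<exists>\<phi>. (\<forall>n. \<phi> n \<in> mod_hom R (obj C n) (obj D n))
     \<and> (\<forall>m\<in>carrier M. \<phi> 0 (\<epsilon> m) = \<eta> (xM +>\<^bsub>M\<^esub> m))
     \<and> (\<forall>n. \<forall>z\<in>carrier (obj C n). \<phi> (Suc n) (diff C n z) = diff D n (\<phi> n z))"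
proof -
  \<comment> \<open>The last clause is carried along because it makes \<open>diff D n\<close> after
    \<open>f\<close> vanish on the kernel of \<open>diff C n\<close>, which is what the next
    component needs in order to exist.\<close>
  define P where "P n f \<longleftrightarrow> f \<in> mod_hom R (obj C n) (obj D n)
      \<and> (n = 0 \<longrightarrow> (\<forall>m\<in>carrier M. f (\<epsilon> m) = \<eta> (xM +>\<^bsub>M\<^esub> m)))
      \<and> (\<forall>z\<in>carrier (obj C n). diff C n z = \<zero>\<^bsub>obj C (Suc n)\<^esub> \<longrightarrow> diff D n (f z) = \<zero>\<^bsub>obj D (Suc n)\<^esub>)"
    for n f
  have "\<exists>\<phi>. \<forall>n. P n (\<phi> n) \<and> (\<forall>z\<in>carrier (obj C n). \<phi> (Suc n) (diff C n z) = diff D n (\<phi> n z))"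
  proof (rule dependent_nat_choice)
    have "\<exists>f\<in>mod_hom R (obj C 0) (obj D 0). \<forall>m\<in>carrier M. f (\<epsilon> m) = \<eta> (xM +>\<^bsub>M\<^esub> m)"
    proof (rule injective_module_factor[OF D.obj_injective C.M_module C.C_module C.\<epsilon>_hom aug_hom])
      fix m assume m: "m \<in> carrier M" "\<epsilon> m = \<zero>\<^bsub>obj C 0\<^esub>"
      then have "m = \<zero>\<^bsub>M\<^esub>" using C.\<epsilon>_simps(4) C.\<epsilon>_inj C.M.M.zero_closed by (metis inj_onD)
      then show "\<eta> (xM +>\<^bsub>M\<^esub> m) = \<zero>\<^bsub>obj D 0\<^esub>"
        using aug_zero_iff m(1) C.M.submoduleD(2)[OF xM_submodule] by simp
    qed
    then obtain f where f: "f \<in> mod_hom R (obj C 0) (obj D 0)"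
      "\<And>m. m \<in> carrier M \<Longrightarrow> f (\<epsilon> m) = \<eta> (xM +>\<^bsub>M\<^esub> m)" by blast
    have "diff D 0 (f z) = \<zero>\<^bsub>obj D (Suc 0)\<^esub>"
      if z: "z \<in> carrier (obj C 0)" "diff C 0 z = \<zero>\<^bsub>obj C (Suc 0)\<^esub>" for z
    proof -
      obtain m where m: "m \<in> carrier M" "z = \<epsilon> m" using C.exact_0[OF z(1)] z(2) by blast
      have "f z \<in> \<eta> ` carrier (mod_quot M xM)"
        using m f(2) mod_quot_simps(1)[OF C.M_module xM_submodule] by auto
      then show ?thesis using D.exact_0 mod_homD(1)[OF f(1) z(1)] by blast
    qed
    then show "\<exists>f. P 0 f" unfolding P_def using f by blast
  next
    fix f n assume f: "P n f"
    then have fh: "f \<in> mod_hom R (obj C n) (obj D n)" unfolding P_def by blast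
    have "\<exists>g\<in>mod_hom R (obj C (Suc n)) (obj D (Suc n)). \<forall>z\<in>carrier (obj C n). g (diff C n z) = diff D n (f z)"
      by (rule injective_module_factor[OF D.obj_injective C.C_module C.C_module C.diff_hom
            mod_hom_compose[OF fh D.diff_hom]]) (use f in \<open>auto simp: P_def\<close>)
    then obtain g where g: "g \<in> mod_hom R (obj C (Suc n)) (obj D (Suc n))"
      "\<And>z. z \<in> carrier (obj C n) \<Longrightarrow> g (diff C n z) = diff D n (f z)" by blast
    have "diff D (Suc n) (g z) = \<zero>\<^bsub>obj D (Suc (Suc n))\<^esub>"
      if z: "z \<in> carrier (obj C (Suc n))" "diff C (Suc n) z = \<zero>\<^bsub>obj C (Suc (Suc n))\<^esub>" for z
    proof -
      obtain w where w: "w \<in> carrier (obj C n)" "z = diff C n w" using C.exact_Suc[OF z(1)] z(2) by blast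
      show ?thesis using w g(2)[OF w(1)] D.d_d[OF mod_homD(1)[OF fh w(1)]] by simp
    qed
    then show "\<exists>g. P (Suc n) g \<and> (\<forall>z\<in>carrier (obj C n). g (diff C n z) = diff D n (f z))"
      unfolding P_def using g by blast
  qed
  then obtain \<phi> where P: "\<And>n. P n (\<phi> n)"
    and step: "\<And>n. \<forall>z\<in>carrier (obj C n). \<phi> (Suc n) (diff C n z) = diff D n (\<phi> n z)" by metis
  show ?thesis
    by (rule exI[of _ \<phi>], intro conjI allI step) (use P[unfolded P_def] P[of 0, unfolded P_def] in simp_all)
qed

definition \<phi> :: "nat \<Rightarrow> 'e \<Rightarrow> 'f" where
  "\<phi> = (SOME \<phi>. (\<forall>n. \<phi> n \<in> mod_hom R (obj C n) (obj D n))
     \<and> (\<forall>m\<in>carrier M. \<phi> 0 (\<epsilon> m) = \<eta> (xM +>\<^bsub>M\<^esub> m))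
     \<and> (\<forall>n. \<forall>z\<in>carrier (obj C n). \<phi> (Suc n) (diff C n z) = diff D n (\<phi> n z)))"

lemma \<phi>_hom: "\<phi> n \<in> mod_hom R (obj C n) (obj D n)"
  and \<phi>_aug: "m \<in> carrier M \<Longrightarrow> \<phi> 0 (\<epsilon> m) = \<eta> (xM +>\<^bsub>M\<^esub> m)"
  and \<phi>_diff: "z \<in> carrier (obj C n) \<Longrightarrow> \<phi> (Suc n) (diff C n z) = diff D n (\<phi> n z)"
  using someI_ex[OF ex_chain_map] unfolding \<phi>_def[symmetric] by blast+

lemmas \<phi>_simps [simp] = mod_homD[OF \<phi>_hom] mod_hom_zero[OF C.C_module D.C_module \<phi>_hom]
  mod_hom_neg[OF C.C_module D.C_module \<phi>_hom] mod_hom_minus[OF C.C_module D.C_module \<phi>_hom]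

text \<open>Multiplication by \<open>x\<close> is zero on \<open>M/xM\<close>, hence \<open>x \<phi>\<close> is null-homotopic.\<close>

lemma ex_homotopy:
  "\<exists>\<tau>. (\<forall>n. \<tau> n \<in> mod_hom R (obj C (Suc n)) (obj D n))
     \<and> (\<forall>z\<in>carrier (obj C 0). \<tau> 0 (diff C 0 z) = x \<odot>\<^bsub>obj D 0\<^esub> \<phi> 0 z)
     \<and> (\<forall>n. \<forall>z\<in>carrier (obj C (Suc n)). \<tau> (Suc n) (diff C (Suc n) z)
          = x \<odot>\<^bsub>obj D (Suc n)\<^esub> \<phi> (Suc n) z \<ominus>\<^bsub>obj D (Suc n)\<^esub> diff D n (\<tau> n z))"
proof -
  \<comment> \<open>By the last clause the difference of \<open>x \<phi>\<close> and
    \<open>diff D n\<close> after \<open>t\<close> vanishes on cocycles, so it factors through the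
    next differential.\<close>
  define P where "P n t \<longleftrightarrow> t \<in> mod_hom R (obj C (Suc n)) (obj D n)
      \<and> (n = 0 \<longrightarrow> (\<forall>z\<in>carrier (obj C 0). t (diff C 0 z) = x \<odot>\<^bsub>obj D 0\<^esub> \<phi> 0 z))
      \<and> (\<forall>z\<in>carrier (obj C (Suc n)). diff C (Suc n) z = \<zero>\<^bsub>obj C (Suc (Suc n))\<^esub> \<longrightarrow>
           x \<odot>\<^bsub>obj D (Suc n)\<^esub> \<phi> (Suc n) z = diff D n (t z))" for n t
  have "\<exists>\<tau>. \<forall>n. P n (\<tau> n) \<and> (\<forall>z\<in>carrier (obj C (Suc n)). \<tau> (Suc n) (diff C (Suc n) z)
          = x \<odot>\<^bsub>obj D (Suc n)\<^esub> \<phi> (Suc n) z \<ominus>\<^bsub>obj D (Suc n)\<^esub> diff D n (\<tau> n z))"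
  proof (rule dependent_nat_choice)
    have "\<exists>t\<in>mod_hom R (obj C (Suc 0)) (obj D 0).
        \<forall>z\<in>carrier (obj C 0). t (diff C 0 z) = x \<odot>\<^bsub>obj D 0\<^esub> \<phi> 0 z"
    proof (rule injective_module_factor[OF D.obj_injective C.C_module C.C_module C.diff_hom
          mod_hom_smult[OF C.C_module D.C_module \<phi>_hom x]])
      fix z assume z: "z \<in> carrier (obj C 0)" "diff C 0 z = \<zero>\<^bsub>obj C (Suc 0)\<^esub>"
      then obtain m where m: "m \<in> carrier M" "z = \<epsilon> m" using C.exact_0[OF z(1)] by blast
      have "x \<odot>\<^bsub>obj D 0\<^esub> \<phi> 0 z = \<phi> 0 (\<epsilon> (x \<odot>\<^bsub>M\<^esub> m))" using m x z(1) by (simp add: C.\<epsilon>_simps)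
      also have "\<dots> = \<zero>\<^bsub>obj D 0\<^esub>" using \<phi>_aug aug_zero_iff xM_I m(1) x by simp
      finally show "x \<odot>\<^bsub>obj D 0\<^esub> \<phi> 0 z = \<zero>\<^bsub>obj D 0\<^esub>" .
    qed
    then obtain t where t: "t \<in> mod_hom R (obj C (Suc 0)) (obj D 0)"
      "\<And>z. z \<in> carrier (obj C 0) \<Longrightarrow> t (diff C 0 z) = x \<odot>\<^bsub>obj D 0\<^esub> \<phi> 0 z" by blast
    have "x \<odot>\<^bsub>obj D (Suc 0)\<^esub> \<phi> (Suc 0) z = diff D 0 (t z)"
      if z: "z \<in> carrier (obj C (Suc 0))" "diff C (Suc 0) z = \<zero>\<^bsub>obj C (Suc (Suc 0))\<^esub>" for z
    proof -
      obtain w where w: "w \<in> carrier (obj C 0)" "z = diff C 0 w" using C.exact_Suc[OF z(1)] z(2) by blast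
      show ?thesis using w t(2)[OF w(1)] x by (simp add: \<phi>_diff)
    qed
    then show "\<exists>t. P 0 t" unfolding P_def using t by blast
  next
    fix t n assume t: "P n t"
    then have th: "t \<in> mod_hom R (obj C (Suc n)) (obj D n)" unfolding P_def by blast
    let ?v = "\<lambda>z. x \<odot>\<^bsub>obj D (Suc n)\<^esub> \<phi> (Suc n) z \<ominus>\<^bsub>obj D (Suc n)\<^esub> diff D n (t z)"
    have "\<exists>s\<in>mod_hom R (obj C (Suc (Suc n))) (obj D (Suc n)). \<forall>z\<in>carrier (obj C (Suc n)). s (diff C (Suc n) z) = ?v z"
    proof (rule injective_module_factor[OF D.obj_injective C.C_module C.C_module C.diff_hom
          mod_hom_diff[OF C.C_module D.C_module mod_hom_smult[OF C.C_module D.C_module \<phi>_hom x]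
            mod_hom_compose[OF th D.diff_hom]]])
      fix z assume z: "z \<in> carrier (obj C (Suc n))" "diff C (Suc n) z = \<zero>\<^bsub>obj C (Suc (Suc n))\<^esub>"
      then have "x \<odot>\<^bsub>obj D (Suc n)\<^esub> \<phi> (Suc n) z = diff D n (t z)" using t unfolding P_def by blast
      then show "?v z = \<zero>\<^bsub>obj D (Suc n)\<^esub>" using mod_homD(1)[OF th z(1)] by (simp add: D.Cm.M.minus_self)
    qed
    then obtain s where s: "s \<in> mod_hom R (obj C (Suc (Suc n))) (obj D (Suc n))"
      "\<And>z. z \<in> carrier (obj C (Suc n)) \<Longrightarrow> s (diff C (Suc n) z) = ?v z" by blast
    have "x \<odot>\<^bsub>obj D (Suc (Suc n))\<^esub> \<phi> (Suc (Suc n)) z = diff D (Suc n) (s z)"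
      if z: "z \<in> carrier (obj C (Suc (Suc n)))" "diff C (Suc (Suc n)) z = \<zero>\<^bsub>obj C (Suc (Suc (Suc n)))\<^esub>" for z
    proof -
      obtain w where w: "w \<in> carrier (obj C (Suc n))" "z = diff C (Suc n) w"
        using C.exact_Suc[OF z(1)] z(2) by blast
      show ?thesis
        using w s(2)[OF w(1)] x mod_homD(1)[OF th w(1)] by (simp add: \<phi>_diff D.d_d D.Cm.M.minus_zero_right)
    qed
    then show "\<exists>s. P (Suc n) s \<and> (\<forall>z\<in>carrier (obj C (Suc n)). s (diff C (Suc n) z) = ?v z)"
      unfolding P_def using s by blast
  qed
  then obtain \<tau> where P: "\<And>n. P n (\<tau> n)"
    and step: "\<And>n. \<forall>z\<in>carrier (obj C (Suc n)). \<tau> (Suc n) (diff C (Suc n) z)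
          = x \<odot>\<^bsub>obj D (Suc n)\<^esub> \<phi> (Suc n) z \<ominus>\<^bsub>obj D (Suc n)\<^esub> diff D n (\<tau> n z)" by metis
  show ?thesis
    by (rule exI[of _ \<tau>], intro conjI allI step) (use P[unfolded P_def] P[of 0, unfolded P_def] in simp_all)
qed

definition \<tau> :: "nat \<Rightarrow> 'e \<Rightarrow> 'f" where
  "\<tau> = (SOME \<tau>. (\<forall>n. \<tau> n \<in> mod_hom R (obj C (Suc n)) (obj D n))
     \<and> (\<forall>z\<in>carrier (obj C 0). \<tau> 0 (diff C 0 z) = x \<odot>\<^bsub>obj D 0\<^esub> \<phi> 0 z)
     \<and> (\<forall>n. \<forall>z\<in>carrier (obj C (Suc n)). \<tau> (Suc n) (diff C (Suc n) z)
          = x \<odot>\<^bsub>obj D (Suc n)\<^esub> \<phi> (Suc n) z \<ominus>\<^bsub>obj D (Suc n)\<^esub> diff D n (\<tau> n z)))"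

lemma \<tau>_hom: "\<tau> n \<in> mod_hom R (obj C (Suc n)) (obj D n)"
  and \<tau>_diff_0: "z \<in> carrier (obj C 0) \<Longrightarrow> \<tau> 0 (diff C 0 z) = x \<odot>\<^bsub>obj D 0\<^esub> \<phi> 0 z"
  and \<tau>_diff_Suc: "z \<in> carrier (obj C (Suc n)) \<Longrightarrow> \<tau> (Suc n) (diff C (Suc n) z)
          = x \<odot>\<^bsub>obj D (Suc n)\<^esub> \<phi> (Suc n) z \<ominus>\<^bsub>obj D (Suc n)\<^esub> diff D n (\<tau> n z)"
  using someI_ex[OF ex_homotopy] unfolding \<tau>_def[symmetric] by blast+

lemmas \<tau>_simps [simp] = mod_homD[OF \<tau>_hom] mod_hom_zero[OF C.C_module D.C_module \<tau>_hom]
  mod_hom_neg[OF C.C_module D.C_module \<tau>_hom] mod_hom_minus[OF C.C_module D.C_module \<tau>_hom]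

text \<open>The shifted companions, zero in degree zero, let the total complex and the homotopy
  relation be written uniformly in the degree.\<close>

definition \<phi>p :: "nat \<Rightarrow> 'e \<Rightarrow> 'f" where "\<phi>p = case_nat (\<lambda>_. \<zero>\<^bsub>obj D 0\<^esub>) \<phi>"
definition \<tau>p :: "nat \<Rightarrow> 'e \<Rightarrow> 'f" where "\<tau>p = case_nat (\<lambda>_. \<zero>\<^bsub>obj D 0\<^esub>) \<tau>"
definition ppobj :: "nat \<Rightarrow> ('a, 'f) module" where "ppobj = case_nat (zero_module (obj D 0)) D.pobj"
definition ppd :: "nat \<Rightarrow> 'f \<Rightarrow> 'f" where "ppd = case_nat (\<lambda>_. \<zero>\<^bsub>obj D 0\<^esub>) D.pd"

lemma p_simps [simp]:
  "\<phi>p 0 z = \<zero>\<^bsub>obj D 0\<^esub>" "\<phi>p (Suc n) = \<phi> n" "\<tau>p 0 z = \<zero>\<^bsub>obj D 0\<^esub>" "\<tau>p (Suc n) = \<tau> n"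
  "ppobj 0 = zero_module (obj D 0)" "ppobj (Suc n) = D.pobj n" "ppd 0 e = \<zero>\<^bsub>obj D 0\<^esub>" "ppd (Suc n) = D.pd n"
  by (simp_all add: \<phi>p_def \<tau>p_def ppobj_def ppd_def)

lemma ppobj_baer: "baer_module R (ppobj n)"
  by (cases n) (simp_all add: D.pobj_baer baer_zero_module[OF D.C_module])

lemma ppobj_module: "module R (ppobj n)"
  using ppobj_baer unfolding baer_module_def by blast

lemma \<phi>p_hom: "\<phi>p n \<in> mod_hom R (C.pobj n) (D.pobj n)"
  by (cases n) (auto simp: \<phi>_hom intro: mod_homI)

lemma \<tau>p_hom: "\<tau>p n \<in> mod_hom R (obj C n) (D.pobj n)"
  by (cases n) (auto simp: \<tau>_hom intro: mod_homI)

lemma ppd_hom: "ppd n \<in> mod_hom R (ppobj n) (D.pobj n)"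
  by (cases n) (auto simp: D.pd_hom intro: mod_homI)

lemma pd_ppd: "e \<in> carrier (ppobj n) \<Longrightarrow> D.pd n (ppd n e) = \<zero>\<^bsub>obj D n\<^esub>"
  by (cases n) (simp_all add: D.d_pd)

lemma \<phi>_pd: "z \<in> carrier (C.pobj n) \<Longrightarrow> \<phi> n (C.pd n z) = D.pd n (\<phi>p n z)"
  by (cases n) (simp_all add: \<phi>_diff)

lemma homotopy:
  assumes "z \<in> carrier (obj C n)"
  shows "\<tau> n (diff C n z) = x \<odot>\<^bsub>obj D n\<^esub> \<phi> n z \<ominus>\<^bsub>obj D n\<^esub> D.pd n (\<tau>p n z)"
  using assms x by (cases n) (simp_all add: \<tau>_diff_0 \<tau>_diff_Suc D.Cm.M.minus_zero_right)

end


section \<open>The total complex\<close>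

context abelian_group
begin

text \<open>The cancellation in the last component of \<open>Ld_Ld\<close>: \<open>a\<close> is
  \<open>x \<phi> c\<close>, and \<open>b\<close> and \<open>c\<close> are the differentials of
  \<open>\<tau>p n c\<close> and \<open>\<phi>p n c'\<close>.\<close>

lemma minus_minus_add:
  assumes "a \<in> carrier G" "b \<in> carrier G" "c \<in> carrier G"
  shows "((a \<ominus> b) \<ominus> (a \<ominus> c)) \<oplus> (b \<ominus> c) = \<zero>"
proof -
  have "((a \<ominus> b) \<ominus> (a \<ominus> c)) \<oplus> (b \<ominus> c) = (a \<oplus> (b \<oplus> c)) \<oplus> \<ominus> (a \<oplus> (b \<oplus> c))"
    using assms by (simp add: minus_eq minus_add a_ac)
  then show ?thesis using assms by (simp add: r_neg)
qed

lemma minus_minus_cancel: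
  assumes "a \<in> carrier G" "b \<in> carrier G"
  shows "a \<ominus> (a \<ominus> b) = b"
proof -
  have "a \<ominus> (a \<ominus> b) = b \<oplus> (a \<oplus> \<ominus> a)"
    using assms by (simp add: minus_eq minus_add a_ac)
  then show ?thesis using assms by (simp add: r_neg)
qed

lemma minus_add_distrib:
  assumes "a \<in> carrier G" "b \<in> carrier G" "a' \<in> carrier G" "b' \<in> carrier G"
  shows "(a \<oplus> a') \<ominus> (b \<oplus> b') = (a \<ominus> b) \<oplus> (a' \<ominus> b')"
  using assms by (simp add: minus_eq minus_add a_ac)

end

context quotient_resolutions
begin

definition Lobj :: "nat \<Rightarrow> ('a, 'e \<times> 'e \<times> 'f) module" where
  "Lobj n = mod_sum (obj C n) (mod_sum (C.pobj n) (ppobj n))"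

text \<open>The total complex of \<open>C \<rightarrow> C \<rightarrow> D\<close>, with maps \<open>x\<close> and \<open>\<phi>\<close> and the null-homotopy \<open>\<tau>\<close> of their
  composition; the two last terms are shifted by one and by two degrees.\<close>

definition Ld :: "nat \<Rightarrow> 'e \<times> 'e \<times> 'f \<Rightarrow> 'e \<times> 'e \<times> 'f" where
  "Ld n = (\<lambda>(c, c', e). (diff C n c, x \<odot>\<^bsub>obj C n\<^esub> c \<ominus>\<^bsub>obj C n\<^esub> C.pd n c',
     (\<tau>p n c \<ominus>\<^bsub>D.pobj n\<^esub> \<phi>p n c') \<oplus>\<^bsub>D.pobj n\<^esub> ppd n e))"

lemma Lobj_baer: "baer_module R (Lobj n)"
  unfolding Lobj_def by (intro baer_mod_sum C.C_baer C.pobj_baer ppobj_baer)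

lemma Lobj_simps [simp]:
  "carrier (Lobj n) = carrier (obj C n) \<times> carrier (C.pobj n) \<times> carrier (ppobj n)"
  "\<zero>\<^bsub>Lobj n\<^esub> = (\<zero>\<^bsub>obj C n\<^esub>, \<zero>\<^bsub>C.pobj n\<^esub>, \<zero>\<^bsub>ppobj n\<^esub>)"
  "(c, c', e) \<oplus>\<^bsub>Lobj n\<^esub> (c1, c1', e1) = (c \<oplus>\<^bsub>obj C n\<^esub> c1, c' \<oplus>\<^bsub>C.pobj n\<^esub> c1', e \<oplus>\<^bsub>ppobj n\<^esub> e1)"
  "r \<odot>\<^bsub>Lobj n\<^esub> (c, c', e) = (r \<odot>\<^bsub>obj C n\<^esub> c, r \<odot>\<^bsub>C.pobj n\<^esub> c', r \<odot>\<^bsub>ppobj n\<^esub> e)"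
  by (simp_all add: Lobj_def mod_sum_def)

lemma tors_Lobj: "tors R \<mm> (Lobj n) = C.\<Gamma> n \<times> tors R \<mm> (C.pobj n) \<times> tors R \<mm> (ppobj n)"
  unfolding Lobj_def
  by (simp add: C.tors_mod_sum C.C_module C.pobj_module ppobj_module mod_sum_module)

lemma Ld_hom: "Ld n \<in> mod_hom R (Lobj n) (Lobj (Suc n))"
proof -
  interpret P: module R "D.pobj n" by (rule D.pobj_module)
  note c = mod_homD[OF C.pd_hom[of n]] and h = mod_homD[OF \<phi>p_hom[of n]] mod_homD[OF \<tau>p_hom[of n]] mod_homD[OF ppd_hom[of n]]
  show ?thesis
  proof (rule mod_homI)
    fix z assume "z \<in> carrier (Lobj n)"
    then show "Ld n z \<in> carrier (Lobj (Suc n))" using c h x by (auto simp: Ld_def)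
  next
    fix z w assume "z \<in> carrier (Lobj n)" "w \<in> carrier (Lobj n)"
    then show "Ld n (z \<oplus>\<^bsub>Lobj n\<^esub> w) = Ld n z \<oplus>\<^bsub>Lobj (Suc n)\<^esub> Ld n w"
      using c h x
      by (auto simp: Ld_def C.Cm.smult_r_distr C.Cm.M.minus_add_distrib P.M.minus_add_distrib P.M.a_ac)
  next
    fix r z assume "r \<in> carrier R" "z \<in> carrier (Lobj n)"
    then show "Ld n (r \<odot>\<^bsub>Lobj n\<^esub> z) = r \<odot>\<^bsub>Lobj (Suc n)\<^esub> Ld n z"
      using c h x
      by (auto simp: Ld_def C.Cm.smult_minus_distr P.smult_minus_distr P.smult_r_distr
          C.Cm.smult_assoc1[symmetric] C.m_comm)
  qed
qed

lemma Ld_Ld: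
  assumes "z \<in> carrier (Lobj n)"
  shows "Ld (Suc n) (Ld n z) = \<zero>\<^bsub>Lobj (Suc (Suc n))\<^esub>"
proof -
  obtain c c' e where z: "z = (c, c', e)" "c \<in> carrier (obj C n)" "c' \<in> carrier (C.pobj n)" "e \<in> carrier (ppobj n)"
    using assms by auto
  interpret P: module R "D.pobj n" by (rule D.pobj_module)
  note pc = mod_homD(1)[OF C.pd_hom z(3)] mod_homD(1)[OF \<phi>p_hom z(3)] mod_homD(1)[OF \<tau>p_hom z(2)] mod_homD(1)[OF ppd_hom z(4)]
  note pdD = mod_homD[OF D.pd_hom[of n]] mod_hom_minus[OF D.pobj_module D.C_module D.pd_hom[of n]]
  have "x \<odot>\<^bsub>obj C (Suc n)\<^esub> diff C n c \<ominus>\<^bsub>obj C (Suc n)\<^esub> diff C n (x \<odot>\<^bsub>obj C n\<^esub> c \<ominus>\<^bsub>obj C n\<^esub> C.pd n c') = \<zero>\<^bsub>obj C (Suc n)\<^esub>"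
    using z pc x by (simp add: C.d_pd C.Cm.M.minus_zero_right C.Cm.M.minus_self)
  moreover have "(\<tau> n (diff C n c) \<ominus>\<^bsub>obj D n\<^esub> \<phi> n (x \<odot>\<^bsub>obj C n\<^esub> c \<ominus>\<^bsub>obj C n\<^esub> C.pd n c'))
      \<oplus>\<^bsub>obj D n\<^esub> D.pd n ((\<tau>p n c \<ominus>\<^bsub>D.pobj n\<^esub> \<phi>p n c') \<oplus>\<^bsub>D.pobj n\<^esub> ppd n e) = \<zero>\<^bsub>obj D n\<^esub>"
    using z pc x by (simp add: pdD homotopy pd_ppd \<phi>_pd D.Cm.M.minus_minus_add)
  ultimately show ?thesis using z C.d_d by (simp add: Ld_def)
qed

sublocale L: baer_complex R \<mm> Lobj Ld
  by (intro baer_complex.intro baer_complex_axioms.intro C.noeth_local_ring_axioms Lobj_baer Ld_hom Ld_Ld)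

text \<open>A chase from the first component to the last. Above the low degrees it uses the
  exactness of \<open>C\<close> and \<open>D\<close>. For \<open>n = 0\<close> it uses that the
  kernel of \<open>M -> M/xM\<close> is \<open>x M\<close>, for \<open>n = 1\<close> that this map
  is surjective.\<close>

lemma Ld_exact_aux:
  assumes c: "c \<in> carrier (obj C (Suc n))" "c' \<in> carrier (obj C n)" "e \<in> carrier (D.pobj n)"
    and dc: "diff C (Suc n) c = \<zero>\<^bsub>obj C (Suc (Suc n))\<^esub>"
    and dc': "x \<odot>\<^bsub>obj C (Suc n)\<^esub> c \<ominus>\<^bsub>obj C (Suc n)\<^esub> diff C n c' = \<zero>\<^bsub>obj C (Suc n)\<^esub>"
    and de: "(\<tau> n c \<ominus>\<^bsub>obj D n\<^esub> \<phi> n c') \<oplus>\<^bsub>obj D n\<^esub> D.pd n e = \<zero>\<^bsub>obj D n\<^esub>"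
  shows "\<exists>c1\<in>carrier (obj C n). \<exists>c1'\<in>carrier (C.pobj n). \<exists>e1\<in>carrier (ppobj n).
    c = diff C n c1 \<and> c' = x \<odot>\<^bsub>obj C n\<^esub> c1 \<ominus>\<^bsub>obj C n\<^esub> C.pd n c1'
    \<and> e = (\<tau>p n c1 \<ominus>\<^bsub>D.pobj n\<^esub> \<phi>p n c1') \<oplus>\<^bsub>D.pobj n\<^esub> ppd n e1"
proof -
  interpret P: module R "D.pobj n" by (rule D.pobj_module)
  note pdD = mod_homD[OF D.pd_hom[of n]] mod_hom_minus[OF D.pobj_module D.C_module D.pd_hom[of n]]
  obtain c1 where c1: "c1 \<in> carrier (obj C n)" "c = diff C n c1" using C.exact_Suc[OF c(1)] dc by blast
  note t1 = mod_homD(1)[OF \<tau>p_hom c1(1)]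
  \<comment> \<open>The defect left in the second component by the choice of \<open>c1\<close>; it
    is a cocycle. \<open>f\<close> below is the defect in the third component, and
    \<open>\<phi> n y = D.pd n f\<close> ties the two together.\<close>
  define y where "y = x \<odot>\<^bsub>obj C n\<^esub> c1 \<ominus>\<^bsub>obj C n\<^esub> c'"
  have y: "y \<in> carrier (obj C n)" unfolding y_def using x c1 c by simp
  have dy: "diff C n y = \<zero>\<^bsub>obj C (Suc n)\<^esub>" unfolding y_def using x c1 c dc' by simp
  have c'y: "c' = x \<odot>\<^bsub>obj C n\<^esub> c1 \<ominus>\<^bsub>obj C n\<^esub> y"
    unfolding y_def using x c1 c by (simp add: C.Cm.M.minus_minus_cancel)
  define f where "f = \<tau>p n c1 \<ominus>\<^bsub>D.pobj n\<^esub> e"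
  have f: "f \<in> carrier (D.pobj n)" unfolding f_def using t1 c by simp
  have ef: "e = \<tau>p n c1 \<ominus>\<^bsub>D.pobj n\<^esub> f" unfolding f_def using t1 c by (simp add: P.M.minus_minus_cancel)
  have "\<phi> n y \<ominus>\<^bsub>obj D n\<^esub> D.pd n f
      = ((x \<odot>\<^bsub>obj D n\<^esub> \<phi> n c1 \<ominus>\<^bsub>obj D n\<^esub> D.pd n (\<tau>p n c1)) \<ominus>\<^bsub>obj D n\<^esub> \<phi> n c') \<oplus>\<^bsub>obj D n\<^esub> D.pd n e"
    unfolding y_def f_def using x c1 c t1
    by (simp add: pdD D.Cm.M.minus_eq D.Cm.M.minus_add D.Cm.M.a_ac)
  also have "\<dots> = \<zero>\<^bsub>obj D n\<^esub>" using de c1 by (simp add: homotopy)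
  finally have \<phi>y: "\<phi> n y = D.pd n f"
    by (rule D.Cm.M.minus_eq_zeroD[OF mod_homD(1)[OF \<phi>_hom y] mod_homD(1)[OF D.pd_hom f]])
  show ?thesis
  proof (cases n)
    case 0
    \<comment> \<open>There are no lower terms to absorb \<open>y\<close>, but
      \<open>\<phi> 0 y = 0\<close> puts \<open>m\<close> into \<open>x M\<close>. With
      \<open>m = x m'\<close>, replacing \<open>c1\<close> by \<open>c1 - \<epsilon> m'\<close>
      removes the defect and keeps \<open>diff C 0 c1\<close>.\<close>
    obtain m where m: "m \<in> carrier M" "y = \<epsilon> m" using C.exact_0[of y] y dy 0 by auto
    have "\<eta> (xM +>\<^bsub>M\<^esub> m) = \<zero>\<^bsub>obj D 0\<^esub>" using \<phi>y \<phi>_aug[OF m(1)] m(2) 0 by simp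
    then have "m \<in> xM" using aug_zero_iff m(1) by blast
    then obtain m' where m': "m' \<in> carrier M" "m = x \<odot>\<^bsub>M\<^esub> m'" unfolding mod_smult_image_def by blast
    have em: "\<epsilon> m' \<in> carrier (obj C 0)" "y = x \<odot>\<^bsub>obj C 0\<^esub> \<epsilon> m'" "diff C 0 (\<epsilon> m') = \<zero>\<^bsub>obj C (Suc 0)\<^esub>"
      using m m' x C.\<epsilon>_simps C.exact_0[of "\<epsilon> m'"] by auto
    let ?c1 = "c1 \<ominus>\<^bsub>obj C 0\<^esub> \<epsilon> m'"
    have "c = diff C 0 ?c1" using c1 em 0 by (simp add: C.Cm.M.minus_zero_right)
    moreover have "c' = x \<odot>\<^bsub>obj C 0\<^esub> ?c1 \<ominus>\<^bsub>obj C 0\<^esub> C.pd 0 \<zero>\<^bsub>obj C 0\<^esub>"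
      using c'y c1 em x 0 by (simp add: C.Cm.smult_minus_distr C.Cm.M.minus_zero_right)
    moreover have "(\<tau>p n ?c1 \<ominus>\<^bsub>D.pobj n\<^esub> \<phi>p n \<zero>\<^bsub>obj C 0\<^esub>) \<oplus>\<^bsub>D.pobj n\<^esub> ppd n \<zero>\<^bsub>obj D 0\<^esub> \<in> carrier (D.pobj n)"
      using 0 P.M.zero_closed P.M.minus_closed P.M.a_closed by simp
    then have "e = (\<tau>p 0 ?c1 \<ominus>\<^bsub>D.pobj 0\<^esub> \<phi>p 0 \<zero>\<^bsub>obj C 0\<^esub>) \<oplus>\<^bsub>D.pobj 0\<^esub> ppd 0 \<zero>\<^bsub>obj D 0\<^esub>"
      using c(3) 0 by simp
    ultimately show ?thesis using 0 c1(1) em(1)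
      by (intro bexI[of _ ?c1] bexI[of _ "\<zero>\<^bsub>obj C 0\<^esub>"] bexI[of _ "\<zero>\<^bsub>obj D 0\<^esub>"]) auto
  next
    case (Suc k)
    obtain w where w: "w \<in> carrier (obj C k)" "y = diff C k w" using C.exact_Suc[of y k] y dy Suc by auto
    have fc: "f \<in> carrier (obj D k)" "e = \<tau> k c1 \<ominus>\<^bsub>obj D k\<^esub> f" using f ef Suc by simp_all
    have c1k: "c1 \<in> carrier (obj C (Suc k))" using c1 Suc by simp
    \<comment> \<open>What remains of \<open>f\<close> after the choice of \<open>w\<close> is a
      cocycle of \<open>D\<close>.\<close>
    define g where "g = f \<ominus>\<^bsub>obj D k\<^esub> \<phi> k w"
    have g: "g \<in> carrier (obj D k)" unfolding g_def using fc w by simp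
    have fg: "f = \<phi> k w \<oplus>\<^bsub>obj D k\<^esub> g"
      unfolding g_def using fc w by (simp add: D.Cm.M.minus_add_cancel D.Cm.M.a_comm[of "\<phi> k w"])
    have dg: "diff D k g = \<zero>\<^bsub>obj D (Suc k)\<^esub>"
      using \<phi>y Suc fc w unfolding g_def by (simp add: \<phi>_diff D.Cm.M.minus_self)
    have "\<exists>w1\<in>carrier (obj C k). \<exists>e1\<in>carrier (D.pobj k). y = diff C k w1
        \<and> e = (\<tau> k c1 \<ominus>\<^bsub>obj D k\<^esub> \<phi> k w1) \<oplus>\<^bsub>obj D k\<^esub> D.pd k e1"
    proof (cases k)
      case 0
      \<comment> \<open>The cocycle \<open>g\<close> comes from M/xM and so from \<open>M\<close>;
        adding \<open>\<epsilon> m\<close> to \<open>w\<close> absorbs it without changing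
        \<open>diff C 0 w\<close>.\<close>
      obtain m where m: "m \<in> carrier M" "g = \<phi> 0 (\<epsilon> m)" using aug_surj[of g] \<phi>_aug g dg 0 by auto
      have em: "\<epsilon> m \<in> carrier (obj C 0)" "diff C 0 (\<epsilon> m) = \<zero>\<^bsub>obj C (Suc 0)\<^esub>"
        using m C.\<epsilon>_simps(1) C.exact_0[of "\<epsilon> m"] by auto
      let ?w = "w \<oplus>\<^bsub>obj C 0\<^esub> \<epsilon> m"
      have wc: "?w \<in> carrier (obj C 0)" using w em 0 by simp
      have yw: "y = diff C 0 ?w" using w em 0 by simp
      have "e = \<tau> 0 c1 \<ominus>\<^bsub>obj D 0\<^esub> \<phi> 0 ?w" using fc fg m em w 0 by simp
      also have "\<dots> = (\<tau> 0 c1 \<ominus>\<^bsub>obj D 0\<^esub> \<phi> 0 ?w) \<oplus>\<^bsub>obj D 0\<^esub> D.pd 0 \<zero>\<^bsub>obj D 0\<^esub>"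
        using c1k wc 0 by (simp del: \<phi>_simps(2))
      finally have "e = (\<tau> 0 c1 \<ominus>\<^bsub>obj D 0\<^esub> \<phi> 0 ?w) \<oplus>\<^bsub>obj D 0\<^esub> D.pd 0 \<zero>\<^bsub>obj D 0\<^esub>" .
      moreover have "\<zero>\<^bsub>obj D 0\<^esub> \<in> carrier (D.pobj 0)" by simp
      ultimately show ?thesis unfolding 0 using wc yw by blast
    next
      case (Suc j)
      obtain h where h: "h \<in> carrier (obj D j)" "g = diff D j h" using D.exact_Suc[of g j] g dg Suc by auto
      have "e = (\<tau> k c1 \<ominus>\<^bsub>obj D k\<^esub> \<phi> k w) \<oplus>\<^bsub>obj D k\<^esub> \<ominus>\<^bsub>obj D k\<^esub> g"
        using fc(2) c1k w g unfolding fg by (simp add: D.Cm.M.minus_eq D.Cm.M.minus_add D.Cm.M.a_assoc)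
      then show ?thesis using h w Suc
        by (intro bexI[of _ w] bexI[of _ "\<ominus>\<^bsub>obj D j\<^esub> h"]) auto
    qed
    then show ?thesis using c1 c'y Suc by auto
  qed
qed

lemma Ld_exact:
  assumes z: "z \<in> carrier (Lobj (Suc n))" "Ld (Suc n) z = \<zero>\<^bsub>Lobj (Suc (Suc n))\<^esub>"
  shows "\<exists>w\<in>carrier (Lobj n). z = Ld n w"
proof -
  obtain c c' e where ce: "z = (c, c', e)" "c \<in> carrier (obj C (Suc n))" "c' \<in> carrier (obj C n)" "e \<in> carrier (D.pobj n)"
    using z(1) by auto
  obtain c1 c1' e1 where "c1 \<in> carrier (obj C n)" "c1' \<in> carrier (C.pobj n)" "e1 \<in> carrier (ppobj n)"
    "c = diff C n c1" "c' = x \<odot>\<^bsub>obj C n\<^esub> c1 \<ominus>\<^bsub>obj C n\<^esub> C.pd n c1'"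
    "e = (\<tau>p n c1 \<ominus>\<^bsub>D.pobj n\<^esub> \<phi>p n c1') \<oplus>\<^bsub>D.pobj n\<^esub> ppd n e1"
    using Ld_exact_aux[OF ce(2-4)] z(2) unfolding ce(1) by (auto simp: Ld_def)
  then show ?thesis using ce(1) by (intro bexI[of _ "(c1, c1', e1)"]) (auto simp: Ld_def)
qed

end

locale torsion_annihilator = quotient_resolutions R \<mm> M \<epsilon> C x \<eta> D
  for R (structure) and \<mm> and M :: "('a, 'm) module" and \<epsilon> :: "'m \<Rightarrow> 'e"
    and C :: "('a, 'e) cochain_complex" and x and \<eta> :: "'m set \<Rightarrow> 'f"
    and D :: "('a, 'f) cochain_complex" +
  assumes annihilator_torsion: "u \<in> carrier M \<Longrightarrow> x \<odot>\<^bsub>M\<^esub> u = \<zero>\<^bsub>M\<^esub> \<Longrightarrow> u \<in> tors R \<mm> M"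
begin

text \<open>A degree-zero cocycle is \<open>\<epsilon> m\<close> with \<open>x m = 0\<close>. This
  is the only place where the torsion of the annihilator of \<open>x\<close> enters.\<close>

lemma Ld_kernel_0:
  assumes z: "z \<in> carrier (Lobj 0)" "Ld 0 z = \<zero>\<^bsub>Lobj (Suc 0)\<^esub>"
  shows "z \<in> tors R \<mm> (Lobj 0)"
proof -
  obtain c where c: "z = (c, \<zero>\<^bsub>obj C 0\<^esub>, \<zero>\<^bsub>obj D 0\<^esub>)" "c \<in> carrier (obj C 0)" using z(1) by auto
  have dc: "diff C 0 c = \<zero>\<^bsub>obj C (Suc 0)\<^esub>" and xc: "x \<odot>\<^bsub>obj C 0\<^esub> c = \<zero>\<^bsub>obj C 0\<^esub>"
    using z(2) c x by (auto simp: Ld_def C.Cm.M.minus_zero_right)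
  obtain m where m: "m \<in> carrier M" "c = \<epsilon> m" using C.exact_0[OF c(2)] dc by blast
  have "\<epsilon> (x \<odot>\<^bsub>M\<^esub> m) = \<epsilon> \<zero>\<^bsub>M\<^esub>" using xc m x by (simp add: C.\<epsilon>_simps)
  then have "x \<odot>\<^bsub>M\<^esub> m = \<zero>\<^bsub>M\<^esub>" using C.\<epsilon>_inj m x C.M.M.zero_closed C.M.smult_closed by (metis inj_onD)
  then have "c \<in> C.\<Gamma> 0" using annihilator_torsion C.\<epsilon>_tors m by blast
  moreover have "\<zero>\<^bsub>E\<^esub> \<in> tors R \<mm> (zero_module E)" if "module R E" for E :: "('a, 'g) module"
  proof -
    interpret E: module R E by fact
    show ?thesis using C.mm_carrier by (auto simp: tors_def)
  qed
  then have "\<zero>\<^bsub>obj C 0\<^esub> \<in> tors R \<mm> (C.pobj 0)" "\<zero>\<^bsub>obj D 0\<^esub> \<in> tors R \<mm> (ppobj 0)"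
    using C.C_module[of 0] D.C_module[of 0] C.mm_carrier by (auto simp: tors_def)
  ultimately show ?thesis unfolding tors_Lobj c(1) by simp
qed

lemma L_torsion_exact:
  assumes "z \<in> tors R \<mm> (Lobj (Suc n))" "Ld (Suc n) z = \<zero>\<^bsub>Lobj (Suc (Suc n))\<^esub>"
  shows "\<exists>w\<in>tors R \<mm> (Lobj n). z = Ld n w"
  using L.torsion_exact[OF Ld_kernel_0 Ld_exact assms] .

text \<open>The pairs \<open>(v, c')\<close> with \<open>v\<close> a cocycle and
  \<open>d c' = x v\<close> are the cocycles of the mapping cone of \<open>x\<close> on the torsion
  complex. Exactness of the torsion of \<open>L\<close> says that
  \<open>(v, c') |-> \<tau> v - \<phi> c'\<close> identifies the cohomology of the cone with that of
  \<open>D\<close>. This is the injectivity.\<close>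

lemma connecting_injective:
  assumes v: "v \<in> C.tcyc (Suc i)" and c': "c' \<in> C.\<Gamma> i" and dc': "diff C i c' = x \<odot>\<^bsub>obj C (Suc i)\<^esub> v"
    and b: "\<tau> i v \<ominus>\<^bsub>obj D i\<^esub> \<phi> i c' \<in> D.tbnd i"
  shows "\<exists>w\<in>C.\<Gamma> i. v = diff C i w \<and> c' \<ominus>\<^bsub>obj C i\<^esub> x \<odot>\<^bsub>obj C i\<^esub> w \<in> C.tbnd i"
proof -
  obtain e where e: "e \<in> tors R \<mm> (D.pobj i)" "\<tau> i v \<ominus>\<^bsub>obj D i\<^esub> \<phi> i c' = D.pd i e"
    using b unfolding D.tbnd_pd by blast
  interpret P: module R "D.pobj i" by (rule D.pobj_module)
  note T = P.submoduleD[OF C.tors_submodule[OF D.pobj_module]]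
  have vc: "v \<in> C.\<Gamma> (Suc i)" "diff C (Suc i) v = \<zero>\<^bsub>obj C (Suc (Suc i))\<^esub>" "v \<in> carrier (obj C (Suc i))"
    using v C.\<Gamma>_D(1) unfolding C.tcyc_def by auto
  have cc: "c' \<in> carrier (obj C i)" using c' C.\<Gamma>_D(1) by blast
  have ec: "e \<in> carrier (D.pobj i)" using T(1) e(1) by blast
  \<comment> \<open>The third entry cancels the coboundary \<open>\<tau> v - \<phi> c'\<close>, so
    the triple is a cocycle of \<open>L\<close>.\<close>
  let ?z = "(v, c', \<ominus>\<^bsub>D.pobj i\<^esub> e)"
  have "?z \<in> tors R \<mm> (Lobj (Suc i))" unfolding tors_Lobj using vc c' T(5)[OF e(1)] by simp
  moreover have "Ld (Suc i) ?z = \<zero>\<^bsub>Lobj (Suc (Suc i))\<^esub>"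
    using vc x dc' e ec mod_homD(1)[OF D.pd_hom ec]
    by (simp add: Ld_def C.Cm.M.minus_self D.Cm.M.r_neg mod_hom_neg[OF D.pobj_module D.C_module D.pd_hom])
  ultimately obtain w where w: "w \<in> tors R \<mm> (Lobj i)" "?z = Ld i w" using L_torsion_exact by blast
  obtain c1 c1' e1 where ce: "w = (c1, c1', e1)" "c1 \<in> C.\<Gamma> i" "c1' \<in> tors R \<mm> (C.pobj i)"
    using w(1) unfolding tors_Lobj by auto
  have c1: "c1 \<in> carrier (obj C i)" "c1' \<in> carrier (C.pobj i)" using ce(2,3) unfolding tors_def by auto
  have pb: "C.pd i c1' \<in> C.tbnd i" unfolding C.tbnd_pd using ce(3) by blast
  note pc = mod_homD(1)[OF C.pd_hom c1(2)]
  have eq: "v = diff C i c1" "c' = x \<odot>\<^bsub>obj C i\<^esub> c1 \<ominus>\<^bsub>obj C i\<^esub> C.pd i c1'"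
    using w(2) unfolding ce(1) Ld_def by auto
  have "c' \<ominus>\<^bsub>obj C i\<^esub> x \<odot>\<^bsub>obj C i\<^esub> c1
      = \<ominus>\<^bsub>obj C i\<^esub> C.pd i c1' \<oplus>\<^bsub>obj C i\<^esub> (x \<odot>\<^bsub>obj C i\<^esub> c1 \<oplus>\<^bsub>obj C i\<^esub> \<ominus>\<^bsub>obj C i\<^esub> (x \<odot>\<^bsub>obj C i\<^esub> c1))"
    unfolding eq(2) using x c1 pc by (simp add: C.Cm.M.minus_eq C.Cm.M.a_ac)
  then have "c' \<ominus>\<^bsub>obj C i\<^esub> x \<odot>\<^bsub>obj C i\<^esub> c1 = \<ominus>\<^bsub>obj C i\<^esub> C.pd i c1'"
    using x c1 pc by (simp add: C.Cm.M.r_neg)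
  then show ?thesis using eq(1) ce(2) C.tbnd_D(5)[OF pb] by auto
qed

text \<open>A cocycle of \<open>D\<close>, placed two degrees up in the third component, is a
  cocycle of \<open>L\<close>. Its preimage under \<open>Ld\<close> provides the pair
  \<open>(v, c')\<close>.\<close>

lemma connecting_surjective:
  assumes u: "u \<in> D.tcyc i"
  shows "\<exists>v\<in>C.tcyc (Suc i). \<exists>c'\<in>C.\<Gamma> i. diff C i c' = x \<odot>\<^bsub>obj C (Suc i)\<^esub> v
     \<and> u \<ominus>\<^bsub>obj D i\<^esub> (\<tau> i v \<ominus>\<^bsub>obj D i\<^esub> \<phi> i c') \<in> D.tbnd i"
proof -
  have uc: "u \<in> D.\<Gamma> i" "diff D i u = \<zero>\<^bsub>obj D (Suc i)\<^esub>" "u \<in> carrier (obj D i)"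
    using u D.\<Gamma>_D(1) unfolding D.tcyc_def by auto
  let ?z = "(\<zero>\<^bsub>obj C (Suc (Suc i))\<^esub>, \<zero>\<^bsub>obj C (Suc i)\<^esub>, u)"
  have "?z \<in> tors R \<mm> (Lobj (Suc (Suc i)))" unfolding tors_Lobj using uc C.\<Gamma>_D(2) by simp
  moreover have "Ld (Suc (Suc i)) ?z = \<zero>\<^bsub>Lobj (Suc (Suc (Suc i)))\<^esub>"
    using uc x by (simp add: Ld_def C.Cm.M.minus_self D.Cm.M.minus_self)
  ultimately obtain w where w: "w \<in> tors R \<mm> (Lobj (Suc i))" "?z = Ld (Suc i) w" using L_torsion_exact by blast
  obtain v c' e where ce: "w = (v, c', e)" "v \<in> C.\<Gamma> (Suc i)" "c' \<in> C.\<Gamma> i" "e \<in> tors R \<mm> (D.pobj i)"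
    using w(1) unfolding tors_Lobj by auto
  have c: "v \<in> carrier (obj C (Suc i))" "c' \<in> carrier (obj C i)" "e \<in> carrier (D.pobj i)"
    using ce unfolding tors_def by auto
  have eq: "diff C (Suc i) v = \<zero>\<^bsub>obj C (Suc (Suc i))\<^esub>"
    "x \<odot>\<^bsub>obj C (Suc i)\<^esub> v \<ominus>\<^bsub>obj C (Suc i)\<^esub> diff C i c' = \<zero>\<^bsub>obj C (Suc i)\<^esub>"
    "u = (\<tau> i v \<ominus>\<^bsub>obj D i\<^esub> \<phi> i c') \<oplus>\<^bsub>obj D i\<^esub> D.pd i e"
    using w(2) unfolding ce(1) Ld_def by auto
  have "diff C i c' = x \<odot>\<^bsub>obj C (Suc i)\<^esub> v"
    using C.Cm.M.minus_eq_zeroD[OF _ _ eq(2)] x c by simp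
  moreover have "u \<ominus>\<^bsub>obj D i\<^esub> (\<tau> i v \<ominus>\<^bsub>obj D i\<^esub> \<phi> i c') = D.pd i e"
  proof -
    let ?s = "\<tau> i v \<ominus>\<^bsub>obj D i\<^esub> \<phi> i c'"
    have s: "?s \<in> carrier (obj D i)" and p: "D.pd i e \<in> carrier (obj D i)"
      using c mod_homD(1)[OF D.pd_hom c(3)] by simp_all
    have "(?s \<oplus>\<^bsub>obj D i\<^esub> D.pd i e) \<ominus>\<^bsub>obj D i\<^esub> ?s = D.pd i e \<oplus>\<^bsub>obj D i\<^esub> (?s \<oplus>\<^bsub>obj D i\<^esub> \<ominus>\<^bsub>obj D i\<^esub> ?s)"
      using s p by (simp only: D.Cm.M.minus_eq D.Cm.M.a_ac D.Cm.M.a_closed D.Cm.M.a_inv_closed)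
    then show ?thesis using eq(3) s p by (simp add: D.Cm.M.r_neg)
  qed
  ultimately show ?thesis using eq(1) ce unfolding C.tcyc_def D.tbnd_pd by blast
qed

end


section \<open>The splitting\<close>

context baer_complex
begin

text \<open>The representatives of the part of \<open>H n\<close> killed by \<open>I\<close>, see
  \<open>carrier_zero_colon_H\<close>.\<close>

definition ker_colon :: "'a set \<Rightarrow> nat \<Rightarrow> 'e set" where
  "ker_colon I n = {v \<in> tcyc n. \<forall>b\<in>I. b \<odot>\<^bsub>C n\<^esub> v \<in> tbnd n}"

text \<open>A linear choice \<open>Y\<close> of elements \<open>y\<close> with \<open>d y = t v\<close>, for the cocycles \<open>v\<close> whose class is
  killed by \<open>I\<close>; it is unique modulo coboundaries if \<open>v\<close> is a coboundary.\<close>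

definition lifts :: "'a set \<Rightarrow> nat \<Rightarrow> 'a \<Rightarrow> ('e \<times> 'e) set \<Rightarrow> bool" where
  "lifts I n t Y \<longleftrightarrow>
     (\<forall>v y. (v, y) \<in> Y \<longrightarrow> v \<in> ker_colon I (Suc n) \<and> y \<in> \<Gamma> n \<and> d n y = t \<odot>\<^bsub>C (Suc n)\<^esub> v) \<and>
     (\<forall>v y v' y'. (v, y) \<in> Y \<longrightarrow> (v', y') \<in> Y \<longrightarrow> (v \<oplus>\<^bsub>C (Suc n)\<^esub> v', y \<oplus>\<^bsub>C n\<^esub> y') \<in> Y) \<and>
     (\<forall>r\<in>carrier R. \<forall>v y. (v, y) \<in> Y \<longrightarrow> (r \<odot>\<^bsub>C (Suc n)\<^esub> v, r \<odot>\<^bsub>C n\<^esub> y) \<in> Y) \<and>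
     (\<forall>v\<in>ker_colon I (Suc n). \<exists>y. (v, y) \<in> Y) \<and>
     (\<forall>w\<in>\<Gamma> n. \<forall>y. (d n w, y) \<in> Y \<longrightarrow> y \<ominus>\<^bsub>C n\<^esub> t \<odot>\<^bsub>C n\<^esub> w \<in> tbnd n)"

lemma liftsD:
  assumes "lifts I n t Y"
  shows "(v, y) \<in> Y \<Longrightarrow> v \<in> ker_colon I (Suc n) \<and> y \<in> \<Gamma> n \<and> d n y = t \<odot>\<^bsub>C (Suc n)\<^esub> v"
    and "(v, y) \<in> Y \<Longrightarrow> (v', y') \<in> Y \<Longrightarrow> (v \<oplus>\<^bsub>C (Suc n)\<^esub> v', y \<oplus>\<^bsub>C n\<^esub> y') \<in> Y"
    and "r \<in> carrier R \<Longrightarrow> (v, y) \<in> Y \<Longrightarrow> (r \<odot>\<^bsub>C (Suc n)\<^esub> v, r \<odot>\<^bsub>C n\<^esub> y) \<in> Y"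
    and "v \<in> ker_colon I (Suc n) \<Longrightarrow> \<exists>y. (v, y) \<in> Y"
    and "w \<in> \<Gamma> n \<Longrightarrow> (d n w, y) \<in> Y \<Longrightarrow> y \<ominus>\<^bsub>C n\<^esub> t \<odot>\<^bsub>C n\<^esub> w \<in> tbnd n"
  using assms unfolding lifts_def by simp_all

lemma ker_colon_submodule:
  assumes "I \<subseteq> carrier R"
  shows "submodule (ker_colon I n) R (C n)"
proof -
  have sw: "b \<odot>\<^bsub>C n\<^esub> (r \<odot>\<^bsub>C n\<^esub> v) = r \<odot>\<^bsub>C n\<^esub> (b \<odot>\<^bsub>C n\<^esub> v)"
    if "b \<in> I" "r \<in> carrier R" "v \<in> tcyc n" for b r v
  proof -
    have "b \<in> carrier R" "v \<in> carrier (C n)" using that assms tcyc_D(1) by auto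
    then show ?thesis using that(2) by (simp add: Cm.smult_assoc1[symmetric] m_comm)
  qed
  have ad: "b \<odot>\<^bsub>C n\<^esub> (v \<oplus>\<^bsub>C n\<^esub> w) = b \<odot>\<^bsub>C n\<^esub> v \<oplus>\<^bsub>C n\<^esub> b \<odot>\<^bsub>C n\<^esub> w"
    if "b \<in> I" "v \<in> tcyc n" "w \<in> tcyc n" for b v w
    by (rule Cm.smult_r_distr) (use that assms tcyc_D(1) in auto)
  have z: "b \<odot>\<^bsub>C n\<^esub> \<zero>\<^bsub>C n\<^esub> \<in> tbnd n" if "b \<in> I" for b
    using that assms tbnd_D(2) by (auto simp: subset_eq)
  show ?thesis
    unfolding Cm.submodule_crit ker_colon_def
    using tcyc_D tbnd_D(2-4) by (auto simp: sw ad z)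
qed

lemma lifts_prod:
  assumes kill: "\<And>a z. a \<in> I \<Longrightarrow> z \<in> tcyc n \<Longrightarrow> a \<odot>\<^bsub>C n\<^esub> z \<in> tbnd n"
    and a: "a \<in> I" and b: "b \<in> I" and I: "I \<subseteq> carrier R"
  shows "\<exists>Y. lifts I n (a \<otimes> b) Y"
proof
  have aR: "a \<in> carrier R" and bR: "b \<in> carrier R" using a b I by auto
  note K = Cm.submoduleD[OF ker_colon_submodule[OF I]]
  let ?Y = "{(v, a \<odot>\<^bsub>C n\<^esub> y) | v y. v \<in> ker_colon I (Suc n) \<and> y \<in> \<Gamma> n \<and> d n y = b \<odot>\<^bsub>C (Suc n)\<^esub> v}"
  have YI: "(v, y') \<in> ?Y" if "y' = a \<odot>\<^bsub>C n\<^esub> y" "v \<in> ker_colon I (Suc n)" "y \<in> \<Gamma> n" "d n y = b \<odot>\<^bsub>C (Suc n)\<^esub> v" for v y y'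
    using that by blast
  note Gc = \<Gamma>_D(1)
  show "lifts I n (a \<otimes> b) ?Y"
    unfolding lifts_def
  proof (intro conjI allI impI ballI)
    fix v y assume "(v, y) \<in> ?Y"
    then obtain y' where y': "y = a \<odot>\<^bsub>C n\<^esub> y'" "v \<in> ker_colon I (Suc n)" "y' \<in> \<Gamma> n" "d n y' = b \<odot>\<^bsub>C (Suc n)\<^esub> v" by blast
    show "v \<in> ker_colon I (Suc n)" "y \<in> \<Gamma> n" using y' aR \<Gamma>_D(4) by auto
    show "d n y = (a \<otimes> b) \<odot>\<^bsub>C (Suc n)\<^esub> v"
      using y' aR bR Gc[OF y'(3)] K(1)[OF y'(2)] by (simp add: Cm.smult_assoc1)
  next
    fix v y v1 y1 assume "(v, y) \<in> ?Y" "(v1, y1) \<in> ?Y"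
    then obtain y' y1' where y': "y = a \<odot>\<^bsub>C n\<^esub> y'" "v \<in> ker_colon I (Suc n)" "y' \<in> \<Gamma> n" "d n y' = b \<odot>\<^bsub>C (Suc n)\<^esub> v"
      "y1 = a \<odot>\<^bsub>C n\<^esub> y1'" "v1 \<in> ker_colon I (Suc n)" "y1' \<in> \<Gamma> n" "d n y1' = b \<odot>\<^bsub>C (Suc n)\<^esub> v1" by blast
    note c = Gc[OF y'(3)] Gc[OF y'(7)] K(1)[OF y'(2)] K(1)[OF y'(6)]
    show "(v \<oplus>\<^bsub>C (Suc n)\<^esub> v1, y \<oplus>\<^bsub>C n\<^esub> y1) \<in> ?Y"
      by (rule YI[of _ "y' \<oplus>\<^bsub>C n\<^esub> y1'"]) (use y' c aR bR K(3) \<Gamma>_D(3) in \<open>simp_all add: Cm.smult_r_distr\<close>)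
  next
    fix r v y assume r: "r \<in> carrier R" and "(v, y) \<in> ?Y"
    then obtain y' where y': "y = a \<odot>\<^bsub>C n\<^esub> y'" "v \<in> ker_colon I (Suc n)" "y' \<in> \<Gamma> n" "d n y' = b \<odot>\<^bsub>C (Suc n)\<^esub> v" by blast
    note c = Gc[OF y'(3)] K(1)[OF y'(2)]
    show "(r \<odot>\<^bsub>C (Suc n)\<^esub> v, r \<odot>\<^bsub>C n\<^esub> y) \<in> ?Y"
      by (rule YI[of _ "r \<odot>\<^bsub>C n\<^esub> y'"])
        (use y' c aR bR r K(4) \<Gamma>_D(4) in \<open>simp_all add: Cm.smult_assoc1[symmetric] m_comm\<close>)
  next
    fix v assume v: "v \<in> ker_colon I (Suc n)"
    then obtain y where "y \<in> \<Gamma> n" "d n y = b \<odot>\<^bsub>C (Suc n)\<^esub> v"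
      using b unfolding ker_colon_def by (force simp: tbnd_Suc)
    then show "\<exists>y. (v, y) \<in> ?Y" using YI[OF refl v] by blast
  next
    fix w y assume w: "w \<in> \<Gamma> n" and "(d n w, y) \<in> ?Y"
    then obtain y' where y': "y = a \<odot>\<^bsub>C n\<^esub> y'" "y' \<in> \<Gamma> n" "d n y' = b \<odot>\<^bsub>C (Suc n)\<^esub> d n w" by blast
    note c = Gc[OF w] Gc[OF y'(2)]
    have "y' \<ominus>\<^bsub>C n\<^esub> b \<odot>\<^bsub>C n\<^esub> w \<in> tcyc n"
      using \<Gamma>_D(6)[OF y'(2) \<Gamma>_D(4)[OF bR w]] y'(3) c bR unfolding tcyc_def by (simp add: Cm.M.minus_self)
    then have "a \<odot>\<^bsub>C n\<^esub> (y' \<ominus>\<^bsub>C n\<^esub> b \<odot>\<^bsub>C n\<^esub> w) \<in> tbnd n" by (rule kill[OF a])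
    then show "y \<ominus>\<^bsub>C n\<^esub> (a \<otimes> b) \<odot>\<^bsub>C n\<^esub> w \<in> tbnd n"
      using y'(1) c aR bR by (simp add: Cm.smult_minus_distr Cm.smult_assoc1)
  qed
qed

lemma lifts_add:
  assumes I: "I \<subseteq> carrier R" and s: "s \<in> carrier R" and t: "t \<in> carrier R"
    and S: "lifts I n s S" and T: "lifts I n t T"
  shows "\<exists>Y. lifts I n (s \<oplus> t) Y"
proof
  note K = Cm.submoduleD[OF ker_colon_submodule[OF I]]
  have S1: "v \<in> ker_colon I (Suc n)" "y \<in> \<Gamma> n" "d n y = s \<odot>\<^bsub>C (Suc n)\<^esub> v" if "(v, y) \<in> S" for v y
    using liftsD(1)[OF S that] by simp_all
  have T1: "v \<in> ker_colon I (Suc n)" "y \<in> \<Gamma> n" "d n y = t \<odot>\<^bsub>C (Suc n)\<^esub> v" if "(v, y) \<in> T" for v y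
    using liftsD(1)[OF T that] by simp_all
  let ?Y = "{(v, y \<oplus>\<^bsub>C n\<^esub> y') | v y y'. (v, y) \<in> S \<and> (v, y') \<in> T}"
  have YI: "(v, z) \<in> ?Y" if "z = y \<oplus>\<^bsub>C n\<^esub> y'" "(v, y) \<in> S" "(v, y') \<in> T" for v y y' z
    using that by blast
  note Gc = \<Gamma>_D(1)
  show "lifts I n (s \<oplus> t) ?Y"
    unfolding lifts_def
  proof (intro conjI allI impI ballI)
    fix v z assume "(v, z) \<in> ?Y"
    then obtain y y' where y: "z = y \<oplus>\<^bsub>C n\<^esub> y'" "(v, y) \<in> S" "(v, y') \<in> T" by blast
    note yS = S1[OF y(2)] and yT = T1[OF y(3)]
    show "v \<in> ker_colon I (Suc n)" "z \<in> \<Gamma> n" using y(1) yS yT \<Gamma>_D(3) by auto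
    show "d n z = (s \<oplus> t) \<odot>\<^bsub>C (Suc n)\<^esub> v"
      using y(1) yS(3) yT(3) Gc[OF yS(2)] Gc[OF yT(2)] s t K(1)[OF yS(1)] by (simp add: Cm.smult_l_distr)
  next
    fix v z v1 z1 assume "(v, z) \<in> ?Y" "(v1, z1) \<in> ?Y"
    then obtain y y' y1 y1' where y: "z = y \<oplus>\<^bsub>C n\<^esub> y'" "(v, y) \<in> S" "(v, y') \<in> T"
      "z1 = y1 \<oplus>\<^bsub>C n\<^esub> y1'" "(v1, y1) \<in> S" "(v1, y1') \<in> T" by blast
    note c = Gc[OF S1(2)[OF y(2)]] Gc[OF T1(2)[OF y(3)]] Gc[OF S1(2)[OF y(5)]] Gc[OF T1(2)[OF y(6)]]
    have "(v \<oplus>\<^bsub>C (Suc n)\<^esub> v1, y \<oplus>\<^bsub>C n\<^esub> y1) \<in> S" "(v \<oplus>\<^bsub>C (Suc n)\<^esub> v1, y' \<oplus>\<^bsub>C n\<^esub> y1') \<in> T"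
      by (rule liftsD(2)[OF S y(2,5)], rule liftsD(2)[OF T y(3,6)])
    then show "(v \<oplus>\<^bsub>C (Suc n)\<^esub> v1, z \<oplus>\<^bsub>C n\<^esub> z1) \<in> ?Y"
      by (rule YI[rotated]) (use y c in \<open>simp add: Cm.M.a_ac\<close>)
  next
    fix r v z assume r: "r \<in> carrier R" and "(v, z) \<in> ?Y"
    then obtain y y' where y: "z = y \<oplus>\<^bsub>C n\<^esub> y'" "(v, y) \<in> S" "(v, y') \<in> T" by blast
    note c = Gc[OF S1(2)[OF y(2)]] Gc[OF T1(2)[OF y(3)]]
    have "(r \<odot>\<^bsub>C (Suc n)\<^esub> v, r \<odot>\<^bsub>C n\<^esub> y) \<in> S" "(r \<odot>\<^bsub>C (Suc n)\<^esub> v, r \<odot>\<^bsub>C n\<^esub> y') \<in> T"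
      by (rule liftsD(3)[OF S r y(2)], rule liftsD(3)[OF T r y(3)])
    then show "(r \<odot>\<^bsub>C (Suc n)\<^esub> v, r \<odot>\<^bsub>C n\<^esub> z) \<in> ?Y"
      by (rule YI[rotated]) (use y c r in \<open>simp add: Cm.smult_r_distr\<close>)
  next
    fix v assume v: "v \<in> ker_colon I (Suc n)"
    obtain y where "(v, y) \<in> S" using liftsD(4)[OF S v] by blast
    moreover obtain y' where "(v, y') \<in> T" using liftsD(4)[OF T v] by blast
    ultimately show "\<exists>y. (v, y) \<in> ?Y" by blast
  next
    fix w z assume w: "w \<in> \<Gamma> n" and "(d n w, z) \<in> ?Y"
    then obtain y y' where y: "z = y \<oplus>\<^bsub>C n\<^esub> y'" "(d n w, y) \<in> S" "(d n w, y') \<in> T" by blast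
    note c = Gc[OF S1(2)[OF y(2)]] Gc[OF T1(2)[OF y(3)]] Gc[OF w]
    have "y \<ominus>\<^bsub>C n\<^esub> s \<odot>\<^bsub>C n\<^esub> w \<in> tbnd n" by (rule liftsD(5)[OF S w y(2)])
    moreover have "y' \<ominus>\<^bsub>C n\<^esub> t \<odot>\<^bsub>C n\<^esub> w \<in> tbnd n" by (rule liftsD(5)[OF T w y(3)])
    ultimately have "(y \<ominus>\<^bsub>C n\<^esub> s \<odot>\<^bsub>C n\<^esub> w) \<oplus>\<^bsub>C n\<^esub> (y' \<ominus>\<^bsub>C n\<^esub> t \<odot>\<^bsub>C n\<^esub> w) \<in> tbnd n"
      by (rule tbnd_D(3))
    then show "z \<ominus>\<^bsub>C n\<^esub> (s \<oplus> t) \<odot>\<^bsub>C n\<^esub> w \<in> tbnd n"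
      using y(1) c s t by (simp add: Cm.smult_l_distr Cm.M.minus_add_distrib)
  qed
qed

text \<open>The hypothesis on the square of \<open>I\<close> is the origin of the factor 2 in the
  exponent: each product needs one factor for the existence of preimages and one for their
  uniqueness.\<close>

lemma ex_lifts:
  assumes kill: "\<And>a z. a \<in> I \<Longrightarrow> z \<in> tcyc n \<Longrightarrow> a \<odot>\<^bsub>C n\<^esub> z \<in> tbnd n"
    and I: "ideal I R" and t: "t \<in> I \<cdot> I"
  shows "\<exists>Y. lifts I n t Y"
  using t
proof (induction t rule: ideal_prod.induct)
  case (prod a b)
  then show ?case using lifts_prod[OF kill] I unfolding ideal_crit by blast
next
  case (sum s t)
  have "I \<subseteq> carrier R" using I unfolding ideal_crit by blast
  moreover have "s \<in> carrier R" "t \<in> carrier R" using sum.hyps ideal_prod_in_carrier[OF I I] by auto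
  ultimately show ?case using sum.IH lifts_add by blast
qed

end

section \<open>Colon submodules of cohomology modules\<close>

lemma zero_colon_submodule:
  assumes "module R N" "I \<subseteq> carrier R"
  shows "submodule {z \<in> carrier N. \<forall>a\<in>I. a \<odot>\<^bsub>N\<^esub> z = \<zero>\<^bsub>N\<^esub>} R N"
proof -
  interpret N: module R N by fact
  have "a \<odot>\<^bsub>N\<^esub> (r \<odot>\<^bsub>N\<^esub> z) = r \<odot>\<^bsub>N\<^esub> (a \<odot>\<^bsub>N\<^esub> z)" if "a \<in> I" "r \<in> carrier R" "z \<in> carrier N" for a r z
  proof -
    have "a \<in> carrier R" using that assms(2) by blast
    then show ?thesis using that by (simp add: N.smult_assoc1[symmetric] N.R.m_comm)
  qed
  then show ?thesis
    unfolding N.submodule_crit using assms(2) by (auto simp: subset_eq N.smult_r_distr)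
qed

lemma zero_colon_module: "module R N \<Longrightarrow> I \<subseteq> carrier R \<Longrightarrow> module R (zero_colon N I)"
  unfolding zero_colon_def using module.submodule_module[OF _ zero_colon_submodule] by blast

lemma zero_colon_kills: "kills I N \<Longrightarrow> zero_colon N I = N"
proof -
  assume "kills I N"
  then have "{z \<in> carrier N. \<forall>a\<in>I. a \<odot>\<^bsub>N\<^esub> z = \<zero>\<^bsub>N\<^esub>} = carrier N" unfolding kills_def by auto
  then show ?thesis unfolding zero_colon_def by simp
qed

lemma zero_colon_simps [simp]:
  "\<zero>\<^bsub>zero_colon N I\<^esub> = \<zero>\<^bsub>N\<^esub>" "a \<oplus>\<^bsub>zero_colon N I\<^esub> b = a \<oplus>\<^bsub>N\<^esub> b" "r \<odot>\<^bsub>zero_colon N I\<^esub> a = r \<odot>\<^bsub>N\<^esub> a"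
  by (simp_all add: zero_colon_def)

lemma (in baer_complex) carrier_zero_colon_H:
  assumes "I \<subseteq> carrier R"
  shows "carrier (zero_colon (H n) I) = hc n ` ker_colon I n"
proof -
  have "b \<odot>\<^bsub>H n\<^esub> hc n v = \<zero>\<^bsub>H n\<^esub> \<longleftrightarrow> b \<odot>\<^bsub>C n\<^esub> v \<in> tbnd n" if "b \<in> I" "v \<in> tcyc n" for b v
  proof -
    have "b \<in> carrier R" using that assms by blast
    then show ?thesis using that tcyc_D(4) by (simp add: hc_smult hc_eq_zero)
  qed
  then show ?thesis unfolding zero_colon_def ker_colon_def by (auto simp: carrier_H)
qed

section \<open>The isomorphism onto the part of the cohomology of M/xM killed by
  \<open>I\<close>\<close>

context torsion_annihilator
begin

lemma \<phi>_tors: "z \<in> C.\<Gamma> n \<Longrightarrow> \<phi> n z \<in> D.\<Gamma> n"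
  by (rule C.mod_hom_tors[OF C.C_module D.C_module \<phi>_hom])

lemma \<tau>_tors: "z \<in> C.\<Gamma> (Suc n) \<Longrightarrow> \<tau> n z \<in> D.\<Gamma> n"
  by (rule C.mod_hom_tors[OF C.C_module D.C_module \<tau>_hom])

lemma \<phi>_tbnd: "z \<in> C.tbnd n \<Longrightarrow> \<phi> n z \<in> D.tbnd n"
proof -
  assume "z \<in> C.tbnd n"
  then obtain e where e: "e \<in> tors R \<mm> (C.pobj n)" "z = C.pd n e" unfolding C.tbnd_pd by blast
  have "e \<in> carrier (C.pobj n)" using e(1) by (simp add: tors_def)
  then have "\<phi> n z = D.pd n (\<phi>p n e)" using e(2) \<phi>_pd by simp
  moreover have "\<phi>p n e \<in> tors R \<mm> (D.pobj n)"
    by (rule C.mod_hom_tors[OF C.pobj_module D.pobj_module \<phi>p_hom e(1)])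
  ultimately show "\<phi> n z \<in> D.tbnd n" unfolding D.tbnd_pd by blast
qed

text \<open>The homotopy rewrites \<open>\<tau> (d w)\<close> as \<open>x \<phi> w\<close> minus a
  coboundary, and \<open>y\<close> differs from \<open>x w\<close> by a coboundary. So the chosen
  section is trivial on coboundaries.\<close>

lemma lifts_bnd:
  assumes Y: "C.lifts I i x Y" and w: "w \<in> C.\<Gamma> i" and y: "(diff C i w, y) \<in> Y"
  shows "\<tau> i (diff C i w) \<ominus>\<^bsub>obj D i\<^esub> \<phi> i y \<in> D.tbnd i"
proof -
  have wc: "w \<in> carrier (obj C i)" using w C.\<Gamma>_D(1) by blast
  have yc: "y \<in> carrier (obj C i)" using C.liftsD(1)[OF Y y] C.\<Gamma>_D(1) by blast
  let ?b = "y \<ominus>\<^bsub>obj C i\<^esub> x \<odot>\<^bsub>obj C i\<^esub> w" and ?p = "D.pd i (\<tau>p i w)"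
  have b: "?b \<in> C.tbnd i" by (rule C.liftsD(5)[OF Y w y])
  have "\<tau>p i w \<in> tors R \<mm> (D.pobj i)" by (rule C.mod_hom_tors[OF C.C_module D.pobj_module \<tau>p_hom w])
  then have p: "?p \<in> D.tbnd i" unfolding D.tbnd_pd by blast
  note pc = D.tbnd_D(1)[OF p]
  have pb: "?p \<oplus>\<^bsub>obj D i\<^esub> \<phi> i ?b \<in> D.tbnd i" by (rule D.tbnd_D(3)[OF p \<phi>_tbnd[OF b]])
  have "(x \<odot>\<^bsub>obj D i\<^esub> \<phi> i w \<ominus>\<^bsub>obj D i\<^esub> ?p) \<ominus>\<^bsub>obj D i\<^esub> \<phi> i y
      = \<ominus>\<^bsub>obj D i\<^esub> (?p \<oplus>\<^bsub>obj D i\<^esub> \<phi> i ?b)"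
    using wc yc pc x
    by (simp add: D.Cm.M.minus_eq D.Cm.M.minus_add D.Cm.M.a_ac)
  then show ?thesis using D.tbnd_D(5)[OF pb] homotopy[OF wc] by simp
qed

text \<open>The map \<open>(v, c') |-> \<tau> v - \<phi> c'\<close> of
  \<open>connecting_injective\<close> at \<open>c' = y - c\<close>: the chosen \<open>y\<close>
  gives a section over \<open>v\<close>, and the cocycle \<open>c\<close> moves along the
  fibre.\<close>

definition splitting :: "nat \<Rightarrow> 'e \<Rightarrow> 'e \<Rightarrow> 'e \<Rightarrow> 'f" where
  "splitting i c v y = \<phi> i c \<oplus>\<^bsub>obj D i\<^esub> (\<tau> i v \<ominus>\<^bsub>obj D i\<^esub> \<phi> i y)"

definition related :: "nat \<Rightarrow> ('e \<times> 'e) set \<Rightarrow> 'f \<Rightarrow> 'e \<Rightarrow> 'e \<Rightarrow> 'e \<Rightarrow> bool" where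
  "related i Y u c v y \<longleftrightarrow> u \<in> D.tcyc i \<and> c \<in> C.tcyc i \<and> (v, y) \<in> Y
     \<and> u \<ominus>\<^bsub>obj D i\<^esub> splitting i c v y \<in> D.tbnd i"

context
  fixes I i Y
  assumes I: "ideal I R" and Y: "C.lifts I i x Y"
    and kill: "\<And>a z. a \<in> I \<Longrightarrow> z \<in> C.tcyc i \<Longrightarrow> a \<odot>\<^bsub>obj C i\<^esub> z \<in> C.tbnd i"
begin

lemma I_carrier: "I \<subseteq> carrier R"
  using I unfolding C.ideal_crit by blast

lemma Y_D:
  assumes "(v, y) \<in> Y"
  shows "v \<in> C.ker_colon I (Suc i)" "y \<in> C.\<Gamma> i" "diff C i y = x \<odot>\<^bsub>obj C (Suc i)\<^esub> v"
    "v \<in> C.tcyc (Suc i)" "v \<in> carrier (obj C (Suc i))" "y \<in> carrier (obj C i)" "v \<in> C.\<Gamma> (Suc i)"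
    "diff C (Suc i) v = \<zero>\<^bsub>obj C (Suc (Suc i))\<^esub>"
proof -
  show *: "v \<in> C.ker_colon I (Suc i)" "y \<in> C.\<Gamma> i" "diff C i y = x \<odot>\<^bsub>obj C (Suc i)\<^esub> v"
    using C.liftsD(1)[OF Y assms] by simp_all
  show v: "v \<in> C.tcyc (Suc i)" using *(1) unfolding C.ker_colon_def by blast
  show "v \<in> carrier (obj C (Suc i))" using C.tcyc_D(1)[OF v] .
  show "y \<in> carrier (obj C i)" using C.\<Gamma>_D(1)[OF *(2)] .
  show "v \<in> C.\<Gamma> (Suc i)" "diff C (Suc i) v = \<zero>\<^bsub>obj C (Suc (Suc i))\<^esub>" using v unfolding C.tcyc_def by auto
qed

lemma Y_add: "(v, y) \<in> Y \<Longrightarrow> (v', y') \<in> Y \<Longrightarrow> (v \<oplus>\<^bsub>obj C (Suc i)\<^esub> v', y \<oplus>\<^bsub>obj C i\<^esub> y') \<in> Y"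
  and Y_smult: "r \<in> carrier R \<Longrightarrow> (v, y) \<in> Y \<Longrightarrow> (r \<odot>\<^bsub>obj C (Suc i)\<^esub> v, r \<odot>\<^bsub>obj C i\<^esub> y) \<in> Y"
  and Y_total: "v \<in> C.ker_colon I (Suc i) \<Longrightarrow> \<exists>y. (v, y) \<in> Y"
  and Y_bnd: "w \<in> C.\<Gamma> i \<Longrightarrow> (diff C i w, y) \<in> Y \<Longrightarrow> y \<ominus>\<^bsub>obj C i\<^esub> x \<odot>\<^bsub>obj C i\<^esub> w \<in> C.tbnd i"
  using C.liftsD(2-5)[OF Y] by blast+

lemma splitting_add:
  assumes "c \<in> C.tcyc i" "(v, y) \<in> Y" "c' \<in> C.tcyc i" "(v', y') \<in> Y"
  shows "splitting i (c \<oplus>\<^bsub>obj C i\<^esub> c') (v \<oplus>\<^bsub>obj C (Suc i)\<^esub> v') (y \<oplus>\<^bsub>obj C i\<^esub> y')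
    = splitting i c v y \<oplus>\<^bsub>obj D i\<^esub> splitting i c' v' y'"
  unfolding splitting_def
  using Y_D(5,6)[OF assms(2)] Y_D(5,6)[OF assms(4)] C.tcyc_D(1)[OF assms(1)] C.tcyc_D(1)[OF assms(3)]
  by (simp add: D.Cm.M.minus_eq D.Cm.M.minus_add D.Cm.M.a_ac)

lemma splitting_smult:
  assumes "c \<in> C.tcyc i" "(v, y) \<in> Y" "r \<in> carrier R"
  shows "splitting i (r \<odot>\<^bsub>obj C i\<^esub> c) (r \<odot>\<^bsub>obj C (Suc i)\<^esub> v) (r \<odot>\<^bsub>obj C i\<^esub> y)
    = r \<odot>\<^bsub>obj D i\<^esub> splitting i c v y"
  unfolding splitting_def
  using Y_D(5,6)[OF assms(2)] C.tcyc_D(1)[OF assms(1)] assms(3)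
  by (simp add: D.Cm.smult_r_distr D.Cm.smult_minus_distr)

lemma splitting_tcyc:
  assumes c: "c \<in> C.tcyc i" and v: "(v, y) \<in> Y"
  shows "splitting i c v y \<in> D.tcyc i"
proof -
  note y = Y_D[OF v] and cc = C.tcyc_D(1)[OF c]
  have c': "c \<in> C.\<Gamma> i" "diff C i c = \<zero>\<^bsub>obj C (Suc i)\<^esub>" using c unfolding C.tcyc_def by auto
  have "x \<odot>\<^bsub>obj D (Suc i)\<^esub> \<phi> (Suc i) v \<ominus>\<^bsub>obj D (Suc i)\<^esub> diff D i (\<tau> i v) = \<zero>\<^bsub>obj D (Suc i)\<^esub>"
    using homotopy[OF y(5)] y(8) by simp
  then have \<tau>v: "diff D i (\<tau> i v) = x \<odot>\<^bsub>obj D (Suc i)\<^esub> \<phi> (Suc i) v"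
    using D.Cm.M.minus_eq_zeroD[of "x \<odot>\<^bsub>obj D (Suc i)\<^esub> \<phi> (Suc i) v" "Suc i" "diff D i (\<tau> i v)"] y(5) x by simp
  have "diff D i (splitting i c v y) = \<zero>\<^bsub>obj D (Suc i)\<^esub>"
    unfolding splitting_def using cc y(3,5,6) c'(2) \<tau>v x
    by (simp add: \<phi>_diff[symmetric] D.Cm.M.minus_self)
  moreover have "splitting i c v y \<in> D.\<Gamma> i"
    unfolding splitting_def
    by (intro D.\<Gamma>_D(3) D.\<Gamma>_D(6) \<phi>_tors \<tau>_tors c'(1) y(2,7))
  ultimately show ?thesis unfolding D.tcyc_def by blast
qed

lemma splitting_tbnd:
  assumes c: "c \<in> C.tbnd i" and v: "(v, y) \<in> Y" "v \<in> C.tbnd (Suc i)"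
  shows "splitting i c v y \<in> D.tbnd i"
proof -
  obtain w where w: "w \<in> C.\<Gamma> i" "v = diff C i w" using v(2) by (auto simp: C.tbnd_Suc)
  show ?thesis
    unfolding splitting_def using lifts_bnd[OF Y w(1)] v(1) w(2) \<phi>_tbnd[OF c] by (intro D.tbnd_D(3)) auto
qed

lemma related_tbnd_iff:
  assumes "related i Y u c v y"
  shows "u \<in> D.tbnd i \<longleftrightarrow> splitting i c v y \<in> D.tbnd i"
proof -
  have uc: "u \<in> carrier (obj D i)" using assms D.tcyc_D(1) unfolding related_def by blast
  have sc: "splitting i c v y \<in> carrier (obj D i)"
    using assms splitting_tcyc D.tcyc_D(1) unfolding related_def by blast
  have b: "u \<ominus>\<^bsub>obj D i\<^esub> splitting i c v y \<in> D.tbnd i" using assms unfolding related_def by blast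
  have 1: "(u \<ominus>\<^bsub>obj D i\<^esub> splitting i c v y) \<oplus>\<^bsub>obj D i\<^esub> splitting i c v y = u"
    using uc sc by (simp add: D.Cm.M.minus_add_cancel)
  have 2: "u \<ominus>\<^bsub>obj D i\<^esub> (u \<ominus>\<^bsub>obj D i\<^esub> splitting i c v y) = splitting i c v y"
    using uc sc by (simp add: D.Cm.M.minus_minus_cancel)
  show ?thesis using D.tbnd_D(3)[OF b] D.tbnd_D(6)[OF _ b] 1 2 by metis
qed

lemma related_smult:
  assumes "related i Y u c v y" "r \<in> carrier R"
  shows "related i Y (r \<odot>\<^bsub>obj D i\<^esub> u) (r \<odot>\<^bsub>obj C i\<^esub> c) (r \<odot>\<^bsub>obj C (Suc i)\<^esub> v) (r \<odot>\<^bsub>obj C i\<^esub> y)"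
proof -
  have *: "u \<in> D.tcyc i" "c \<in> C.tcyc i" "(v, y) \<in> Y" "u \<ominus>\<^bsub>obj D i\<^esub> splitting i c v y \<in> D.tbnd i"
    using assms unfolding related_def by auto
  note sc = D.tcyc_D(1)[OF splitting_tcyc[OF *(2,3)]] D.tcyc_D(1)[OF *(1)]
  show ?thesis
    unfolding related_def splitting_smult[OF *(2,3) assms(2)]
    using D.tcyc_D(4)[OF assms(2) *(1)] C.tcyc_D(4)[OF assms(2) *(2)] Y_smult[OF assms(2) *(3)]
      D.tbnd_D(4)[OF assms(2) *(4)] sc assms(2)
    by (simp add: D.Cm.smult_minus_distr)
qed

lemma related_add:
  assumes "related i Y u c v y" "related i Y u' c' v' y'"
  shows "related i Y (u \<oplus>\<^bsub>obj D i\<^esub> u') (c \<oplus>\<^bsub>obj C i\<^esub> c') (v \<oplus>\<^bsub>obj C (Suc i)\<^esub> v') (y \<oplus>\<^bsub>obj C i\<^esub> y')"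
proof -
  have *: "u \<in> D.tcyc i" "c \<in> C.tcyc i" "(v, y) \<in> Y" "u \<ominus>\<^bsub>obj D i\<^esub> splitting i c v y \<in> D.tbnd i"
    and **: "u' \<in> D.tcyc i" "c' \<in> C.tcyc i" "(v', y') \<in> Y" "u' \<ominus>\<^bsub>obj D i\<^esub> splitting i c' v' y' \<in> D.tbnd i"
    using assms unfolding related_def by auto
  note sc = D.tcyc_D(1)[OF splitting_tcyc[OF *(2,3)]] D.tcyc_D(1)[OF *(1)]
    D.tcyc_D(1)[OF splitting_tcyc[OF **(2,3)]] D.tcyc_D(1)[OF **(1)]
  show ?thesis
    unfolding related_def splitting_add[OF *(2,3) **(2,3)]
    using D.tcyc_D(3)[OF *(1) **(1)] C.tcyc_D(3)[OF *(2) **(2)] Y_add[OF *(3) **(3)]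
      D.tbnd_D(3)[OF *(4) **(4)] sc
    by (simp add: D.Cm.M.minus_add_distrib)
qed

text \<open>The relation is linear, and multiplication by \<open>b\<close> turns both
  \<open>c\<close> and \<open>v\<close> into coboundaries. So the cocycles reached have classes
  killed by \<open>I\<close>.\<close>

lemma related_killed:
  assumes r: "related i Y u c v y" and b: "b \<in> I"
  shows "b \<odot>\<^bsub>obj D i\<^esub> u \<in> D.tbnd i"
proof -
  have bR: "b \<in> carrier R" using b I_carrier by blast
  have *: "c \<in> C.tcyc i" "(v, y) \<in> Y" using r unfolding related_def by auto
  have "b \<odot>\<^bsub>obj C (Suc i)\<^esub> v \<in> C.tbnd (Suc i)" using Y_D(1)[OF *(2)] b unfolding C.ker_colon_def by blast
  then show ?thesis
    using related_tbnd_iff[OF related_smult[OF r bR]] splitting_tbnd[OF kill[OF b *(1)] Y_smult[OF bR *(2)]]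
    by blast
qed

lemma related_right:
  assumes "c \<in> C.tcyc i" "v \<in> C.ker_colon I (Suc i)"
  shows "\<exists>u y. related i Y u c v y"
proof -
  obtain y where y: "(v, y) \<in> Y" using Y_total[OF assms(2)] by blast
  note s = splitting_tcyc[OF assms(1) y]
  have "related i Y (splitting i c v y) c v y"
    unfolding related_def using s assms(1) y D.tcyc_D(1)[OF s] D.tbnd_D(2) by (simp add: D.Cm.M.minus_self)
  then show ?thesis by blast
qed

text \<open>Surjectivity provides a pair \<open>(v, c')\<close>; what has to be seen is that
  \<open>I\<close> kills the class of \<open>v\<close>. The first alternative serves the
  isomorphism, the second serves \<open>kills_H_quotient\<close>.\<close>

lemma related_left:
  assumes u: "u \<in> D.tcyc i"
    and alt: "(\<forall>b\<in>I. b \<odot>\<^bsub>obj D i\<^esub> u \<in> D.tbnd i) \<or> C.tcyc (Suc i) \<subseteq> C.ker_colon I (Suc i)"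
  shows "\<exists>c v y. related i Y u c v y"
proof -
  obtain v c' where v: "v \<in> C.tcyc (Suc i)" and c': "c' \<in> C.\<Gamma> i" "diff C i c' = x \<odot>\<^bsub>obj C (Suc i)\<^esub> v"
    and b: "u \<ominus>\<^bsub>obj D i\<^esub> (\<tau> i v \<ominus>\<^bsub>obj D i\<^esub> \<phi> i c') \<in> D.tbnd i"
    using connecting_surjective[OF u] by blast
  note uc = D.tcyc_D(1)[OF u] and vc = C.tcyc_D(1)[OF v] and c'c = C.\<Gamma>_D(1)[OF c'(1)]
  let ?s = "\<tau> i v \<ominus>\<^bsub>obj D i\<^esub> \<phi> i c'"
  have sc: "?s \<in> carrier (obj D i)" using vc c'c by simp
  have vI: "v \<in> C.ker_colon I (Suc i)"
    using alt
  proof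
    assume kb: "\<forall>b\<in>I. b \<odot>\<^bsub>obj D i\<^esub> u \<in> D.tbnd i"
    \<comment> \<open>The pair \<open>(a v, a c')\<close> is sent to a coboundary, so injectivity
      makes \<open>a v\<close> a coboundary.\<close>
    have "a \<odot>\<^bsub>obj C (Suc i)\<^esub> v \<in> C.tbnd (Suc i)" if a: "a \<in> I" for a
    proof -
      have aR: "a \<in> carrier R" using a I_carrier by blast
      have "a \<odot>\<^bsub>obj D i\<^esub> u \<ominus>\<^bsub>obj D i\<^esub> a \<odot>\<^bsub>obj D i\<^esub> (u \<ominus>\<^bsub>obj D i\<^esub> ?s) \<in> D.tbnd i"
        using D.tbnd_D(6)[OF _ D.tbnd_D(4)[OF aR b]] kb a by blast
      moreover have "a \<odot>\<^bsub>obj D i\<^esub> u \<ominus>\<^bsub>obj D i\<^esub> a \<odot>\<^bsub>obj D i\<^esub> (u \<ominus>\<^bsub>obj D i\<^esub> ?s) = a \<odot>\<^bsub>obj D i\<^esub> ?s"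
        using uc sc aR D.Cm.smult_minus_distr[OF aR uc sc] by (simp add: D.Cm.M.minus_minus_cancel)
      ultimately have "\<tau> i (a \<odot>\<^bsub>obj C (Suc i)\<^esub> v) \<ominus>\<^bsub>obj D i\<^esub> \<phi> i (a \<odot>\<^bsub>obj C i\<^esub> c') \<in> D.tbnd i"
        using vc c'c aR by (simp add: D.Cm.smult_minus_distr)
      moreover have "diff C i (a \<odot>\<^bsub>obj C i\<^esub> c') = x \<odot>\<^bsub>obj C (Suc i)\<^esub> (a \<odot>\<^bsub>obj C (Suc i)\<^esub> v)"
        using c' c'c vc aR x by (simp add: C.Cm.smult_assoc1[symmetric] C.m_comm)
      ultimately obtain w where "w \<in> C.\<Gamma> i" "a \<odot>\<^bsub>obj C (Suc i)\<^esub> v = diff C i w"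
        using connecting_injective[OF C.tcyc_D(4)[OF aR v] C.\<Gamma>_D(4)[OF aR c'(1)]] by blast
      then show ?thesis by (simp add: C.tbnd_Suc)
    qed
    then show ?thesis using v unfolding C.ker_colon_def by blast
  next
    assume "C.tcyc (Suc i) \<subseteq> C.ker_colon I (Suc i)"
    then show ?thesis using v by blast
  qed
  obtain y where y: "(v, y) \<in> Y" using Y_total[OF vI] by blast
  note yD = Y_D[OF y]
  \<comment> \<open>Both \<open>y\<close> and \<open>c'\<close> have differential
    \<open>x v\<close>. Their difference is the required \<open>c\<close>, for which
    \<open>splitting\<close> returns \<open>\<tau> v - \<phi> c'\<close>.\<close>
  have "y \<ominus>\<^bsub>obj C i\<^esub> c' \<in> C.tcyc i"
    using C.\<Gamma>_D(6)[OF yD(2) c'(1)] yD(3,5,6) c'(2) c'c x unfolding C.tcyc_def by (simp add: C.Cm.M.minus_self)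
  moreover have "splitting i (y \<ominus>\<^bsub>obj C i\<^esub> c') v y = ?s"
  proof -
    have "splitting i (y \<ominus>\<^bsub>obj C i\<^esub> c') v y = ?s \<oplus>\<^bsub>obj D i\<^esub> (\<phi> i y \<oplus>\<^bsub>obj D i\<^esub> \<ominus>\<^bsub>obj D i\<^esub> \<phi> i y)"
      unfolding splitting_def using yD(6) c'c vc by (simp add: D.Cm.M.minus_eq D.Cm.M.a_ac)
    then show ?thesis using yD(6) sc by (simp add: D.Cm.M.r_neg)
  qed
  ultimately have "related i Y u (y \<ominus>\<^bsub>obj C i\<^esub> c') v y" unfolding related_def using u y b by simp
  then show ?thesis by blast
qed

text \<open>Injectivity is applied to the pair \<open>(v, y - c)\<close>. It gives
  \<open>v = d w\<close> and makes \<open>(y - c) - x w\<close> a coboundary, while the choice of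
  \<open>Y\<close> makes \<open>y - x w\<close> one.\<close>

lemma related_zero_left:
  assumes r: "related i Y u c v y" and u: "u \<in> D.tbnd i"
  shows "c \<in> C.tbnd i" "v \<in> C.tbnd (Suc i)"
proof -
  have *: "c \<in> C.tcyc i" "(v, y) \<in> Y" using r unfolding related_def by auto
  note yD = Y_D[OF *(2)] and cc = C.tcyc_D(1)[OF *(1)]
  have cG: "c \<in> C.\<Gamma> i" "diff C i c = \<zero>\<^bsub>obj C (Suc i)\<^esub>" using *(1) unfolding C.tcyc_def by auto
  have "\<tau> i v \<ominus>\<^bsub>obj D i\<^esub> \<phi> i (y \<ominus>\<^bsub>obj C i\<^esub> c) = splitting i c v y"
    unfolding splitting_def using yD(5,6) cc by (simp add: D.Cm.M.minus_eq D.Cm.M.minus_add D.Cm.M.a_ac)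
  also have "\<dots> \<in> D.tbnd i" using related_tbnd_iff[OF r] u by blast
  finally have s: "\<tau> i v \<ominus>\<^bsub>obj D i\<^esub> \<phi> i (y \<ominus>\<^bsub>obj C i\<^esub> c) \<in> D.tbnd i" .
  have "diff C i (y \<ominus>\<^bsub>obj C i\<^esub> c) = x \<odot>\<^bsub>obj C (Suc i)\<^esub> v"
    using yD(3,5,6) cc cG(2) x by (simp add: C.Cm.M.minus_zero_right)
  then obtain w where w: "w \<in> C.\<Gamma> i" "v = diff C i w"
    "(y \<ominus>\<^bsub>obj C i\<^esub> c) \<ominus>\<^bsub>obj C i\<^esub> x \<odot>\<^bsub>obj C i\<^esub> w \<in> C.tbnd i"
    using connecting_injective[OF yD(4) C.\<Gamma>_D(6)[OF yD(2) cG(1)] _ s] by blast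
  show "v \<in> C.tbnd (Suc i)" using w by (simp add: C.tbnd_Suc)
  have wc: "w \<in> carrier (obj C i)" using C.\<Gamma>_D(1)[OF w(1)] .
  let ?q = "y \<ominus>\<^bsub>obj C i\<^esub> x \<odot>\<^bsub>obj C i\<^esub> w"
  have q: "?q \<in> C.tbnd i" using Y_bnd[OF w(1)] *(2) w(2) by simp
  \<comment> \<open>This exhibits \<open>c\<close> as a difference of two coboundaries.\<close>
  have "?q \<ominus>\<^bsub>obj C i\<^esub> ((y \<ominus>\<^bsub>obj C i\<^esub> c) \<ominus>\<^bsub>obj C i\<^esub> x \<odot>\<^bsub>obj C i\<^esub> w)
      = ?q \<ominus>\<^bsub>obj C i\<^esub> (?q \<ominus>\<^bsub>obj C i\<^esub> c)"
    using yD(6) cc wc x by (simp add: C.Cm.M.minus_eq C.Cm.M.a_ac)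
  also have "\<dots> = c" using C.tbnd_D(1)[OF q] cc by (simp add: C.Cm.M.minus_minus_cancel)
  finally show "c \<in> C.tbnd i" using C.tbnd_D(6)[OF q w(3)] by simp
qed

lemma related_zero_right:
  assumes r: "related i Y u c v y" and "c \<in> C.tbnd i" "v \<in> C.tbnd (Suc i)"
  shows "u \<in> D.tbnd i"
  using related_tbnd_iff[OF r] splitting_tbnd[OF assms(2) _ assms(3)] r unfolding related_def by blast

text \<open>\<open>related\<close> depends on representatives and on \<open>y\<close>. On classes it
  becomes single-valued in both directions, by \<open>related_zero_left\<close> and
  \<open>related_zero_right\<close>.\<close>

theorem splitting_isomorphism:
  "mod_isomorphic R (zero_colon (D.H i) I) (mod_sum (C.H i) (zero_colon (C.H (Suc i)) I))"
proof -
  define G where "G = {(D.hc i u, (C.hc i c, C.hc (Suc i) v)) | u c v. \<exists>y. related i Y u c v y}"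
  have GI: "(U, (P, V)) \<in> G" if "related i Y u c v y" "U = D.hc i u" "P = C.hc i c" "V = C.hc (Suc i) v"
    for U P V u c v y using that unfolding G_def by blast
  have GE: "\<exists>u c v y. related i Y u c v y \<and> U = D.hc i u \<and> Z = (C.hc i c, C.hc (Suc i) v)" if "(U, Z) \<in> G" for U Z
    using that unfolding G_def by blast
  have relD: "u \<in> D.tcyc i" "c \<in> C.tcyc i" "v \<in> C.tcyc (Suc i)" "v \<in> C.ker_colon I (Suc i)" "u \<in> D.ker_colon I i"
    if "related i Y u c v y" for u c v y
    using that Y_D(1,4) related_killed[OF that] unfolding related_def D.ker_colon_def by auto
  note carr = C.carrier_zero_colon_H[OF I_carrier] D.carrier_zero_colon_H[OF I_carrier]
  show ?thesis
  proof (rule mod_isomorphic_graph[of R _ _ G])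
    show "module R (zero_colon (D.H i) I)" by (rule zero_colon_module[OF D.H_module I_carrier])
    show "module R (mod_sum (C.H i) (zero_colon (C.H (Suc i)) I))"
      by (rule mod_sum_module[OF C.H_module zero_colon_module[OF C.H_module I_carrier]])
    show "G \<subseteq> carrier (zero_colon (D.H i) I) \<times> carrier (mod_sum (C.H i) (zero_colon (C.H (Suc i)) I))"
    proof
      fix g assume "g \<in> G"
      then obtain u c v y where r: "related i Y u c v y" and g: "g = (D.hc i u, (C.hc i c, C.hc (Suc i) v))"
        unfolding G_def by blast
      show "g \<in> carrier (zero_colon (D.H i) I) \<times> carrier (mod_sum (C.H i) (zero_colon (C.H (Suc i)) I))"
        using relD[OF r] unfolding g by (simp add: carr mod_sum_def C.carrier_H)
    qed
  next
    fix U Z U' Z' assume "(U, Z) \<in> G" "(U', Z') \<in> G"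
    then obtain u c v y u' c' v' y' where r: "related i Y u c v y" "related i Y u' c' v' y'"
      and e: "U = D.hc i u" "Z = (C.hc i c, C.hc (Suc i) v)" "U' = D.hc i u'" "Z' = (C.hc i c', C.hc (Suc i) v')"
      using GE by metis
    note rD = relD[OF r(1)] relD[OF r(2)]
    have "Z \<oplus>\<^bsub>mod_sum (C.H i) (zero_colon (C.H (Suc i)) I)\<^esub> Z'
        = (C.hc i (c \<oplus>\<^bsub>obj C i\<^esub> c'), C.hc (Suc i) (v \<oplus>\<^bsub>obj C (Suc i)\<^esub> v'))"
      unfolding e using rD by (simp add: mod_sum_def C.hc_add)
    moreover have "U \<oplus>\<^bsub>zero_colon (D.H i) I\<^esub> U' = D.hc i (u \<oplus>\<^bsub>obj D i\<^esub> u')"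
      unfolding e using rD by (simp add: D.hc_add)
    ultimately show "(U \<oplus>\<^bsub>zero_colon (D.H i) I\<^esub> U', Z \<oplus>\<^bsub>mod_sum (C.H i) (zero_colon (C.H (Suc i)) I)\<^esub> Z') \<in> G"
      using GI[OF related_add[OF r]] by simp
  next
    fix r U Z assume rR: "r \<in> carrier R" and "(U, Z) \<in> G"
    then obtain u c v y where r: "related i Y u c v y" and e: "U = D.hc i u" "Z = (C.hc i c, C.hc (Suc i) v)"
      using GE by metis
    note rD = relD[OF r]
    have "r \<odot>\<^bsub>mod_sum (C.H i) (zero_colon (C.H (Suc i)) I)\<^esub> Z
        = (C.hc i (r \<odot>\<^bsub>obj C i\<^esub> c), C.hc (Suc i) (r \<odot>\<^bsub>obj C (Suc i)\<^esub> v))"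
      unfolding e using rD rR by (simp add: mod_sum_def C.hc_smult)
    moreover have "r \<odot>\<^bsub>zero_colon (D.H i) I\<^esub> U = D.hc i (r \<odot>\<^bsub>obj D i\<^esub> u)"
      unfolding e using rD rR by (simp add: D.hc_smult)
    ultimately show "(r \<odot>\<^bsub>zero_colon (D.H i) I\<^esub> U, r \<odot>\<^bsub>mod_sum (C.H i) (zero_colon (C.H (Suc i)) I)\<^esub> Z) \<in> G"
      using GI[OF related_smult[OF r rR]] by simp
  next
    fix U assume "U \<in> carrier (zero_colon (D.H i) I)"
    then obtain u where u: "u \<in> D.ker_colon I i" "U = D.hc i u" unfolding carr by blast
    then obtain c v y where "related i Y u c v y"
      using related_left[of u] unfolding D.ker_colon_def by blast
    then show "\<exists>Z. (U, Z) \<in> G" using GI u(2) by blast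
  next
    fix Z assume "Z \<in> carrier (mod_sum (C.H i) (zero_colon (C.H (Suc i)) I))"
    then obtain c v where cv: "c \<in> C.tcyc i" "v \<in> C.ker_colon I (Suc i)" "Z = (C.hc i c, C.hc (Suc i) v)"
      by (auto simp: mod_sum_def carr C.carrier_H)
    then obtain u y where "related i Y u c v y" using related_right by blast
    then show "\<exists>U. (U, Z) \<in> G" using GI cv(3) by blast
  next
    fix Z assume "(\<zero>\<^bsub>zero_colon (D.H i) I\<^esub>, Z) \<in> G"
    then obtain u c v y where r: "related i Y u c v y" and e: "\<zero>\<^bsub>D.H i\<^esub> = D.hc i u" "Z = (C.hc i c, C.hc (Suc i) v)"
      using GE by (metis zero_colon_simps(1))
    have "u \<in> D.tbnd i" using e(1) D.hc_eq_zero[OF relD(1)[OF r]] by simp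
    then have "C.hc i c = \<zero>\<^bsub>C.H i\<^esub>" "C.hc (Suc i) v = \<zero>\<^bsub>C.H (Suc i)\<^esub>"
      using related_zero_left[OF r] C.hc_eq_zero relD[OF r] by auto
    then show "Z = \<zero>\<^bsub>mod_sum (C.H i) (zero_colon (C.H (Suc i)) I)\<^esub>" using e(2) by (simp add: mod_sum_def)
  next
    fix U assume "(U, \<zero>\<^bsub>mod_sum (C.H i) (zero_colon (C.H (Suc i)) I)\<^esub>) \<in> G"
    then have "(U, (\<zero>\<^bsub>C.H i\<^esub>, \<zero>\<^bsub>C.H (Suc i)\<^esub>)) \<in> G" by (simp add: mod_sum_def)
    then obtain u c v y where r: "related i Y u c v y" and e: "U = D.hc i u"
      "(\<zero>\<^bsub>C.H i\<^esub>, \<zero>\<^bsub>C.H (Suc i)\<^esub>) = (C.hc i c, C.hc (Suc i) v)"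
      using GE by metis
    have "c \<in> C.tbnd i" "v \<in> C.tbnd (Suc i)" using e(2) C.hc_eq_zero relD[OF r] by auto
    then have "D.hc i u = \<zero>\<^bsub>D.H i\<^esub>" using related_zero_right[OF r] D.hc_eq_zero relD[OF r] by blast
    then show "U = \<zero>\<^bsub>zero_colon (D.H i) I\<^esub>" using e(1) by simp
  qed
qed

text \<open>The long exact sequence alone would give only that the square of \<open>I\<close> kills
  \<open>D.H i\<close>. Here every cocycle of \<open>D\<close> is related to a triple, so
  \<open>I\<close> itself kills its class.\<close>

lemma kills_H_quotient:
  assumes "kills I (C.H (Suc i))"
  shows "kills I (D.H i)"
proof -
  have "C.tcyc (Suc i) \<subseteq> C.ker_colon I (Suc i)"
    using assms C.kills_H[OF I_carrier] unfolding C.ker_colon_def by blast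
  then show ?thesis using related_left related_killed unfolding D.kills_H[OF I_carrier] by blast
qed

end

end

theorem corollary4p1:
  fixes R :: "('a, 'r) ring_scheme" and \<mm> :: "'a set" and M :: "('a, 'm) module"
    and \<epsilon> :: "'m \<Rightarrow> 'e" and C :: "('a, 'e) cochain_complex"
    and x :: 'a and \<eta> :: "'m set \<Rightarrow> 'f" and D :: "('a, 'f) cochain_complex"
    and d n\<^sub>0 :: nat
  assumes "noetherian_local_ring R \<mm>"
    and "injective_resolution R M \<epsilon> C"
    and "generalized_Cohen_Macaulay R \<mm> M C d"
    and "n\<^sub>0 = (LEAST n. 0 < n \<and>
            (\<forall>i<d. kills (ideal_power R \<mm> n) (local_cohomology R \<mm> C i)))"
    and "parameter_element R \<mm> M x"
    and "x \<in> ideal_power R \<mm> (2 * n\<^sub>0)"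
    and "injective_resolution R (mod_quot M (mod_smult_image x M)) \<eta> D"
  shows "(\<forall>i<d - 1. mod_isomorphic R (local_cohomology R \<mm> D i)
            (mod_sum (local_cohomology R \<mm> C i) (local_cohomology R \<mm> C (i + 1))))
    \<and> mod_isomorphic R
        (zero_colon (local_cohomology R \<mm> D (d - 1)) (ideal_power R \<mm> n\<^sub>0))
        (mod_sum (local_cohomology R \<mm> C (d - 1))
          (zero_colon (local_cohomology R \<mm> C d) (ideal_power R \<mm> n\<^sub>0)))"
proof -
  interpret noeth_local_ring R \<mm>
    by (intro noeth_local_ring.intro noeth_local_ring_axioms.intro assms(1))
      (use assms(1) in \<open>simp add: noetherian_local_ring_def\<close>)
  have M: "module R M" and d: "0 < d"
    using assms(3) unfolding generalized_Cohen_Macaulay_def finitely_generated_module_def by auto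
  interpret C: resolved_module R \<mm> M \<epsilon> C
    by (intro resolved_module.intro resolved_module_axioms.intro noeth_local_ring_axioms M assms(2))
  have xR: "x \<in> carrier R" using assms(5) mm_carrier unfolding parameter_element_def by blast
  interpret D: resolved_module R \<mm> "mod_quot M (mod_smult_image x M)" \<eta> D
    by (intro resolved_module.intro resolved_module_axioms.intro noeth_local_ring_axioms assms(7)
        mod_quot_module[OF M mod_smult_image_submodule[OF M xR]])
  interpret torsion_annihilator R \<mm> M \<epsilon> C x \<eta> D
  proof (intro torsion_annihilator.intro quotient_resolutions.intro quotient_resolutions_axioms.intro
      torsion_annihilator_axioms.intro)
    show "u \<in> tors R \<mm> M" if "u \<in> carrier M" "x \<odot>\<^bsub>M\<^esub> u = \<zero>\<^bsub>M\<^esub>" for u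
      by (rule C.annihilator_parameter_torsion[OF assms(3,5) that])
  qed (rule C.resolved_module_axioms D.resolved_module_axioms xR)+
  let ?I = "ideal_power R \<mm> n\<^sub>0"
  have I: "ideal ?I R" by (rule ideal_power_ideal[OF ideal_mm])
  have Ic: "?I \<subseteq> carrier R" using I unfolding ideal_crit by blast
  have "\<exists>n. 0 < n \<and> (\<forall>i<d. kills (ideal_power R \<mm> n) (local_cohomology R \<mm> C i))"
    using assms(3) unfolding generalized_Cohen_Macaulay_def by blast
  \<comment> \<open>Of the minimality of \<open>n\<^sub>0\<close> only this is drawn: the exponent
    itself has the annihilation property.\<close>
  from LeastI_ex[OF this, folded assms(4)] have kills: "kills ?I (C.H i)" if "i < d" for i
    using that by (simp add: C.local_cohomology_eq)
  have x: "x \<in> ?I \<cdot>\<^bsub>R\<^esub> ?I" using assms(6) ideal_power_add[OF ideal_mm, of n\<^sub>0 n\<^sub>0] by (simp add: mult_2)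
  have iso: "mod_isomorphic R (zero_colon (D.H i) ?I) (mod_sum (C.H i) (zero_colon (C.H (Suc i)) ?I))"
    and killsD: "kills ?I (C.H (Suc i)) \<Longrightarrow> kills ?I (D.H i)" if i: "i < d" for i
  proof -
    have kill: "\<And>a z. a \<in> ?I \<Longrightarrow> z \<in> C.tcyc i \<Longrightarrow> a \<odot>\<^bsub>obj C i\<^esub> z \<in> C.tbnd i"
      using kills[OF i] C.kills_H[OF Ic] by blast
    obtain Y where Y: "C.lifts ?I i x Y" using C.ex_lifts[OF kill I x] by blast
    show "mod_isomorphic R (zero_colon (D.H i) ?I) (mod_sum (C.H i) (zero_colon (C.H (Suc i)) ?I))"
      by (rule splitting_isomorphism[OF I Y kill])
    show "kills ?I (D.H i)" if "kills ?I (C.H (Suc i))"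
      by (rule kills_H_quotient[OF I Y kill that])
  qed
  show ?thesis
    unfolding C.local_cohomology_eq D.local_cohomology_eq
  proof (intro conjI allI impI)
    fix i assume i: "i < d - 1"
    \<comment> \<open>Below degree \<open>d - 1\<close> the ideal kills \<open>H (Suc i)\<close> and
      hence also the cohomology of M/xM, so both colon submodules are the whole modules.\<close>
    then have k: "kills ?I (C.H (Suc i))" by (intro kills) simp
    then show "mod_isomorphic R (D.H i) (mod_sum (C.H i) (C.H (i + 1)))"
      using iso[of i] killsD[of i] i by (simp add: zero_colon_kills)
  next
    \<comment> \<open>In the top case \<open>Suc i = d\<close>, where the hypothesis says nothing
      about annihilation; the colon submodules remain.\<close>
    show "mod_isomorphic R (zero_colon (D.H (d - 1)) ?I) (mod_sum (C.H (d - 1)) (zero_colon (C.H d) ?I))"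
      using iso[of "d - 1"] d by simp
  qed
qed

end
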